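(* For every $y_0\in\mathcal A_0$, the function $y\mapsto S(y_0,y)$ is coercive, i.e. $S(y_0,y)\to+\infty$ as $|y|\to+\infty$, and it is a viscosity solution of the critical equation $H_0(y,Du)=c_0$ in $\mathbb R^M$.
   Context: Standing assumptions. $N,M$ are positive integers; $A$ is a compact subset of a Euclidean space; $f:\mathbb R^N\times\mathbb R^M\times A\to\mathbb R^N$, $g:\mathbb R^N\times\mathbb R^M\times A\to\mathbb R^M$, $\ell:\mathbb R^N\times\mathbb R^M\times A\to\mathbb R$ are continuous. (1) There is $L_0>0$ with $|f(x_1,y_1,a)-f(x_2,y_2,a)|\le L_0(|x_1-x_2|+|y_1-y_2|)$ and $|g(x_1,y_1,a)-g(x_2,y_2,a)|\le L_0(|x_1-x_2|+|y_1-y_2|)$ for all $(x_i,y_i)$ and $a\in A$; $|f|$ is bounded, with upper bound $Q_0$. (2) For any compact $K\subset\mathbb R^N\times\mathbb R^M$ there is $r=r(K)>0$ such that $B(0,r)\subset\overline{\mathrm{co}}\,g(x,y,A)$ for all $(x,y)\in K$, where $g(x,y,A)=\{g(x,y,a)\mid a\in A\}$. (3) For any compact $B\subset\mathbb R^N$, $\lim_{|y|\to+\infty}\min_{(x,a)\in B\times A}\ell(x,y,a)=+\infty$. Let $H(x,y,p,q)=\max_{a\in A}\{-p\cdot f(x,y,a)-q\cdot g(x,y,a)-\ell(x,y,a)\}$. Fix $(x_0,p_0)\in\mathbb R^N\times\mathbb R^N$ and set $H_0(y,q)=H(x_0,y,p_0,q)$ for $(y,q)\in\mathbb R^M\times\mathbb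 R^M$. The critical value is $c_0=\inf\{b\in\mathbb R\mid H_0(y,Du)=b\text{ admits a viscosity subsolution in }\mathbb R^M\}$ (a finite number). Let $Z(y)=\{q\in\mathbb R^M\mid H_0(y,q)\le c_0\}$, $\sigma(y,v)=\max\{q\cdot v\mid q\in Z(y)\}$, and $$S(y_1,y_2)=\inf\Big\{\int_0^1\sigma(\xi,\dot\xi)\,ds\ \Big|\ \xi:[0,1]\to\mathbb R^M\text{ Lipschitz curve},\ \xi(0)=y_1,\ \xi(1)=y_2\Big\}.$$ The Aubry set $\mathcal A_0$ is the set of $y_0\in\mathbb R^M$ satisfying any of the following (equivalent) properties: (i) there is a sequence of cycles $\xi_n:[0,1]\to\mathbb R^M$ based on $y_0$ ($\xi_n(0)=\xi_n(1)=y_0$) with $\inf_n\int_0^1\sigma(\xi_n,\dot\xi_n)\,ds=0$ and $\inf_n\int_0^1|\dot\xi_n|\,ds>0$; (ii) $y\mapsto S(y_0,y)$ is a viscosity solution of $H_0=c_0$ in the whole of $\mathbb R^M$; (iii) no function that satisfies $H_0(y,Du)\le c_0-\delta$ in the viscosity sense in a neighborhood of $y_0$ for some $\delta>0$ can be a subsolution of $H_0=c_0$ in $\mathbb R^M$. *)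

theory Defs
  imports "HOL-Analysis.Analysis"
begin

text \<open>The supremum is a maximum when \<open>A\<close> is nonempty and compact and the data are continuous in
  the control.\<close>

definition hamiltonian ::
  "('n::euclidean_space \<Rightarrow> 'm::euclidean_space \<Rightarrow> 'a \<Rightarrow> 'n) \<Rightarrow> ('n \<Rightarrow> 'm \<Rightarrow> 'a \<Rightarrow> 'm) \<Rightarrow>
   ('n \<Rightarrow> 'm \<Rightarrow> 'a \<Rightarrow> real) \<Rightarrow> 'a set \<Rightarrow> 'n \<Rightarrow> 'm \<Rightarrow> 'n \<Rightarrow> 'm \<Rightarrow> real" where
  "hamiltonian f g l A x y p q =
     (SUP a\<in>A. - (p \<bullet> f x y a) - q \<bullet> g x y a - l x y a)"

text \<open>Below, \<open>F y q\<close> is a Hamiltonian on \<open>\<real>\<^sup>M \<times> \<real>\<^sup>M\<close>, and \<open>F(y, Du) = b\<close> is considered in an open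
  set \<open>U\<close>. Subsolutions are upper semicontinuous, supersolutions lower semicontinuous, and
  solutions are both (hence continuous). Test functions are of class \<open>C\<^sup>1\<close> in \<open>U\<close>.\<close>

definition C1_gradient_on ::
  "'m::euclidean_space set \<Rightarrow> ('m \<Rightarrow> real) \<Rightarrow> ('m \<Rightarrow> 'm) \<Rightarrow> bool" where
  "C1_gradient_on U \<phi> D\<phi> \<longleftrightarrow> (\<forall>z\<in>U. GDERIV \<phi> z :> D\<phi> z) \<and> continuous_on U D\<phi>"

definition usc_on :: "'m::euclidean_space set \<Rightarrow> ('m \<Rightarrow> real) \<Rightarrow> bool" where
  "usc_on U u \<longleftrightarrow> (\<forall>y\<in>U. \<forall>t>u y. \<forall>\<^sub>F z in at y within U. u z < t)"

definition lsc_on :: "'m::euclidean_space set \<Rightarrow> ('m \<Rightarrow> real) \<Rightarrow> bool" where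
  "lsc_on U u \<longleftrightarrow> (\<forall>y\<in>U. \<forall>t<u y. \<forall>\<^sub>F z in at y within U. t < u z)"

definition viscosity_subsolution ::
  "('m::euclidean_space \<Rightarrow> 'm \<Rightarrow> real) \<Rightarrow> real \<Rightarrow> 'm set \<Rightarrow> ('m \<Rightarrow> real) \<Rightarrow> bool" where
  "viscosity_subsolution F b U u \<longleftrightarrow>
     usc_on U u \<and>
     (\<forall>\<phi> D\<phi> y. C1_gradient_on U \<phi> D\<phi> \<and> y \<in> U \<and>
        (\<forall>\<^sub>F z in at y within U. u z - \<phi> z \<le> u y - \<phi> y) \<longrightarrow> F y (D\<phi> y) \<le> b)"

definition viscosity_supersolution ::
  "('m::euclidean_space \<Rightarrow> 'm \<Rightarrow> real) \<Rightarrow> real \<Rightarrow> 'm set \<Rightarrow> ('m \<Rightarrow> real) \<Rightarrow> bool" where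
  "viscosity_supersolution F b U u \<longleftrightarrow>
     lsc_on U u \<and>
     (\<forall>\<phi> D\<phi> y. C1_gradient_on U \<phi> D\<phi> \<and> y \<in> U \<and>
        (\<forall>\<^sub>F z in at y within U. u z - \<phi> z \<ge> u y - \<phi> y) \<longrightarrow> F y (D\<phi> y) \<ge> b)"

definition viscosity_solution ::
  "('m::euclidean_space \<Rightarrow> 'm \<Rightarrow> real) \<Rightarrow> real \<Rightarrow> 'm set \<Rightarrow> ('m \<Rightarrow> real) \<Rightarrow> bool" where
  "viscosity_solution F b U u \<longleftrightarrow>
     viscosity_subsolution F b U u \<and> viscosity_supersolution F b U u"

definition critical_value :: "('m::euclidean_space \<Rightarrow> 'm \<Rightarrow> real) \<Rightarrow> real" where
  "critical_value F = Inf {b. \<exists>u. viscosity_subsolution F b UNIV u}"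

definition critical_sublevel :: "('m::euclidean_space \<Rightarrow> 'm \<Rightarrow> real) \<Rightarrow> 'm \<Rightarrow> 'm set" where
  "critical_sublevel F y = {q. F y q \<le> critical_value F}"

definition support_fn :: "('m::euclidean_space \<Rightarrow> 'm \<Rightarrow> real) \<Rightarrow> 'm \<Rightarrow> 'm \<Rightarrow> real" where
  "support_fn F y v = (SUP q\<in>critical_sublevel F y. q \<bullet> v)"

definition lipschitz_curve :: "(real \<Rightarrow> 'm::euclidean_space) \<Rightarrow> 'm \<Rightarrow> 'm \<Rightarrow> bool" where
  "lipschitz_curve \<xi> y1 y2 \<longleftrightarrow> (\<exists>L. L-lipschitz_on {0..1} \<xi>) \<and> \<xi> 0 = y1 \<and> \<xi> 1 = y2"

text \<open>A Lipschitz curve is differentiable almost everywhere; at the remaining times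
  \<^const>\<open>vector_derivative\<close> is unspecified, which does not affect the integrals.\<close>

definition velocity :: "(real \<Rightarrow> 'm::euclidean_space) \<Rightarrow> real \<Rightarrow> 'm" where
  "velocity \<xi> s = vector_derivative \<xi> (at s within {0..1})"

definition intrinsic_length ::
  "('m::euclidean_space \<Rightarrow> 'm \<Rightarrow> real) \<Rightarrow> (real \<Rightarrow> 'm) \<Rightarrow> real" where
  "intrinsic_length F \<xi> = integral {0..1} (\<lambda>s. support_fn F (\<xi> s) (velocity \<xi> s))"

definition euclidean_length :: "(real \<Rightarrow> 'm::euclidean_space) \<Rightarrow> real" where
  "euclidean_length \<xi> = integral {0..1} (\<lambda>s. norm (velocity \<xi> s))"

definition intrinsic_dist ::
  "('m::euclidean_space \<Rightarrow> 'm \<Rightarrow> real) \<Rightarrow> 'm \<Rightarrow> 'm \<Rightarrow> real" where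
  "intrinsic_dist F y1 y2 = Inf {intrinsic_length F \<xi> | \<xi>. lipschitz_curve \<xi> y1 y2}"

text \<open>The three characterizations of the Aubry set are equivalent for the Hamiltonians of interest.
  That equivalence is a theorem, not part of the definition, so a point is admitted as soon as it
  has any one of the three properties.\<close>

definition aubry_cycles :: "('m::euclidean_space \<Rightarrow> 'm \<Rightarrow> real) \<Rightarrow> 'm \<Rightarrow> bool" where
  "aubry_cycles F y0 \<longleftrightarrow>
     (\<exists>\<xi> :: nat \<Rightarrow> real \<Rightarrow> 'm.
        (\<forall>n. lipschitz_curve (\<xi> n) y0 y0) \<and>
        (INF n. intrinsic_length F (\<xi> n)) = 0 \<and>
        (INF n. euclidean_length (\<xi> n)) > 0)"

definition aubry_solution :: "('m::euclidean_space \<Rightarrow> 'm \<Rightarrow> real) \<Rightarrow> 'm \<Rightarrow> bool" where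
  "aubry_solution F y0 \<longleftrightarrow>
     viscosity_solution F (critical_value F) UNIV (intrinsic_dist F y0)"

definition aubry_no_strict :: "('m::euclidean_space \<Rightarrow> 'm \<Rightarrow> real) \<Rightarrow> 'm \<Rightarrow> bool" where
  "aubry_no_strict F y0 \<longleftrightarrow>
     \<not> (\<exists>u U \<delta>. \<delta> > 0 \<and> open U \<and> y0 \<in> U \<and>
          viscosity_subsolution F (critical_value F - \<delta>) U u \<and>
          viscosity_subsolution F (critical_value F) UNIV u)"

definition aubry_set :: "('m::euclidean_space \<Rightarrow> 'm \<Rightarrow> real) \<Rightarrow> 'm set" where
  "aubry_set F = {y0. aubry_cycles F y0 \<or> aubry_solution F y0 \<or> aubry_no_strict F y0}"

end

theory Submission
  imports Defs
begin

text \<open>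
  Let \<open>Z y\<close> be the critical sublevel at \<open>y\<close>, \<open>\<sigma>\<close> its support function and \<open>S\<close> the intrinsic distance.
  Everything rests on a duality: \<open>S y0 y\<close> is the largest increment \<open>u y - u y0\<close> of a critical
  subsolution \<open>u\<close>. That increments are bounded by lengths of curves
  (\<open>subsolution_increment_le_length\<close>) reduces to a pointwise estimate along the curve. A
  subsolution grows along a short segment at most at the rate prescribed by the sublevels nearby
  (\<open>subsolution_increment_along_segment\<close>, a comparison with an explicit test function), and the
  sublevels are upper semicontinuous, so the derivative of \<open>u\<close> along a curve is at most
  \<open>\<sigma>\<close> of position and velocity. Integrating this needs Lebesgue's theorem that Lipschitz functions of one
  variable are differentiable almost everywhere and are integrals of their derivatives; it is derived
  from the Vitali covering theorem and the Henstock lemma (\<open>lipschitz_AE_derivative_real\<close>).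
  Conversely \<open>S y0\<close> is itself a critical subsolution (\<open>intrinsic_dist_subsolution\<close>), because it
  grows along short segments at most at the rate \<open>\<sigma>\<close> and \<open>Z y\<close> is determined by \<open>\<sigma> y\<close>. The
  duality would be empty if no critical subsolution existed; one is obtained as a limit of
  subsolutions at levels decreasing to the critical value (\<open>critical_subsolution_exists\<close>).

  The supersolution property is Perron's argument. A test function touching \<open>S y0\<close> from below at
  \<open>y\<close> with subcritical gradient can be lifted to produce a larger critical subsolution
  (\<open>bump_subsolution\<close>). For \<open>y \<noteq> y0\<close> this contradicts maximality. For \<open>y = y0\<close> it yields a critical
  subsolution that is strict near \<open>y0\<close>, which membership in the Aubry set excludes: directly in the
  characterisation by strict subsolutions, and in the characterisation by cycles because near a point
  of strictness the intrinsic length of a cycle controls its Euclidean length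
  (\<open>length_ge_near_strict_point\<close>).

  Coercivity comes from the growth of the running cost: it makes zero a strictly subcritical
  gradient far away, so a small multiple of \<open>ln (1 + (norm y)\<^sup>2)\<close>, glued to a critical
  subsolution, is a critical subsolution (\<open>coercive_critical_subsolution\<close>), and \<open>S y0\<close> is above it up
  to a constant.
\<close>

section \<open>Lipschitz functions of one real variable: almost everywhere differentiability\<close>

lemma division_increment_sum:
  fixes f :: "real \<Rightarrow> real"
  assumes "a \<le> b" and "q division_of {a..b}"
  shows "(\<Sum>K\<in>q. f (Sup K) - f (Inf K)) = f b - f a"
proof -
  note q = division_ofD[OF assms(2)]
  let ?p = "(\<lambda>K. (Inf K, K)) ` q"
  have ne: "Inf K \<in> K" if Kq: "K \<in> q" for K
  proof -
    obtain c d where "K = cbox c d" using q(4)[OF Kq] by blast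
    with q(3)[OF Kq] show ?thesis by auto
  qed
  have "?p tagged_division_of {a..b}"
  proof (rule tagged_division_ofI)
    show "finite ?p" using q(1) by blast
    show "x \<in> K" if "(x, K) \<in> ?p" for x K using that ne by auto
    show "K \<subseteq> {a..b}" if "(x, K) \<in> ?p" for x K using that q(2) by auto
    show "\<exists>c d. K = cbox c d" if "(x, K) \<in> ?p" for x K using that q(4) by auto
    show "interior K1 \<inter> interior K2 = {}"
      if "(x1, K1) \<in> ?p" "(x2, K2) \<in> ?p" "(x1, K1) \<noteq> (x2, K2)" for x1 K1 x2 K2
      using that q(5) by auto
    have "{K. \<exists>x. (x, K) \<in> ?p} = q" by auto
    then show "\<Union>{K. \<exists>x. (x, K) \<in> ?p} = {a..b}" using q(6) by simp
  qed
  from additive_tagged_division_1[OF assms(1) this, of f]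
  show ?thesis by (simp add: sum.reindex inj_on_def)
qed

text \<open>Through every interior point \<open>x\<close> pass arbitrarily short intervals on which \<open>f\<close> increases almost at
  the rate \<open>U x\<close>. By the Vitali covering theorem finitely many disjoint ones fill \<open>{a..b}\<close> up to a
  small measure; tagged by their points they form a partial division on which the Henstock lemma
  identifies the Riemann sum of \<open>U\<close> with its integral. Monotonicity of \<open>f\<close> and boundedness of \<open>U\<close>
  make the uncovered part harmless.\<close>

lemma integral_le_increment_if_steep_secants:
  fixes f U :: "real \<Rightarrow> real"
  assumes ab: "a \<le> b" and mono: "mono_on {a..b} f"
    and int: "U integrable_on {a..b}"
    and U: "\<And>x. x \<in> {a..b} \<Longrightarrow> 0 \<le> U x \<and> U x \<le> B"
    and sec: "\<And>x e d. x \<in> {a<..<b} \<Longrightarrow> e > 0 \<Longrightarrow> d > 0 \<Longrightarrow>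
      \<exists>p q. p < q \<and> x \<in> {p..q} \<and> q - p < d \<and> (U x - e) * (q - p) \<le> f q - f p"
  shows "integral {a..b} U \<le> f b - f a"
proof (rule field_le_epsilon)
  fix e0 :: real assume e0: "e0 > 0"
  have B0: "0 \<le> B" using U[of a] ab by force
  \<comment> \<open>three errors: the slope defect \<open>e * (b - a)\<close>, the Riemann sum \<open>e\<close>, the uncovered part \<open>B * e\<close>\<close>
  define e where "e = e0 / (b - a + 1 + B)"
  have e: "e > 0" using e0 ab B0 by (simp add: e_def)
  have ee: "e * (b - a + 1 + B) = e0" using ab B0 by (simp add: e_def)
  have int': "U integrable_on cbox a b" using int by simp
  obtain \<gamma> where "gauge \<gamma>"
    and hen: "\<And>p. \<lbrakk>p tagged_partial_division_of (cbox a b); \<gamma> fine p\<rbrakk> \<Longrightarrow>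
             sum (\<lambda>(x,k). norm(measure lborel k *\<^sub>R U x - integral k U)) p < e"
    using Henstock_lemma[OF int' e] by blast
  define J where "J = {(x,p,q). x \<in> {a<..<b} \<and> p < q \<and> x \<in> {p..q} \<and> {p..q} \<subseteq> {a..b} \<inter> \<gamma> x \<and>
      (U x - e) * (q - p) \<le> f q - f p}"
  define ce where "ce = (\<lambda>(x::real,p::real,q::real). (p + q) / 2)"
  define ra where "ra = (\<lambda>(x::real,p::real,q::real). (q - p) / 2)"
  have cb: "cball (ce (x,p,q)) (ra (x,p,q)) = {p..q}" for x p q
    unfolding cball_eq_atLeastAtMost ce_def ra_def by (simp add: field_simps)
  obtain C where C: "countable C" "C \<subseteq> J"
     "pairwise (\<lambda>i j. disjnt (cball (ce i) (ra i)) (cball (ce j) (ra j))) C"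
     "negligible({a<..<b} - (\<Union>i \<in> C. cball (ce i) (ra i)))"
  proof (rule Vitali_covering_theorem_cballs)
    show "0 < ra i" if "i \<in> J" for i using that by (auto simp: J_def ra_def)
    fix x d :: real assume x: "x \<in> {a<..<b}" and d: "0 < d"
    have "open (\<gamma> x \<inter> {a<..<b})" "x \<in> \<gamma> x \<inter> {a<..<b}"
      using \<open>gauge \<gamma>\<close> x by (auto simp: gauge_def)
    then obtain r where r: "r > 0" "ball x r \<subseteq> \<gamma> x \<inter> {a<..<b}"
      by (meson open_contains_ball)
    obtain p q where pq: "p < q" "x \<in> {p..q}" "q - p < min d r" "(U x - e) * (q - p) \<le> f q - f p"
      using sec[OF x e, of "min d r"] r d by auto
    have "{p..q} \<subseteq> ball x r" using pq by (auto simp: dist_real_def)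
    with r have "{p..q} \<subseteq> {a<..<b}" "{p..q} \<subseteq> \<gamma> x" by auto
    moreover have "{a<..<b} \<subseteq> {a..b}" by auto
    ultimately have "{p..q} \<subseteq> {a..b} \<inter> \<gamma> x" by blast
    with r have "(x,p,q) \<in> J" using pq x unfolding J_def by blast
    moreover have "x \<in> cball (ce (x,p,q)) (ra (x,p,q))" unfolding cb using pq by simp
    moreover have "ra (x,p,q) < d" using pq by (simp add: ra_def)
    ultimately show "\<exists>i. i \<in> J \<and> x \<in> cball (ce i) (ra i) \<and> ra i < d" by blast
  qed
  let ?I = "\<lambda>i. cball (ce i) (ra i)"
  have sub: "?I i \<subseteq> {a..b}" if "i \<in> J" for i
    using that by (cases i) (auto simp: cb J_def)
  have subU: "(\<Union>i\<in>C. ?I i) \<subseteq> {a..b}" using sub C by blast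
  have meas: "(\<Union>i\<in>C. ?I i) \<in> lmeasurable"
    by (rule bounded_set_imp_lmeasurable)
      (use subU C in \<open>auto intro!: bounded_subset[OF bounded_closed_interval] sets.countable_UN'\<close>)
  have "b - a \<le> measure lebesgue (\<Union>i\<in>C. ?I i)"
  proof -
    have "measure lebesgue {a<..<b} \<le> measure lebesgue (\<Union>i\<in>C. ?I i)"
    proof (rule measure_mono_fmeasurable[THEN order_trans])
      show "{a<..<b} \<subseteq> (\<Union>i\<in>C. ?I i) \<union> ({a<..<b} - (\<Union>i\<in>C. ?I i))" by blast
      show "(\<Union>i\<in>C. ?I i) \<union> ({a<..<b} - (\<Union>i\<in>C. ?I i)) \<in> lmeasurable"
        using meas C(4) negligible_iff_measure by blast
      show "measure lebesgue ((\<Union>i\<in>C. ?I i) \<union> ({a<..<b} - (\<Union>i\<in>C. ?I i))) \<le> measure lebesgue (\<Union>i\<in>C. ?I i)"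
        using C(4) by (smt (verit, best) meas measure_Un_le negligible_iff_measure fmeasurableD)
    qed auto
    then show ?thesis using ab by simp
  qed
  moreover obtain D' where D': "D' \<subseteq> ?I ` C" "finite D'"
    "measure lebesgue (\<Union>(?I ` C)) - e < measure lebesgue (\<Union>D')"
  proof (rule measure_countable_Union_approachable)
    show "countable (?I ` C)" using C by blast
    show "d \<in> lmeasurable" if "d \<in> ?I ` C" for d using that by auto
    show "measure lebesgue (\<Union>D') \<le> measure lebesgue (\<Union>(?I ` C))" if "D' \<subseteq> ?I ` C" "finite D'" for D'
    proof (rule measure_mono_fmeasurable)
      show "\<Union>D' \<in> sets lebesgue"
        by (rule sets.finite_Union) (use that in auto)
    qed (use that meas in auto)
  qed (use e in auto)
  ultimately have D'2: "b - a - e < measure lebesgue (\<Union>D')" by simp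
  obtain C' where C': "C' \<subseteq> C" "finite C'" "D' = ?I ` C'" using finite_subset_image[OF D'(2,1)] by blast
  define T where "T = (\<lambda>(x,p,q). (x,{p..q})) ` C'"
  have TJ: "\<exists>p q. (x,p,q) \<in> C' \<and> (x,p,q) \<in> J \<and> K = {p..q}" if "(x,K) \<in> T" for x K
  proof -
    have "\<exists>p q. (x,p,q) \<in> C' \<and> K = {p..q}" using that by (auto simp: T_def)
    then show ?thesis using C'(1) C(2) by blast
  qed
  have disj: "K1 \<inter> K2 = {}" if T12: "(x1,K1) \<in> T" "(x2,K2) \<in> T" "(x1,K1) \<noteq> (x2,K2)" for x1 K1 x2 K2
  proof -
    obtain p1 q1 p2 q2 where *: "(x1,p1,q1) \<in> C'" "K1 = {p1..q1}" "(x2,p2,q2) \<in> C'" "K2 = {p2..q2}"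
      using TJ T12 by metis
    then have "(x1,p1,q1) \<noteq> (x2,p2,q2)" using T12 by auto
    then have "disjnt (?I (x1,p1,q1)) (?I (x2,p2,q2))"
      using C(3) C' * unfolding pairwise_def by blast
    then show ?thesis unfolding cb disjnt_def * .
  qed
  have T: "T tagged_partial_division_of cbox a b"
    unfolding tagged_partial_division_of_def
  proof (intro conjI allI impI)
    show "finite T" using C' by (simp add: T_def)
    fix x K assume "(x,K) \<in> T"
    then obtain p q where "(x,p,q) \<in> J" "K = {p..q}" using TJ by blast
    then have *: "x \<in> {p..q}" "{p..q} \<subseteq> {a..b}" "K = {p..q}" unfolding J_def by blast+
    show "x \<in> K" "K \<subseteq> cbox a b" "\<exists>a b. K = cbox a b"
      using * unfolding cbox_interval by blast+
  next
    fix x1 K1 x2 K2 assume "(x1,K1) \<in> T \<and> (x2,K2) \<in> T \<and> (x1,K1) \<noteq> (x2,K2)"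
    then have "K1 \<inter> K2 = {}" using disj by blast
    then show "interior K1 \<inter> interior K2 = {}" by (meson disjoint_iff interior_subset subsetD)
  qed
  have "\<gamma> fine T"
  proof (rule fineI)
    fix x K assume "(x,K) \<in> T"
    then obtain p q where "(x,p,q) \<in> J" "K = {p..q}" using TJ by blast
    then show "K \<subseteq> \<gamma> x" by (auto simp: J_def)
  qed
  note henT = hen[OF T this]
  have snd: "inj_on snd T"
  proof (rule inj_onI, clarsimp)
    fix x1 x2 K assume *: "(x1,K) \<in> T" "(x2,K) \<in> T"
    then have "x1 \<in> K" using tagged_partial_division_ofD(2)[OF T] by blast
    then show "x1 = x2" using disj[OF *] by blast
  qed
  have sndT: "snd ` T = D'" unfolding C'(3) T_def image_image
    by (rule image_cong) (auto simp: cb)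
  obtain Q where Q: "snd ` T \<subseteq> Q" "Q division_of cbox a b"
    using partial_division_extend_interval[OF partial_division_of_tagged_division[OF T]]
      tagged_partial_division_ofD(3)[OF T] by (metis Sup_least imageE prod.collapse)
  note Qd = division_ofD[OF Q(2)]
  have Qab: "Q division_of {a..b}" using Q(2) by simp
  have finQ: "finite Q" by (rule Qd(1))
  have cont: "sum (measure lborel) (Q - D') \<le> e"
  proof -
    have "sum (measure lborel) Q = b - a" using additive_content_division[OF Q(2)] ab by simp
    moreover have "sum (measure lborel) Q = sum (measure lborel) (Q - D') + sum (measure lborel) D'"
      using Q(1) finQ sndT sum.subset_diff by metis
    moreover have "measure lebesgue (\<Union>D') \<le> sum (measure lborel) D'"
    proof -
      have "measure lebesgue (\<Union>D') \<le> sum (measure lebesgue) D'"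
        by (rule measure_Union_le) (use D' in auto)
      also have "\<dots> = sum (measure lborel) D'"
        by (rule sum.cong) (use D'(1) in \<open>auto simp: cball_eq_atLeastAtMost\<close>)
      finally show ?thesis .
    qed
    ultimately show ?thesis using D'2 by linarith
  qed
  have rest: "(\<Sum>K\<in>Q - D'. integral K U) \<le> B * e"
  proof -
    have "integral K U \<le> B * measure lborel K" if "K \<in> Q - D'" for K
    proof -
      have "K \<in> Q" using that by simp
      obtain c d where K: "K = cbox c d" using Qd(4)[OF \<open>K \<in> Q\<close>] by blast
      have KS: "K \<subseteq> {a..b}" using Qd(2)[OF \<open>K \<in> Q\<close>] by simp
      have "integral K U \<le> integral K (\<lambda>x. B)"
        by (rule integral_le) (use KS K U int in \<open>auto intro: integrable_on_subinterval\<close>)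
      also have "\<dots> = B * measure lborel K" unfolding K by simp
      finally show ?thesis .
    qed
    then have "(\<Sum>K\<in>Q - D'. integral K U) \<le> (\<Sum>K\<in>Q - D'. B * measure lborel K)" by (rule sum_mono)
    also have "\<dots> \<le> B * e" unfolding sum_distrib_left[symmetric] using cont B0 by (rule mult_left_mono)
    finally show ?thesis .
  qed
  have endp: "Inf K \<in> {a..b} \<and> Sup K \<in> {a..b} \<and> Inf K \<le> Sup K" if KQ: "K \<in> Q" for K
  proof -
    obtain c d where K: "K = cbox c d" using Qd(4)[OF KQ] by blast
    with Qd(3)[OF KQ] have "c \<le> d" by auto
    with K Qd(2)[OF KQ] show ?thesis by auto
  qed
  have incr: "(\<Sum>K\<in>D'. f (Sup K) - f (Inf K)) \<le> f b - f a"
    unfolding division_increment_sum[OF ab Qab, symmetric]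
    by (rule sum_mono2) (use finQ Q(1) sndT endp mono in \<open>auto simp: mono_on_def\<close>)
  have "(\<Sum>K\<in>D'. integral K U) \<le> (\<Sum>K\<in>D'. f (Sup K) - f (Inf K)) + e * (b - a) + e"
  proof -
    have "(\<Sum>K\<in>D'. integral K U) = (\<Sum>(x,K)\<in>T. integral K U)"
      unfolding sndT[symmetric] using sum.reindex[OF snd, of "\<lambda>K. integral K U"]
      by (simp add: case_prod_unfold)
    also have "\<dots> \<le> (\<Sum>(x,K)\<in>T. norm (measure lborel K *\<^sub>R U x - integral K U) + (f (Sup K) - f (Inf K)) + e * measure lborel K)"
    proof (rule sum_mono, clarify)
      fix x K assume xK: "(x,K) \<in> T"
      obtain p q where "(x,p,q) \<in> J" "K = {p..q}" using TJ[OF xK] by blast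
      then have "U x * measure lborel K \<le> (f (Sup K) - f (Inf K)) + e * measure lborel K" 
        by (auto simp: J_def algebra_simps)
      then show "integral K U \<le> norm (measure lborel K *\<^sub>R U x - integral K U) + (f (Sup K) - f (Inf K)) + e * measure lborel K"
        by (simp add: algebra_simps abs_if)
    qed
    also have "\<dots> = (\<Sum>(x,K)\<in>T. norm (measure lborel K *\<^sub>R U x - integral K U)) + (\<Sum>K\<in>D'. f (Sup K) - f (Inf K)) + e * sum (measure lborel) D'"
      unfolding sndT[symmetric] sum.reindex[OF snd] sum_distrib_left
      by (simp add: case_prod_unfold sum.distrib)
    also have "\<dots> \<le> e + (\<Sum>K\<in>D'. f (Sup K) - f (Inf K)) + e * (b - a)"
    proof -
      have "sum (measure lborel) D' \<le> sum (measure lborel) Q"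
        by (rule sum_mono2) (use finQ Q(1) sndT in auto)
      also have "\<dots> = b - a" using additive_content_division[OF Q(2)] ab by simp
      finally have "e * sum (measure lborel) D' \<le> e * (b - a)" using e by simp
      then show ?thesis using henT by linarith
    qed
    finally show ?thesis by simp
  qed
  moreover have "integral {a..b} U = (\<Sum>K\<in>Q - D'. integral K U) + (\<Sum>K\<in>D'. integral K U)"
    using integral_combine_division_topdown[OF int Qab] sum.subset_diff[OF Q(1) finQ] sndT by metis
  ultimately have "integral {a..b} U \<le> f b - f a + e * (b - a + 1 + B)"
    using rest incr by (simp add: algebra_simps)
  then show "integral {a..b} U \<le> f b - f a + e0" unfolding ee .
qed

text \<open>The larger of the two one-sided upper Dini derivatives.\<close>

definition upper_deriv :: "(real \<Rightarrow> real) \<Rightarrow> real \<Rightarrow> real" where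
  "upper_deriv f x =
     (INF n::nat. SUP h\<in>{h. h \<noteq> 0 \<and> \<bar>h\<bar> < inverse (Suc n)}. (f (x + h) - f x) / h)"

context
  fixes f :: "real \<Rightarrow> real" and L :: real
  assumes lip: "L-lipschitz_on UNIV f"
begin

lemma secant_bound: "\<bar>(f (x + h) - f x) / h\<bar> \<le> L"
proof (cases "h = 0")
  case False
  have "\<bar>f (x + h) - f x\<bar> \<le> L * \<bar>h\<bar>"
    using lipschitz_onD[OF lip, of "x + h" x] by (simp add: dist_real_def)
  with False show ?thesis by (simp add: field_simps)
qed (use lipschitz_on_nonneg[OF lip] in simp)

lemma
  fixes n :: nat
  defines "H \<equiv> {h. h \<noteq> 0 \<and> \<bar>h\<bar> < inverse (real (Suc n))}"
  shows secant_set_nonempty: "H \<noteq> {}"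
    and secant_bdd_above: "bdd_above ((\<lambda>h. (f (x + h) - f x) / h) ` H)"
    and secant_SUP_bound: "\<bar>SUP h\<in>H. (f (x + h) - f x) / h\<bar> \<le> L"
proof -
  have "inverse (Suc n) / 2 \<in> H" by (simp add: H_def)
  then show ne: "H \<noteq> {}" by blast
  show bdd: "bdd_above ((\<lambda>h. (f (x + h) - f x) / h) ` H)"
    by (rule bdd_aboveI2[of _ _ L]) (rule abs_le_D1[OF secant_bound])
  show "\<bar>SUP h\<in>H. (f (x + h) - f x) / h\<bar> \<le> L"
  proof (rule abs_leI)
    show "(SUP h\<in>H. (f (x + h) - f x) / h) \<le> L"
      by (rule cSUP_least[OF ne]) (rule abs_le_D1[OF secant_bound])
    obtain h where h: "h \<in> H" using ne by blast
    have "- L \<le> (f (x + h) - f x) / h" using secant_bound[of x h] by linarith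
    also have "\<dots> \<le> (SUP h\<in>H. (f (x + h) - f x) / h)" by (rule cSUP_upper[OF h bdd])
    finally show "- (SUP h\<in>H. (f (x + h) - f x) / h) \<le> L" by linarith
  qed
qed

lemma secant_SUP_lower:
  "- L \<le> (SUP h\<in>{h. h \<noteq> 0 \<and> \<bar>h\<bar> < inverse (real (Suc n))}. (f (x + h) - f x) / h)"
  using abs_le_D2[OF secant_SUP_bound[where n=n and x=x]] by linarith

lemma secant_SUP_bdd_below:
  "bdd_below (range (\<lambda>n. SUP h\<in>{h. h \<noteq> 0 \<and> \<bar>h\<bar> < inverse (real (Suc n))}. (f (x + h) - f x) / h))"
  by (rule bdd_belowI2[of _ "- L"]) (rule secant_SUP_lower)

lemma upper_deriv_bound: "\<bar>upper_deriv f x\<bar> \<le> L"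
proof (rule abs_leI)
  have "upper_deriv f x \<le> (SUP h\<in>{h. h \<noteq> 0 \<and> \<bar>h\<bar> < inverse (real (Suc 0))}. (f (x + h) - f x) / h)"
    unfolding upper_deriv_def by (rule cINF_lower[OF secant_SUP_bdd_below]) simp
  then show "upper_deriv f x \<le> L" using secant_SUP_bound[where n=0 and x=x] by linarith
  have "- L \<le> upper_deriv f x"
    unfolding upper_deriv_def
    by (rule cINF_greatest[OF UNIV_not_empty secant_SUP_lower])
  then show "- upper_deriv f x \<le> L" by linarith
qed

lemma upper_deriv_approached:
  assumes "e > 0" "d > 0"
  obtains h where "h \<noteq> 0" "\<bar>h\<bar> < d" "upper_deriv f x - e < (f (x + h) - f x) / h"
proof -
  obtain n where n: "inverse (real (Suc n)) < d" using \<open>d > 0\<close> reals_Archimedean by blast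
  have "upper_deriv f x \<le> (SUP h\<in>{h. h \<noteq> 0 \<and> \<bar>h\<bar> < inverse (real (Suc n))}. (f (x + h) - f x) / h)"
    unfolding upper_deriv_def by (rule cINF_lower[OF secant_SUP_bdd_below]) simp
  then have "upper_deriv f x - e < (SUP h\<in>{h. h \<noteq> 0 \<and> \<bar>h\<bar> < inverse (real (Suc n))}. (f (x + h) - f x) / h)"
    using \<open>e > 0\<close> by linarith
  then obtain h where "h \<noteq> 0" "\<bar>h\<bar> < inverse (real (Suc n))" "upper_deriv f x - e < (f (x + h) - f x) / h"
    unfolding less_cSUP_iff[OF secant_set_nonempty secant_bdd_above] by blast
  with n show ?thesis by (intro that[of h]) linarith+
qed

lemma upper_deriv_eventually:
  assumes "e > 0"
  obtains d where "d > 0" "\<And>h. h \<noteq> 0 \<Longrightarrow> \<bar>h\<bar> < d \<Longrightarrow> (f (x + h) - f x) / h < upper_deriv f x + e"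
proof -
  have "upper_deriv f x < upper_deriv f x + e" using assms by simp
  then obtain n where "(SUP h\<in>{h. h \<noteq> 0 \<and> \<bar>h\<bar> < inverse (real (Suc n))}. (f (x + h) - f x) / h) < upper_deriv f x + e"
    using cINF_less_iff[OF _ secant_SUP_bdd_below] unfolding upper_deriv_def by blast
  moreover have "(f (x + h) - f x) / h \<le> (SUP h\<in>{h. h \<noteq> 0 \<and> \<bar>h\<bar> < inverse (real (Suc n))}. (f (x + h) - f x) / h)"
    if "h \<noteq> 0" "\<bar>h\<bar> < inverse (real (Suc n))" for h
    by (rule cSUP_upper[OF _ secant_bdd_above]) (use that in simp)
  ultimately show ?thesis using that[of "inverse (real (Suc n))"] by fastforce
qed

text \<open>For fixed \<open>h\<close> the difference quotient is continuous in \<open>x\<close>, so the inner supremum is lower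
  semicontinuous, hence Borel, although \<open>h\<close> ranges over an uncountable set.\<close>

lemma upper_deriv_borel: "upper_deriv f \<in> borel_measurable borel"
proof -
  have cont: "continuous_on UNIV f" using lip by (rule lipschitz_on_continuous_on)
  have "(\<lambda>x. SUP h\<in>{h. h \<noteq> 0 \<and> \<bar>h\<bar> < inverse (real (Suc n))}. (f (x + h) - f x) / h)
      \<in> borel_measurable borel" for n
  proof (rule borel_measurableI_greater)
    fix t
    have "{x. t < (SUP h\<in>{h. h \<noteq> 0 \<and> \<bar>h\<bar> < inverse (real (Suc n))}. (f (x + h) - f x) / h)}
      = (\<Union>h\<in>{h. h \<noteq> 0 \<and> \<bar>h\<bar> < inverse (real (Suc n))}. {x. t < (f (x + h) - f x) / h})"
      using less_cSUP_iff[OF secant_set_nonempty secant_bdd_above] by auto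
    moreover have "open \<dots>"
      by (intro open_UN ballI open_Collect_less continuous_intros continuous_on_compose2[OF cont]) auto
    ultimately show "{x\<in>space borel. t < (SUP h\<in>{h. h \<noteq> 0 \<and> \<bar>h\<bar> < inverse (real (Suc n))}. (f (x + h) - f x) / h)} \<in> sets borel"
      by simp
  qed
  then show ?thesis unfolding upper_deriv_def by (intro borel_measurable_cINF_real) auto
qed

lemma upper_deriv_integrable: fixes a b :: real shows "upper_deriv f integrable_on {a..b}"
proof (rule measurable_bounded_by_integrable_imp_integrable)
  show "upper_deriv f \<in> borel_measurable (lebesgue_on {a..b})"
    using upper_deriv_borel by (intro measurable_restrict_space1 measurable_completion) simp
  show "(\<lambda>x. L) integrable_on {a..b}" by (rule integrable_const_ivl)
  show "norm (upper_deriv f x) \<le> L" for x using upper_deriv_bound by simp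
qed simp

text \<open>Adding \<open>L * x\<close> to \<open>f\<close> makes it monotone and its upper derivative nonnegative.\<close>

lemma integral_upper_deriv_le:
  fixes a b :: real
  assumes "a \<le> b"
  shows "integral {a..b} (upper_deriv f) \<le> f b - f a"
proof -
  have L: "L \<ge> 0" using lip by (rule lipschitz_on_nonneg)
  have "integral {a..b} (\<lambda>x. upper_deriv f x + L) \<le> (f b + L * b) - (f a + L * a)"
  proof (rule integral_le_increment_if_steep_secants[OF assms])
    show "mono_on {a..b} (\<lambda>x. f x + L * x)"
    proof (rule mono_onI)
      fix r s :: real assume "r \<le> s"
      then have "\<bar>f r - f s\<bar> \<le> L * (s - r)"
        using lipschitz_onD[OF lip, of r s] by (simp add: dist_real_def)
      then show "f r + L * r \<le> f s + L * s" by (simp add: algebra_simps)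
    qed
    show "(\<lambda>x. upper_deriv f x + L) integrable_on {a..b}"
      using upper_deriv_integrable by (intro integrable_add) auto
    show "0 \<le> upper_deriv f x + L \<and> upper_deriv f x + L \<le> 2 * L" for x
      using upper_deriv_bound[of x] by linarith
    fix x e d :: real assume "e > 0" "d > 0"
    then obtain h where h: "h \<noteq> 0" "\<bar>h\<bar> < d" "upper_deriv f x - e < (f (x + h) - f x) / h"
      by (rule upper_deriv_approached)
    define p q where "p = min x (x + h)" and "q = max x (x + h)"
    have "(f (x + h) - f x) / h = (f q - f p) / (q - p)"
      by (cases "h > 0") (auto simp: p_def q_def min_def max_def field_simps)
    with h(3) have "upper_deriv f x - e < (f q - f p) / (q - p)" by simp
    moreover have "p < q" using h(1) by (auto simp: p_def q_def min_def max_def)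
    ultimately have "(upper_deriv f x - e) * (q - p) < f q - f p" by (simp add: field_simps)
    then have "(upper_deriv f x + L - e) * (q - p) \<le> f q + L * q - (f p + L * p)"
      by (simp add: algebra_simps)
    moreover have "x \<in> {p..q}" "q - p < d" using h by (auto simp: p_def q_def)
    ultimately show "\<exists>p q. p < q \<and> x \<in> {p..q} \<and> q - p < d \<and>
        (upper_deriv f x + L - e) * (q - p) \<le> f q + L * q - (f p + L * p)" using \<open>p < q\<close> by blast
  qed
  moreover have "integral {a..b} (\<lambda>x. upper_deriv f x + L) = integral {a..b} (upper_deriv f) + L * (b - a)"
    using assms upper_deriv_integrable by (subst integral_add) auto
  ultimately show ?thesis by (simp add: algebra_simps)
qed

end

text \<open>The upper derivative \<open>U\<close> of \<open>f\<close> dominates the lower derivative \<open>V\<close>, which is minus the upper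
  derivative of \<open>- f\<close>. The integral estimate applied to \<open>f\<close> and to \<open>- f\<close> sandwiches the increment the
  other way round, so \<open>U = V\<close> almost everywhere, and both the differentiability and the
  fundamental theorem of calculus follow at once.\<close>

lemma lipschitz_AE_derivative_real:
  fixes f :: "real \<Rightarrow> real"
  assumes lip: "L-lipschitz_on UNIV f"
  obtains g N where "g \<in> borel_measurable borel" "\<And>x. \<bar>g x\<bar> \<le> L" "negligible N"
    "\<And>x. x \<notin> N \<Longrightarrow> (f has_real_derivative g x) (at x)"
    "\<And>a b. a \<le> b \<Longrightarrow> (g has_integral (f b - f a)) {a..b}"
proof -
  have lip': "L-lipschitz_on UNIV (\<lambda>x. - f x)" using lip by simp
  define U V where "U = upper_deriv f" and "V = (\<lambda>x. - upper_deriv (\<lambda>x. - f x) x)"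
  have V: "upper_deriv (\<lambda>x. - f x) x = - V x" for x by (simp add: V_def)
  define N where "N = {x. U x \<noteq> V x}"
  have VU: "V x \<le> U x" for x
  proof (rule field_le_epsilon)
    fix e :: real assume "e > 0"
    then obtain d where d: "d > 0" "\<And>h. h \<noteq> 0 \<Longrightarrow> \<bar>h\<bar> < d \<Longrightarrow> (f (x + h) - f x) / h < U x + e / 2"
      using upper_deriv_eventually[OF lip, of "e/2" x] unfolding U_def by auto
    obtain d' where d': "d' > 0" "\<And>h. h \<noteq> 0 \<Longrightarrow> \<bar>h\<bar> < d' \<Longrightarrow> (- f (x + h) - - f x) / h < - V x + e / 2"
      using upper_deriv_eventually[OF lip', of "e/2" x] \<open>e > 0\<close> unfolding V_def by auto
    define h where "h = min d d' / 2"
    have "h \<noteq> 0" "\<bar>h\<bar> < d" "\<bar>h\<bar> < d'" using d d' by (auto simp: h_def)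
    from d(2)[OF this(1,2)] d'(2)[OF this(1,3)]
    have "(f (x + h) - f x) / h < U x + e / 2" "- ((f (x + h) - f x) / h) < - V x + e / 2"
      by (simp_all add: minus_divide_left)
    then show "V x \<le> U x + e" by linarith
  qed
  have intU: "U integrable_on {a..b}" for a b unfolding U_def by (rule upper_deriv_integrable[OF lip])
  have intV: "V integrable_on {a..b}" for a b unfolding V_def
    by (intro integrable_neg upper_deriv_integrable[OF lip'])
  have le: "integral {a..b} U \<le> f b - f a" "f b - f a \<le> integral {a..b} V" if "a \<le> b" for a b
    using integral_upper_deriv_le[OF lip that] integral_upper_deriv_le[OF lip' that]
    unfolding U_def V_def by simp_all
  have eq: "integral {a..b} U = f b - f a" "integral {a..b} (\<lambda>x. U x - V x) = 0" if "a \<le> b" for a b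
  proof -
    have "integral {a..b} V \<le> integral {a..b} U" by (rule integral_le[OF intV intU]) (rule VU)
    then show "integral {a..b} U = f b - f a" "integral {a..b} (\<lambda>x. U x - V x) = 0"
      using le[OF that] by (auto simp: integral_diff[OF intU intV])
  qed
  have N: "negligible N"
  proof (rule negligible_on_intervals[THEN iffD2], intro allI)
    fix a b :: real
    show "negligible (N \<inter> cbox a b)"
    proof (cases "a \<le> b")
      case True
      have "negligible {x\<in>{a..b}. U x - V x \<noteq> 0}"
      proof -
        have "(\<lambda>x. U x - V x) absolutely_integrable_on {a..b}"
          by (rule nonnegative_absolutely_integrable_1) (use integrable_diff[OF intU intV] VU in auto)
        then have i: "integrable (lebesgue_on {a..b}) (\<lambda>x. U x - V x)"
          by (simp add: integrable_restrict_space set_integrable_def)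
        have "integral\<^sup>L (lebesgue_on {a..b}) (\<lambda>x. U x - V x) = 0"
          using lebesgue_integral_eq_integral[OF i] eq(2)[OF True] by simp
        then have "AE x in lebesgue_on {a..b}. U x - V x = 0"
          using integral_nonneg_eq_0_iff_AE[OF i] VU by simp
        then have "AE x in lebesgue. x \<in> {a..b} \<longrightarrow> U x - V x = 0"
          by (subst (asm) AE_restrict_space_iff) auto
        then obtain N' where N': "{x \<in> space lebesgue. \<not> (x \<in> {a..b} \<longrightarrow> U x - V x = 0)} \<subseteq> N'"
          "N' \<in> null_sets lebesgue"
          unfolding eventually_ae_filter by blast
        have "negligible N'" using N'(2) by (simp add: negligible_iff_null_sets)
        moreover have "{x\<in>{a..b}. U x - V x \<noteq> 0} \<subseteq> N'" using N'(1) by auto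
        ultimately show ?thesis by (rule negligible_subset)
      qed
      then show ?thesis by (rule negligible_subset) (auto simp: N_def)
    qed auto
  qed
  have deriv: "(f has_real_derivative U x) (at x)" if "x \<notin> N" for x
    unfolding DERIV_def LIM_def
  proof (intro allI impI)
    fix e :: real assume "e > 0"
    have UV: "V x = U x" using that by (simp add: N_def)
    obtain d where d: "d > 0" "\<And>h. h \<noteq> 0 \<Longrightarrow> \<bar>h\<bar> < d \<Longrightarrow> (f (x + h) - f x) / h < U x + e"
      using upper_deriv_eventually[OF lip \<open>e > 0\<close>, of x, folded U_def] by blast
    obtain d' where d': "d' > 0" "\<And>h. h \<noteq> 0 \<Longrightarrow> \<bar>h\<bar> < d' \<Longrightarrow> (- f (x + h) - - f x) / h < - V x + e"
      using upper_deriv_eventually[OF lip' \<open>e > 0\<close>, of x, unfolded V] by blast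
    show "\<exists>s>0. \<forall>h. h \<noteq> 0 \<and> dist h 0 < s \<longrightarrow> dist ((f (x + h) - f x) / h) (U x) < e"
    proof (intro exI[of _ "min d d'"] conjI allI impI)
      fix h :: real assume h: "h \<noteq> 0 \<and> dist h 0 < min d d'"
      then have "(f (x + h) - f x) / h < U x + e" "- ((f (x + h) - f x) / h) < - U x + e"
        using d(2)[of h] d'(2)[of h] by (simp_all add: minus_divide_left UV)
      then show "dist ((f (x + h) - f x) / h) (U x) < e" unfolding dist_real_def by linarith
    qed (use d d' in auto)
  qed
  have int: "(U has_integral (f b - f a)) {a..b}" if "a \<le> b" for a b
    using eq(1)[OF that] integrable_integral[OF intU[of a b]] by simp
  show ?thesis
  proof (rule that[of U N])
    show "U \<in> borel_measurable borel" unfolding U_def by (rule upper_deriv_borel[OF lip])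
    show "\<bar>U x\<bar> \<le> L" for x unfolding U_def by (rule upper_deriv_bound[OF lip])
  qed (fact N deriv int)+
qed

lemma lipschitz_on_interval_AE_derivative:
  fixes \<xi> :: "real \<Rightarrow> 'm::euclidean_space"
  assumes lip: "L-lipschitz_on {a..b} \<xi>" and ab: "a \<le> b"
  obtains v N B where "v \<in> borel_measurable borel" "\<And>s. norm (v s) \<le> B" "negligible N"
    "\<And>s. s \<in> {a<..<b} - N \<Longrightarrow> (\<xi> has_vector_derivative v s) (at s)"
    "\<And>c d. a \<le> c \<Longrightarrow> c \<le> d \<Longrightarrow> d \<le> b \<Longrightarrow> (v has_integral (\<xi> d - \<xi> c)) {c..d}"
proof -
  define \<zeta> where "\<zeta> = (\<lambda>s. \<xi> (max a (min b s)))"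
  have \<zeta>: "\<zeta> s = \<xi> s" if "s \<in> {a..b}" for s using that by (simp add: \<zeta>_def)
  have L: "L \<ge> 0" using lip by (rule lipschitz_on_nonneg)
  have comp: "L-lipschitz_on UNIV (\<lambda>s. \<zeta> s \<bullet> i)" if i: "i \<in> Basis" for i
  proof (rule lipschitz_onI)
    fix s t :: real
    have "dist (\<zeta> s \<bullet> i) (\<zeta> t \<bullet> i) = \<bar>(\<zeta> s - \<zeta> t) \<bullet> i\<bar>" by (simp add: dist_real_def inner_diff_left)
    also have "\<dots> \<le> norm (\<zeta> s - \<zeta> t)" using i by (rule Basis_le_norm)
    also have "\<dots> \<le> L * \<bar>max a (min b s) - max a (min b t)\<bar>"
      using lipschitz_onD[OF lip, of "max a (min b s)" "max a (min b t)"] ab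
      by (simp add: \<zeta>_def dist_norm)
    also have "\<dots> \<le> L * dist s t"
      using L by (intro mult_left_mono) (auto simp: dist_real_def)
    finally show "dist (\<zeta> s \<bullet> i) (\<zeta> t \<bullet> i) \<le> L * dist s t" .
  qed (rule L)
  define Q where "Q = (\<lambda>i g N. g \<in> borel_measurable borel \<and> (\<forall>x. \<bar>g x\<bar> \<le> L) \<and> negligible N \<and>
     (\<forall>x. x \<notin> N \<longrightarrow> ((\<lambda>s. \<zeta> s \<bullet> i) has_real_derivative g x) (at x)) \<and>
     (\<forall>a b. a \<le> b \<longrightarrow> (g has_integral (\<zeta> b \<bullet> i - \<zeta> a \<bullet> i)) {a..b}))"
  have "\<forall>i\<in>Basis. \<exists>g N. Q i g N"
  proof
    fix i :: 'm assume i: "i \<in> Basis"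
    show "\<exists>g N. Q i g N"
      by (rule lipschitz_AE_derivative_real[OF comp[OF i]]) (unfold Q_def, blast)
  qed
  then obtain g N where Q: "\<And>i. i \<in> Basis \<Longrightarrow> Q i (g i) (N i)" by metis
  have g: "\<And>i. i \<in> Basis \<Longrightarrow> g i \<in> borel_measurable borel"
    and gL: "\<And>i x. i \<in> Basis \<Longrightarrow> \<bar>g i x\<bar> \<le> L"
    and N: "\<And>i. i \<in> Basis \<Longrightarrow> negligible (N i)"
    and gd: "\<And>i x. i \<in> Basis \<Longrightarrow> x \<notin> N i \<Longrightarrow> ((\<lambda>s. \<zeta> s \<bullet> i) has_real_derivative g i x) (at x)"
    and gi: "\<And>i a b. i \<in> Basis \<Longrightarrow> a \<le> b \<Longrightarrow> (g i has_integral (\<zeta> b \<bullet> i - \<zeta> a \<bullet> i)) {a..b}"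
    using Q unfolding Q_def by blast+
  define v where "v = (\<lambda>s. \<Sum>i\<in>Basis. g i s *\<^sub>R i)"
  have vi: "v s \<bullet> i = g i s" if "i \<in> Basis" for s i using that by (simp add: v_def)
  show ?thesis
  proof (rule that[of v "L * DIM('m)" "\<Union>i\<in>Basis. N i"])
    show "v \<in> borel_measurable borel" unfolding v_def using g by measurable
    show "norm (v s) \<le> L * DIM('m)" for s
    proof -
      have "norm (v s) \<le> (\<Sum>i\<in>Basis. \<bar>v s \<bullet> i\<bar>)" by (rule norm_le_l1)
      also have "\<dots> \<le> (\<Sum>i\<in>(Basis::'m set). L)" by (rule sum_mono) (simp add: vi gL)
      finally show ?thesis by (simp add: mult.commute)
    qed
    show "negligible (\<Union>i\<in>Basis. N i)" using N by (intro negligible_Union) auto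
    fix s assume s: "s \<in> {a<..<b} - (\<Union>i\<in>Basis. N i)"
    have "(\<zeta> has_vector_derivative v s) (at s)"
      unfolding has_vector_derivative_def
    proof (subst has_derivative_componentwise_within, intro ballI)
      fix i :: 'm assume i: "i \<in> Basis"
      then have "((\<lambda>s. \<zeta> s \<bullet> i) has_real_derivative g i s) (at s)" using gd s by blast
      then show "((\<lambda>s. \<zeta> s \<bullet> i) has_derivative (\<lambda>x. x *\<^sub>R v s \<bullet> i)) (at s)"
        by (simp add: has_field_derivative_def vi[OF i] mult.commute[of _ "g i s"])
    qed
    then show "(\<xi> has_vector_derivative v s) (at s)"
      by (rule has_vector_derivative_transform_within_open[of _ _ _ "{a<..<b}"]) (use s \<zeta> in auto)
  next
    fix c d assume cd: "a \<le> c" "c \<le> d" "d \<le> b"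
    show "(v has_integral \<xi> d - \<xi> c) {c..d}"
    proof (subst has_integral_componentwise_iff, intro ballI)
      fix i :: 'm assume i: "i \<in> Basis"
      have "\<zeta> c = \<xi> c" "\<zeta> d = \<xi> d" using cd by (auto intro!: \<zeta>)
      then show "((\<lambda>x. v x \<bullet> i) has_integral (\<xi> d - \<xi> c) \<bullet> i) {c..d}"
        using gi[OF i cd(2)] by (simp add: vi[OF i] inner_diff_left)
    qed
  qed
qed

text \<open>Along a curve, derivatives exist and are controlled only almost everywhere; since \<open>f\<close> is the
  integral of its derivative, such a bound can nevertheless be integrated.\<close>

lemma lipschitz_increment_le_integral:
  fixes f k :: "real \<Rightarrow> real"
  assumes lip: "L-lipschitz_on {a..b} f" and ab: "a \<le> b" and k: "k integrable_on {a..b}"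
    and N: "negligible N"
    and deriv: "\<And>s D. s \<in> {a<..<b} - N \<Longrightarrow> (f has_real_derivative D) (at s) \<Longrightarrow> D \<le> k s"
  shows "f b - f a \<le> integral {a..b} k"
proof -
  obtain v N' B where "negligible N'"
    and v3: "\<And>s. s \<in> {a<..<b} - N' \<Longrightarrow> (f has_vector_derivative v s) (at s)"
    and v2: "\<And>c d. a \<le> c \<Longrightarrow> c \<le> d \<Longrightarrow> d \<le> b \<Longrightarrow> (v has_integral (f d - f c)) {c..d}"
    by (rule lipschitz_on_interval_AE_derivative[OF lip ab]) (rule that; assumption)
  define M where "M = {a, b} \<union> N \<union> N'"
  have M: "negligible M" using \<open>negligible N'\<close> N unfolding M_def by simp
  have vk: "v s \<le> k s" if "s \<in> {a..b} - M" for s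
  proof (rule deriv)
    show "s \<in> {a<..<b} - N" using that by (auto simp: M_def)
    show "(f has_real_derivative v s) (at s)"
      using v3[of s] that by (auto simp: M_def has_real_derivative_iff_has_vector_derivative)
  qed
  have "((\<lambda>s. if s \<in> M then k s else v s) has_integral (f b - f a)) {a..b}"
    by (rule has_integral_spike[OF M _ v2[OF order_refl ab order_refl]]) auto
  then show ?thesis
  proof (rule has_integral_le[OF _ integrable_integral[OF k]])
    show "(if s \<in> M then k s else v s) \<le> k s" if "s \<in> {a..b}" for s
      using vk[of s] that by simp
  qed
qed

section \<open>Viscosity subsolutions: touching, stability, raising\<close>

lemma usc_on_UNIV_iff_open: "usc_on UNIV u \<longleftrightarrow> (\<forall>t. open {z. u z < t})"
proof
  assume u: "usc_on UNIV u"
  show "\<forall>t. open {z. u z < t}"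
  proof
    fix t
    show "open {z. u z < t}"
    proof (subst open_subopen, intro ballI)
      fix y assume "y \<in> {z. u z < t}"
      then have y: "u y < t" by simp
      with u have "\<forall>\<^sub>F z in at y. u z < t" unfolding usc_on_def by simp
      then obtain T where "open T" "y \<in> T" "\<And>z. z \<in> T \<Longrightarrow> z \<noteq> y \<Longrightarrow> u z < t"
        unfolding eventually_at_topological by blast
      with y show "\<exists>T. open T \<and> y \<in> T \<and> T \<subseteq> {z. u z < t}" by (intro exI[of _ T]) auto
    qed
  qed
next
  assume o: "\<forall>t. open {z. u z < t}"
  show "usc_on UNIV u"
    unfolding usc_on_def
  proof (intro ballI allI impI)
    fix y t assume "u y < t"
    then show "\<forall>\<^sub>F z in at y within UNIV. u z < t"
      unfolding eventually_at_topological using o by (intro exI[of _ "{z. u z < t}"]) auto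
  qed
qed

lemma usc_on_UNIV_ball:
  assumes "usc_on UNIV u" "u y < t"
  obtains d where "d > 0" "\<And>z. dist z y < d \<Longrightarrow> u z < t"
proof -
  have "open {z. u z < t}" "y \<in> {z. u z < t}" using assms by (auto simp: usc_on_UNIV_iff_open)
  then obtain d where "d > 0" "ball y d \<subseteq> {z. u z < t}" by (meson open_contains_ball)
  then show ?thesis by (intro that[of d]) (auto simp: dist_commute subset_eq)
qed

lemma continuous_imp_usc_on_UNIV:
  assumes "continuous_on UNIV u"
  shows "usc_on UNIV u"
  unfolding usc_on_UNIV_iff_open
  by (intro allI open_Collect_less assms continuous_on_const)

lemma usc_on_UNIV_diff_continuous:
  assumes u: "usc_on UNIV u" and \<phi>: "continuous_on UNIV \<phi>"
  shows "usc_on UNIV (\<lambda>z. u z - \<phi> z)"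
proof -
  have "{z. u z - \<phi> z < t} = (\<Union>s. {z. u z < s} \<inter> {z. s - t < \<phi> z})" for t
  proof (intro equalityI subsetI)
    fix z assume "z \<in> {z. u z - \<phi> z < t}"
    then obtain s where "u z < s" "s < t + \<phi> z" using dense[of "u z" "t + \<phi> z"] by auto
    then show "z \<in> (\<Union>s. {z. u z < s} \<inter> {z. s - t < \<phi> z})" by (intro UN_I[of s]) auto
  qed auto
  moreover have "open (\<Union>s. {z. u z < s} \<inter> {z. s - t < \<phi> z})" for t
    by (intro open_UN ballI open_Int open_Collect_less[OF continuous_on_const \<phi>])
      (use u in \<open>simp add: usc_on_UNIV_iff_open\<close>)
  ultimately show ?thesis by (simp add: usc_on_UNIV_iff_open)
qed

text \<open>Otherwise the open sets \<open>{z. u z < u x}\<close> with \<open>x \<in> K\<close> cover \<open>K\<close>, and a finite subcover contradicts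
  the choice of the largest of the finitely many values \<open>u x\<close>.\<close>

lemma usc_attains_max:
  assumes u: "usc_on UNIV u" and K: "compact K" "K \<noteq> {}"
  obtains z where "z \<in> K" "\<And>x. x \<in> K \<Longrightarrow> u x \<le> u z"
proof -
  have "\<exists>z\<in>K. \<forall>x\<in>K. u x \<le> u z"
  proof (rule ccontr)
    assume no: "\<not> (\<exists>z\<in>K. \<forall>x\<in>K. u x \<le> u z)"
    have cov: "K \<subseteq> (\<Union>x\<in>K. {z. u z < u x})"
    proof
      fix z assume "z \<in> K"
      with no obtain x where "x \<in> K" "u z < u x" by (meson not_less)
      then show "z \<in> (\<Union>x\<in>K. {z. u z < u x})" by blast
    qed
    have "open {z. u z < u x}" for x using u unfolding usc_on_UNIV_iff_open by blast
    then obtain C where C: "C \<subseteq> K" "finite C" "K \<subseteq> (\<Union>x\<in>C. {z. u z < u x})"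
      using compactE_image[OF K(1), of K "\<lambda>x. {z. u z < u x}"] cov by metis
    have "C \<noteq> {}" using C(3) K(2) by auto
    then have "Max (u ` C) \<in> u ` C" using C(2) by (intro Max_in) auto
    then obtain x where x: "x \<in> C" "u x = Max (u ` C)" by auto
    then obtain x' where x': "x' \<in> C" "u x < u x'" using C(1,3) by blast
    have "u x' \<le> Max (u ` C)" using x'(1) C(2) by (intro Max_ge) auto
    then show False using x(2) x'(2) by simp
  qed
  then show ?thesis using that by blast
qed

lemma viscosity_subsolutionD:
  assumes "viscosity_subsolution F b UNIV u" "C1_gradient_on UNIV \<phi> D\<phi>" "r > 0"
    and "\<And>z. dist z y < r \<Longrightarrow> u z - \<phi> z \<le> u y - \<phi> y"
  shows "F y (D\<phi> y) \<le> b"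
proof -
  have "\<forall>\<^sub>F z in at y within UNIV. u z - \<phi> z \<le> u y - \<phi> y"
    unfolding eventually_at using assms(3,4) by blast
  with assms(1,2) show ?thesis unfolding viscosity_subsolution_def by blast
qed

lemma viscosity_subsolutionI:
  assumes "usc_on UNIV u"
    and "\<And>\<phi> D\<phi> y r. \<lbrakk>C1_gradient_on UNIV \<phi> D\<phi>; r > 0; \<And>z. dist z y < r \<Longrightarrow> u z - \<phi> z \<le> u y - \<phi> y\<rbrakk>
       \<Longrightarrow> F y (D\<phi> y) \<le> b"
  shows "viscosity_subsolution F b UNIV u"
  unfolding viscosity_subsolution_def
proof (intro conjI assms(1) allI impI, elim conjE)
  fix \<phi> D\<phi> y assume \<phi>: "C1_gradient_on UNIV \<phi> D\<phi>" and "\<forall>\<^sub>F z in at y within UNIV. u z - \<phi> z \<le> u y - \<phi> y"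
  then obtain r where "r > 0" "\<And>z. z \<noteq> y \<Longrightarrow> dist z y < r \<Longrightarrow> u z - \<phi> z \<le> u y - \<phi> y"
    unfolding eventually_at by blast
  then have "u z - \<phi> z \<le> u y - \<phi> y" if "dist z y < r" for z using that by (cases "z = y") auto
  with \<phi> \<open>r > 0\<close> show "F y (D\<phi> y) \<le> b" by (rule assms(2))
qed

lemma viscosity_subsolution_usc: "viscosity_subsolution F b U u \<Longrightarrow> usc_on U u"
  by (simp add: viscosity_subsolution_def)

lemma viscosity_subsolution_mono:
  "viscosity_subsolution F b U u \<Longrightarrow> b \<le> b' \<Longrightarrow> viscosity_subsolution F b' U u"
  unfolding viscosity_subsolution_def by fastforce

lemma viscosity_subsolution_add_const:
  assumes "viscosity_subsolution F b UNIV u"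
  shows "viscosity_subsolution F b UNIV (\<lambda>z. u z - k)"
proof (rule viscosity_subsolutionI)
  show "usc_on UNIV (\<lambda>z. u z - k)"
    by (rule usc_on_UNIV_diff_continuous[OF viscosity_subsolution_usc[OF assms] continuous_on_const])
qed (rule viscosity_subsolutionD[OF assms]; simp)

lemma C1_gradient_continuous: "C1_gradient_on UNIV \<phi> D\<phi> \<Longrightarrow> continuous_on UNIV \<phi>"
  unfolding C1_gradient_on_def gderiv_def
  by (metis UNIV_I has_derivative_continuous continuous_at_imp_continuous_on)

lemma C1_gradient_on_add:
  assumes "C1_gradient_on U \<phi> D\<phi>" "C1_gradient_on U \<psi> D\<psi>"
  shows "C1_gradient_on U (\<lambda>z. \<phi> z + \<psi> z) (\<lambda>z. D\<phi> z + D\<psi> z)"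
  using assms unfolding C1_gradient_on_def by (auto intro: GDERIV_add continuous_on_add)

lemma C1_gradient_on_sq_dist:
  "C1_gradient_on U (\<lambda>z. k * (norm (z - y))\<^sup>2) (\<lambda>z. (2 * k) *\<^sub>R (z - y))"
  unfolding C1_gradient_on_def gderiv_def power2_norm_eq_inner
  by (auto intro!: derivative_eq_intros continuous_intros simp: fun_eq_iff inner_commute algebra_simps)

lemma C1_gradient_on_const: "C1_gradient_on U (\<lambda>z. k) (\<lambda>z. 0)"
  unfolding C1_gradient_on_def by (auto intro: GDERIV_const)

lemma GDERIV_eq_if_touching:
  assumes "GDERIV \<phi> y :> p" "GDERIV \<psi> y :> q" "r > 0"
    and "\<And>z. dist z y < r \<Longrightarrow> \<psi> z - \<phi> z \<le> \<psi> y - \<phi> y"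
  shows "p = q"
proof -
  have "((\<lambda>z. \<psi> z - \<phi> z) has_derivative (\<lambda>h. h \<bullet> q - h \<bullet> p)) (at y)"
    using assms(1,2) unfolding gderiv_def by (auto intro: has_derivative_diff)
  moreover have "eventually (\<lambda>z. \<psi> z - \<phi> z \<le> \<psi> y - \<phi> y) (at y)"
    unfolding eventually_at using assms(3,4) by blast
  ultimately have "(\<lambda>h. h \<bullet> q - h \<bullet> p) = (\<lambda>h. 0)" by (rule has_derivative_local_max)
  then have "(q - p) \<bullet> (q - p) = 0" by (metis inner_diff_right)
  then show ?thesis by simp
qed

lemma viscosity_subsolution_C1:
  assumes "open U" "C1_gradient_on UNIV \<psi> D\<psi>" "\<And>z. z \<in> U \<Longrightarrow> u z = \<psi> z" "\<And>z. z \<in> U \<Longrightarrow> F z (D\<psi> z) \<le> b"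
  shows "viscosity_subsolution F b U u"
  unfolding viscosity_subsolution_def
proof (intro conjI allI impI)
  have \<psi>: "usc_on UNIV \<psi>" by (rule continuous_imp_usc_on_UNIV[OF C1_gradient_continuous[OF assms(2)]])
  show "usc_on U u"
    unfolding usc_on_def
  proof (intro ballI allI impI)
    fix y t assume y: "y \<in> U" "u y < t"
    then obtain d where d: "d > 0" "\<And>z. dist z y < d \<Longrightarrow> \<psi> z < t"
      using assms(3) usc_on_UNIV_ball[OF \<psi>] by metis
    then show "\<forall>\<^sub>F z in at y within U. u z < t"
      unfolding eventually_at using assms(3) by auto
  qed
  fix \<phi> D\<phi> y
  assume *: "C1_gradient_on U \<phi> D\<phi> \<and> y \<in> U \<and> (\<forall>\<^sub>F z in at y within U. u z - \<phi> z \<le> u y - \<phi> y)"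
  then obtain d where d: "d > 0" "\<And>z. z \<in> U \<Longrightarrow> z \<noteq> y \<Longrightarrow> dist z y < d \<Longrightarrow> u z - \<phi> z \<le> u y - \<phi> y"
    unfolding eventually_at by blast
  obtain d' where d': "d' > 0" "ball y d' \<subseteq> U" using assms(1) * by (meson open_contains_ball)
  have "D\<phi> y = D\<psi> y"
  proof (rule GDERIV_eq_if_touching)
    show "GDERIV \<phi> y :> D\<phi> y" "GDERIV \<psi> y :> D\<psi> y" using * assms(2) unfolding C1_gradient_on_def by auto
    show "min d d' > 0" using d d' by simp
    fix z assume z: "dist z y < min d d'"
    then have "z \<in> U" using d' by (auto simp: dist_commute subset_eq)
    with z d(2)[of z] * assms(3) show "\<psi> z - \<phi> z \<le> \<psi> y - \<phi> y" by (cases "z = y") auto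
  qed
  then show "F y (D\<phi> y) \<le> b" using assms(4) * by simp
qed

text \<open>Perron-type gluing. At a point where \<open>u\<close> agrees with \<open>w\<close>, a test function touching \<open>u\<close> from above
  also touches \<open>w\<close>; at any other point \<open>u\<close> is locally above the \<open>C\<^sup>1\<close> function \<open>\<psi>\<close> and equal to it
  there, so the test gradient has to be the gradient of \<open>\<psi>\<close>.\<close>

lemma viscosity_subsolution_raise:
  assumes w: "viscosity_subsolution F b UNIV w" and u: "usc_on UNIV u" and le: "\<And>z. w z \<le> u z"
    and \<psi>: "C1_gradient_on UNIV \<psi> D\<psi>"
    and new: "\<And>z. w z < u z \<Longrightarrow> u z = \<psi> z \<and> F z (D\<psi> z) \<le> b \<and> (\<exists>r>0. \<forall>x. dist x z < r \<longrightarrow> \<psi> x \<le> u x)"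
  shows "viscosity_subsolution F b UNIV u"
proof (rule viscosity_subsolutionI[OF u])
  fix \<phi> D\<phi> y r
  assume \<phi>: "C1_gradient_on UNIV \<phi> D\<phi>" and r: "r > (0::real)"
    and max: "\<And>z. dist z y < r \<Longrightarrow> u z - \<phi> z \<le> u y - \<phi> y"
  show "F y (D\<phi> y) \<le> b"
  proof (cases "w y < u y")
    case True
    then obtain r' where y: "u y = \<psi> y" "F y (D\<psi> y) \<le> b"
      and r': "r' > 0" "\<And>x. dist x y < r' \<Longrightarrow> \<psi> x \<le> u x"
      using new by blast
    have "D\<phi> y = D\<psi> y"
    proof (rule GDERIV_eq_if_touching)
      show "GDERIV \<phi> y :> D\<phi> y" "GDERIV \<psi> y :> D\<psi> y" using \<phi> \<psi> unfolding C1_gradient_on_def by auto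
      show "min r r' > 0" using r r' by simp
      show "\<psi> z - \<phi> z \<le> \<psi> y - \<phi> y" if "dist z y < min r r'" for z
        using max[of z] r'(2)[of z] that y(1) by simp
    qed
    then show ?thesis using y(2) by simp
  next
    case False
    then have y: "w y = u y" using le[of y] by simp
    show ?thesis
    proof (rule viscosity_subsolutionD[OF w \<phi> r])
      show "w z - \<phi> z \<le> w y - \<phi> y" if "dist z y < r" for z using max[OF that] le[of z] y by simp
    qed
  qed
qed

text \<open>Subtracting a steep enough paraboloid pushes the maximum point into the open ball. Together with
  coercivity this bounds the admissible levels from below and shows that sublevel sets are nonempty.\<close>

lemma subsolution_touched:
  assumes u: "viscosity_subsolution F b UNIV u" and r: "r > 0"
  obtains z q where "dist z y < r" "F z q \<le> b"
proof -
  note usc = viscosity_subsolution_usc[OF u]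
  obtain z0 where z0: "z0 \<in> cball y r" "\<And>x. x \<in> cball y r \<Longrightarrow> u x \<le> u z0"
    by (rule usc_attains_max[OF usc compact_cball[of y r]]) (use r in auto)
  define k where "k = (u z0 - u y + 1) / r\<^sup>2"
  have k: "k * r\<^sup>2 = u z0 - u y + 1" using r by (simp add: k_def)
  let ?\<phi> = "\<lambda>z. k * (norm (z - y))\<^sup>2"
  have \<phi>: "C1_gradient_on UNIV ?\<phi> (\<lambda>z. (2 * k) *\<^sub>R (z - y))" by (rule C1_gradient_on_sq_dist)
  obtain z where z: "z \<in> cball y r" "\<And>x. x \<in> cball y r \<Longrightarrow> u x - ?\<phi> x \<le> u z - ?\<phi> z"
    by (rule usc_attains_max[OF usc_on_UNIV_diff_continuous[OF usc C1_gradient_continuous[OF \<phi>]] compact_cball[of y r]]) (use r in auto)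
  have "dist z y \<noteq> r"
  proof
    assume "dist z y = r"
    then have "u z - ?\<phi> z < u y" using z0(2)[OF z(1)] k by (simp add: dist_norm)
    with z(2)[of y] r show False by simp
  qed
  with z(1) have zy: "dist z y < r" by (simp add: dist_commute)
  have "F z ((2 * k) *\<^sub>R (z - y)) \<le> b"
  proof (rule viscosity_subsolutionD[OF u \<phi>])
    show "r - dist z y > 0" using zy by simp
    show "u x - ?\<phi> x \<le> u z - ?\<phi> z" if "dist x z < r - dist z y" for x
      by (rule z(2)) (use that dist_triangle[of x y z] in \<open>simp add: dist_commute\<close>)
  qed
  with zy show ?thesis by (rule that)
qed

lemma continuous_on_test_Hamiltonian:
  assumes "continuous_on UNIV (\<lambda>(y,q). F y q)" "continuous_on UNIV p"
  shows "continuous_on UNIV (\<lambda>z. F z (p z))"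
proof -
  have "continuous_on UNIV (\<lambda>z. (z, p z))" by (intro continuous_intros assms(2))
  from continuous_on_compose2[OF assms(1) this] show ?thesis by simp
qed

text \<open>The hypotheses say that \<open>w\<close> is above the upper half-relaxed limit of the \<open>u n\<close> and that no value of
  \<open>w\<close> is lost in the limit. A touching point of \<open>w\<close> is made strict by a quadratic perturbation; then
  infinitely many \<open>u n\<close> have touching points with the perturbed test function arbitrarily close by,
  and continuity of \<open>F\<close> concludes.\<close>

lemma viscosity_subsolution_half_relaxed_limit:
  fixes u :: "nat \<Rightarrow> 'm::euclidean_space \<Rightarrow> real"
  assumes F: "continuous_on UNIV (\<lambda>(y,q). F y q)"
    and u: "\<And>n. viscosity_subsolution F (b n) UNIV (u n)" and b: "b \<longlonglongrightarrow> c"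
    and upper: "\<And>z t. w z < t \<Longrightarrow> \<exists>d>0. \<exists>n0. \<forall>n\<ge>n0. \<forall>z'. dist z' z < d \<longrightarrow> u n z' < t"
    and lower: "\<And>z t n. t < w z \<Longrightarrow> \<exists>k\<ge>n. t < u k z"
  shows "viscosity_subsolution F c UNIV w"
proof (rule viscosity_subsolutionI)
  show "usc_on UNIV w"
    unfolding usc_on_def
  proof (intro ballI allI impI)
    fix z t assume "w z < t"
    then obtain t' where t': "w z < t'" "t' < t" using dense by blast
    obtain d n0 where d: "d > 0" "\<And>n z'. n \<ge> n0 \<Longrightarrow> dist z' z < d \<Longrightarrow> u n z' < t'"
      using upper[OF t'(1)] by blast
    have "w z' \<le> t'" if "dist z' z < d" for z'
    proof (rule ccontr)
      assume "\<not> w z' \<le> t'"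
      then obtain k where "k \<ge> n0" "t' < u k z'" using lower[of t' z' n0] by auto
      with d(2)[OF _ that] show False by force
    qed
    then show "\<forall>\<^sub>F z' in at z within UNIV. w z' < t"
      unfolding eventually_at using d(1) t'(2) by (meson le_less_trans)
  qed
next
  fix \<phi> D\<phi> y r
  assume \<phi>: "C1_gradient_on UNIV \<phi> D\<phi>" and r: "r > (0::real)"
    and max: "\<And>z. dist z y < r \<Longrightarrow> w z - \<phi> z \<le> w y - \<phi> y"
  \<comment> \<open>the quadratic term makes the maximum at \<open>y\<close> strict\<close>
  define \<psi> where "\<psi> = (\<lambda>z. \<phi> z + 1 * (norm (z - y))\<^sup>2)"
  define D\<psi> where "D\<psi> = (\<lambda>z. D\<phi> z + (2 * 1) *\<^sub>R (z - y))"
  have \<psi>: "C1_gradient_on UNIV \<psi> D\<psi>"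
    unfolding \<psi>_def D\<psi>_def by (rule C1_gradient_on_add[OF \<phi> C1_gradient_on_sq_dist])
  note \<psi>c = C1_gradient_continuous[OF \<psi>]
  have key: "\<exists>k\<ge>n. \<exists>z. dist z y < e \<and> F z (D\<psi> z) \<le> b k" if e0: "e > 0" for e n
  proof -
    define e' where "e' = min e r / 2"
    have e': "e' > 0" "e' < e" "e' < r" using e0 r by (auto simp: e'_def)
    define P where "P = (\<lambda>z d n0. d > 0 \<and>
      (\<forall>n\<ge>n0. \<forall>z'. dist z' z < d \<longrightarrow> u n z' - \<psi> z' < w y - \<psi> y - e'\<^sup>2 / 2))"
    have "\<exists>d n0. P z d n0" if z: "z \<in> sphere y e'" for z
    proof -
      have "w z - \<psi> z \<le> w y - \<psi> y - e'\<^sup>2"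
        using max[of z] z e' by (simp add: \<psi>_def dist_commute) (simp add: dist_norm norm_minus_commute)
      moreover have "e'\<^sup>2 > 0" using e' by simp
      ultimately have "w z < w y - \<psi> y - e'\<^sup>2 * (3/4) + \<psi> z" by linarith
      from upper[OF this] obtain d n0 where d: "d > 0"
        "\<And>n z'. n \<ge> n0 \<Longrightarrow> dist z' z < d \<Longrightarrow> u n z' < w y - \<psi> y - e'\<^sup>2 * (3/4) + \<psi> z" by blast
      obtain d' where d': "d' > 0" "\<And>z'. dist z' z < d' \<Longrightarrow> dist (\<psi> z') (\<psi> z) < e'\<^sup>2 / 4"
        using \<psi>c e'(1) unfolding continuous_on_iff by (metis UNIV_I divide_pos_pos zero_less_numeral zero_less_power)
      show ?thesis unfolding P_def
      proof (intro exI[of _ "min d d'"] conjI exI[of _ n0] allI impI)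
        fix n z' assume "n \<ge> n0" "dist z' z < min d d'"
        then have "u n z' < w y - \<psi> y - e'\<^sup>2 * (3/4) + \<psi> z" "dist (\<psi> z') (\<psi> z) < e'\<^sup>2 / 4"
          using d d' by auto
        then show "u n z' - \<psi> z' < w y - \<psi> y - e'\<^sup>2 / 2" unfolding dist_real_def by linarith
      qed (use d d' in auto)
    qed
    then obtain d n0 where P: "\<And>z. z \<in> sphere y e' \<Longrightarrow> P z (d z) (n0 z)" by metis
    have d: "\<And>z. z \<in> sphere y e' \<Longrightarrow> d z > 0"
      and n0: "\<And>z n z'. z \<in> sphere y e' \<Longrightarrow> n \<ge> n0 z \<Longrightarrow> dist z' z < d z \<Longrightarrow>
         u n z' - \<psi> z' < w y - \<psi> y - e'\<^sup>2 / 2"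
      using P unfolding P_def by blast+
    have "sphere y e' \<subseteq> (\<Union>z\<in>sphere y e'. ball z (d z))"
    proof
      fix z assume z: "z \<in> sphere y e'"
      then have "z \<in> ball z (d z)" using d by simp
      with z show "z \<in> (\<Union>z\<in>sphere y e'. ball z (d z))" by blast
    qed
    then obtain C where C: "C \<subseteq> sphere y e'" "finite C" "sphere y e' \<subseteq> (\<Union>z\<in>C. ball z (d z))"
      using compactE_image[OF compact_sphere, of "sphere y e'" "\<lambda>z. ball z (d z)"] open_ball by metis
    define m where "m = Max (insert n (n0 ` C))"
    have m: "m \<ge> n" "\<And>z. z \<in> C \<Longrightarrow> m \<ge> n0 z" using C(2) by (auto simp: m_def)
    have "w y - e'\<^sup>2 / 2 < w y" using e' by simp
    from lower[OF this, of m] obtain k where k: "k \<ge> m" "w y - e'\<^sup>2 / 2 < u k y" by blast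
    have sph: "u k z - \<psi> z < u k y - \<psi> y" if "z \<in> sphere y e'" for z
    proof -
      obtain x where "x \<in> C" "dist z x < d x" using C(3) \<open>z \<in> sphere y e'\<close> by (auto simp: dist_commute)
      then have "u k z - \<psi> z < w y - \<psi> y - e'\<^sup>2 / 2" using n0[of x k z] m(2)[of x] k(1) C(1) by auto
      with k(2) show ?thesis by simp
    qed
    obtain z where z: "z \<in> cball y e'" "\<And>x. x \<in> cball y e' \<Longrightarrow> u k x - \<psi> x \<le> u k z - \<psi> z"
      by (rule usc_attains_max[OF usc_on_UNIV_diff_continuous[OF viscosity_subsolution_usc[OF u[of k]] \<psi>c] compact_cball[of y e']])
        (use e' in auto)
    have "z \<notin> sphere y e'" using sph[of z] z(2)[of y] e' by force
    with z(1) have zy: "dist z y < e'" by (simp add: dist_commute)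
    have "F z (D\<psi> z) \<le> b k"
    proof (rule viscosity_subsolutionD[OF u \<psi>])
      show "e' - dist z y > 0" using zy by simp
      show "u k x - \<psi> x \<le> u k z - \<psi> z" if "dist x z < e' - dist z y" for x
        by (rule z(2)) (use that dist_triangle[of x y z] in \<open>simp add: dist_commute\<close>)
    qed
    moreover have "k \<ge> n" using k(1) m(1) by simp
    ultimately show ?thesis using zy e' by (intro exI[of _ k] conjI exI[of _ z]) auto
  qed
  have cont: "continuous_on UNIV (\<lambda>z. F z (D\<psi> z))"
    using \<psi> by (intro continuous_on_test_Hamiltonian[OF F]) (simp add: C1_gradient_on_def)
  show "F y (D\<phi> y) \<le> c"
  proof (rule ccontr)
    assume "\<not> F y (D\<phi> y) \<le> c"
    then have "c < F y (D\<psi> y)" by (simp add: D\<psi>_def)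
    then obtain c' where c': "c < c'" "c' < F y (D\<psi> y)" using dense by blast
    have "open {z. c' < F z (D\<psi> z)}" by (intro open_Collect_less continuous_on_const cont)
    then obtain e where e: "e > 0" "ball y e \<subseteq> {z. c' < F z (D\<psi> z)}"
      using c'(2) by (metis (mono_tags) mem_Collect_eq open_contains_ball)
    obtain n where n: "\<And>k. k \<ge> n \<Longrightarrow> b k < c'" using order_tendstoD(2)[OF b c'(1)]
      by (auto simp: eventually_sequentially)
    from key[OF e(1), of n] obtain k z where "k \<ge> n" "dist z y < e" "F z (D\<psi> z) \<le> b k" by blast
    with n[of k] e(2) show False by (force simp: dist_commute subset_eq)
  qed
qed

section \<open>Increment of a subsolution along a segment\<close>

text \<open>The test function built in the proof has slope at least \<open>\<mu>\<close> in direction \<open>v\<close> throughout a thin cylinder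
  around the segment, so it cannot touch \<open>u\<close> from above inside; the penalties exclude the lateral
  boundary and the far end, and the maximum sits on the initial face close to \<open>y\<close>. In this way the
  differential inequality is integrated along the segment without any differentiability of \<open>u\<close>.\<close>

lemma subsolution_increment_along_segment:
  fixes u :: "'m::euclidean_space \<Rightarrow> real"
  assumes u: "viscosity_subsolution F b UNIV u" and v: "v \<noteq> 0" and \<rho>: "\<rho> > 0"
    and slope: "\<And>t z q. \<lbrakk>0 \<le> t; t \<le> 1; dist z (y + t *\<^sub>R v) < \<rho>; F z q \<le> b\<rbrakk> \<Longrightarrow> q \<bullet> v < \<mu>"
  shows "u (y + v) - u y \<le> \<mu>"
proof (rule field_le_epsilon)
  fix \<epsilon>0 :: real assume "\<epsilon>0 > 0"
  define \<epsilon> where "\<epsilon> = \<epsilon>0 / 2"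
  have \<epsilon>: "\<epsilon> > 0" "\<epsilon>0 = 2 * \<epsilon>" using \<open>\<epsilon>0 > 0\<close> by (auto simp: \<epsilon>_def)
  note usc = viscosity_subsolution_usc[OF u]
  define e where "e = v /\<^sub>R (v \<bullet> v)"
  have vv: "v \<bullet> v > 0" using v by simp
  have ev: "e \<bullet> v = 1" "v \<bullet> e = 1" using v by (auto simp: e_def)
  have vve: "(v \<bullet> v) *\<^sub>R e = v" using v by (simp add: e_def)
  define T where "T = (\<lambda>z. (z - y) \<bullet> e)"
  define W where "W = (\<lambda>z. z - y - T z *\<^sub>R v)"
  have zTW: "z = y + T z *\<^sub>R v + W z" for z by (simp add: W_def)
  have We: "W z \<bullet> v = 0" for z
  proof -
    have "T z * (v \<bullet> v) = (z - y) \<bullet> v"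
      using vve by (metis T_def inner_scaleR_right mult.commute)
    then show ?thesis by (simp add: W_def inner_diff_left)
  qed
  have normW: "(norm (W z))\<^sup>2 = (z - y) \<bullet> (z - y) - (T z)\<^sup>2 * (v \<bullet> v)" for z
  proof -
    have "(z - y) \<bullet> (z - y) = (T z *\<^sub>R v + W z) \<bullet> (T z *\<^sub>R v + W z)"
      by (simp add: W_def)
    also have "\<dots> = (T z)\<^sup>2 * (v \<bullet> v) + W z \<bullet> W z"
      using We[of z] by (simp add: inner_add_left inner_add_right inner_commute power2_eq_square)
    finally show ?thesis by (simp add: power2_norm_eq_inner)
  qed
  have Tc: "continuous_on UNIV T" unfolding T_def by (intro continuous_intros)
  have Wc: "continuous_on UNIV W" unfolding W_def by (intro continuous_intros Tc)
  define \<alpha> where "\<alpha> = \<rho> / (4 * norm v)"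
  have \<alpha>: "\<alpha> > 0" "\<alpha> * norm v = \<rho> / 4" using \<rho> v by (auto simp: \<alpha>_def)
  define \<sigma> where "\<sigma> = \<rho> / 4"
  have \<sigma>: "\<sigma> > 0" using \<rho> by (simp add: \<sigma>_def)
  \<comment> \<open>the cylinder around the segment, prolonged by \<open>\<alpha> *\<^sub>R v\<close> at its far end\<close>
  define K where "K = {z. 0 \<le> T z \<and> T z \<le> 1 + \<alpha> \<and> norm (W z) \<le> \<sigma>}"
  have near: "\<exists>t. 0 \<le> t \<and> t \<le> 1 \<and> dist z (y + t *\<^sub>R v) < \<rho>" if "z \<in> K" for z
  proof (intro exI[of _ "min (T z) 1"] conjI)
    have "z - (y + min (T z) 1 *\<^sub>R v) = (T z - min (T z) 1) *\<^sub>R v + W z"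
      using zTW[of z] by (simp add: algebra_simps)
    then have "dist z (y + min (T z) 1 *\<^sub>R v) \<le> \<bar>T z - min (T z) 1\<bar> * norm v + norm (W z)"
      unfolding dist_norm by (metis norm_scaleR norm_triangle_ineq)
    also have "\<dots> \<le> \<alpha> * norm v + \<sigma>"
      using that \<alpha>(1) by (intro add_mono mult_right_mono) (auto simp: K_def min_def)
    also have "\<dots> < \<rho>" using \<alpha> \<rho> by (simp add: \<sigma>_def)
    finally show "dist z (y + min (T z) 1 *\<^sub>R v) < \<rho>" .
  qed (use that in \<open>auto simp: K_def\<close>)
  have "compact K"
  proof (rule compact_eq_bounded_closed[THEN iffD2, OF conjI])
    have "K \<subseteq> cball y ((1 + \<alpha>) * norm v + \<sigma>)"
    proof
      fix z assume z: "z \<in> K"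
      have "norm (z - y) \<le> norm (T z *\<^sub>R v) + norm (W z)"
        using zTW[of z] by (metis add.assoc add_diff_cancel_left' norm_triangle_ineq)
      also have "\<dots> \<le> (1 + \<alpha>) * norm v + \<sigma>"
        using z unfolding norm_scaleR by (intro add_mono mult_right_mono) (auto simp: K_def)
      finally show "z \<in> cball y ((1 + \<alpha>) * norm v + \<sigma>)" by (simp add: dist_norm norm_minus_commute)
    qed
    then show "bounded K" by (rule bounded_subset[OF bounded_cball])
    show "closed K" unfolding K_def
      by (intro closed_Collect_conj closed_Collect_le continuous_intros Tc Wc)
  qed
  have yK: "y \<in> K" using \<alpha> \<sigma> by (simp add: K_def T_def W_def)
  have yvK: "y + v \<in> K" using \<alpha> \<sigma> ev by (simp add: K_def T_def W_def)
  obtain z0 where z0: "\<And>x. x \<in> K \<Longrightarrow> u x \<le> u z0"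
    using usc_attains_max[OF usc \<open>compact K\<close>] yK by blast
  obtain \<delta>0 where \<delta>0: "\<delta>0 > 0" "\<And>z. dist z y < \<delta>0 \<Longrightarrow> u z < u y + \<epsilon>"
    using usc_on_UNIV_ball[OF usc, of y "u y + \<epsilon>"] \<epsilon> by auto
  define \<delta> where "\<delta> = min \<delta>0 \<sigma>"
  have \<delta>: "\<delta> > 0" "\<delta> \<le> \<sigma>" "\<delta> \<le> \<delta>0" using \<delta>0 \<sigma> by (auto simp: \<delta>_def)
  define C where "C = u z0 - u y + \<bar>\<mu>\<bar> * (1 + \<alpha>) + 1"
  have C: "C > 0" "C > u z0 - u y + \<bar>\<mu>\<bar> * (1 + \<alpha>)" "C > u z0 - u y"
  proof -
    have "u y \<le> u z0" "\<bar>\<mu>\<bar> * (1 + \<alpha>) \<ge> 0" using z0[OF yK] \<alpha> by auto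
    then show "C > 0" "C > u z0 - u y + \<bar>\<mu>\<bar> * (1 + \<alpha>)" "C > u z0 - u y"
      unfolding C_def by linarith+
  qed
  \<comment> \<open>the two penalties: a high power of \<open>T\<close> closes the far end, \<open>N\<close> closes the lateral boundary\<close>
  define N where "N = C / \<delta>\<^sup>2"
  have N: "N * \<delta>\<^sup>2 = C" "N > 0" using \<delta> C by (auto simp: N_def)
  obtain k where "C / \<epsilon> < (1 + \<alpha>) ^ k" using real_arch_pow[of "1 + \<alpha>" "C / \<epsilon>"] \<alpha> by auto
  also have "\<dots> \<le> (1 + \<alpha>) ^ Suc k" using \<alpha> by (intro power_increasing) auto
  finally have k: "C < \<epsilon> * (1 + \<alpha>) ^ Suc k" using \<epsilon> by (simp add: field_simps)
  define \<phi> where "\<phi> = (\<lambda>z. \<mu> * T z + \<epsilon> * T z ^ Suc k + N * ((z - y) \<bullet> (z - y) - (T z)\<^sup>2 * (v \<bullet> v)))"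
  define D\<phi> where "D\<phi> = (\<lambda>z. (\<mu> + \<epsilon> * (Suc k * T z ^ k)) *\<^sub>R e + (2 * N) *\<^sub>R W z)"
  have \<phi>W: "\<phi> z = \<mu> * T z + \<epsilon> * T z ^ Suc k + N * (norm (W z))\<^sup>2" for z
    by (simp add: \<phi>_def normW)
  have \<phi>: "C1_gradient_on UNIV \<phi> D\<phi>"
    unfolding C1_gradient_on_def
  proof (intro conjI ballI)
    show "continuous_on UNIV D\<phi>" unfolding D\<phi>_def by (intro continuous_intros Tc Wc)
    fix z
    have dT: "(T has_derivative (\<lambda>h. h \<bullet> e)) (at z)"
      unfolding T_def by (auto intro!: derivative_eq_intros)
    have "(\<phi> has_derivative (\<lambda>h. \<mu> * (h \<bullet> e) + \<epsilon> * (Suc k * (h \<bullet> e) * T z ^ k)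
        + N * (2 * (h \<bullet> (z - y)) - 2 * T z * (h \<bullet> e) * (v \<bullet> v)))) (at z)"
      unfolding \<phi>_def
      by (rule derivative_eq_intros dT refl)+ (auto simp: fun_eq_iff inner_commute algebra_simps)
    moreover have "h \<bullet> D\<phi> z = \<mu> * (h \<bullet> e) + \<epsilon> * (Suc k * (h \<bullet> e) * T z ^ k)
        + N * (2 * (h \<bullet> (z - y)) - 2 * T z * (h \<bullet> e) * (v \<bullet> v))" for h
    proof -
      have "h \<bullet> v = (h \<bullet> e) * (v \<bullet> v)" using vve by (metis inner_scaleR_right mult.commute)
      then show ?thesis
        by (simp add: D\<phi>_def W_def inner_add_right inner_diff_right algebra_simps)
    qed
    ultimately show "GDERIV \<phi> z :> D\<phi> z" unfolding gderiv_def by presburger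
  qed
  have D\<phi>v: "D\<phi> z \<bullet> v \<ge> \<mu>" if "T z \<ge> 0" for z
    using \<epsilon> that We[of z] by (simp add: D\<phi>_def inner_add_left ev)
  obtain z where zK: "z \<in> K" and zmax: "\<And>x. x \<in> K \<Longrightarrow> u x - \<phi> x \<le> u z - \<phi> z"
    using usc_attains_max[OF usc_on_UNIV_diff_continuous[OF usc C1_gradient_continuous[OF \<phi>]] \<open>compact K\<close>] yK by blast
  have "\<phi> y = 0" by (simp add: \<phi>_def T_def)
  with zmax[OF yK] z0[OF zK] have \<phi>z: "\<phi> z \<le> u z0 - u y" "N * (norm (W z))\<^sup>2 \<ge> 0" "u y \<le> u z - \<phi> z"
    using N by simp_all
  have T0: "T z \<ge> 0" "T z \<le> 1 + \<alpha>" "norm (W z) \<le> \<sigma>" using zK by (auto simp: K_def)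
  have \<mu>T: "\<mu> * T z \<ge> - (\<bar>\<mu>\<bar> * (1 + \<alpha>))"
  proof -
    have "\<bar>\<mu> * T z\<bar> \<le> \<bar>\<mu>\<bar> * (1 + \<alpha>)" unfolding abs_mult using T0 by (intro mult_left_mono) auto
    then show ?thesis by linarith
  qed
  have Tk: "\<epsilon> * T z ^ Suc k \<ge> 0" using \<epsilon> T0 by simp
  have "T z \<noteq> 1 + \<alpha>"
  proof
    assume "T z = 1 + \<alpha>"
    then have "C < \<epsilon> * T z ^ Suc k" using k by simp
    then show False using \<phi>z \<mu>T C unfolding \<phi>W by linarith
  qed
  then have T1: "T z < 1 + \<alpha>" using T0 by simp
  have W1: "norm (W z) < \<delta>"
  proof (rule ccontr)
    assume "\<not> norm (W z) < \<delta>"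
    then have "\<delta>\<^sup>2 \<le> (norm (W z))\<^sup>2" using \<delta> by (intro power_mono) auto
    then have "C \<le> N * (norm (W z))\<^sup>2" unfolding N(1)[symmetric] using N(2) by simp
    then show False using \<phi>z \<mu>T C Tk unfolding \<phi>W by linarith
  qed
  have "T z = 0"
  proof (rule ccontr)
    assume "T z \<noteq> 0"
    let ?O = "{x. 0 < T x} \<inter> {x. T x < 1 + \<alpha>} \<inter> {x. norm (W x) < \<sigma>}"
    have "open ?O" by (intro open_Int open_Collect_less continuous_intros Tc Wc)
    moreover have "z \<in> ?O" using \<open>T z \<noteq> 0\<close> T0 T1 W1 \<delta> by auto
    ultimately obtain r where r: "r > 0" "ball z r \<subseteq> ?O" by (meson open_contains_ball)
    have "F z (D\<phi> z) \<le> b"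
    proof (rule viscosity_subsolutionD[OF u \<phi> r(1)])
      show "u x - \<phi> x \<le> u z - \<phi> z" if "dist x z < r" for x
      proof (rule zmax)
        have "x \<in> ball z r" using that by (simp add: dist_commute)
        with r(2) have "x \<in> ?O" by blast
        then show "x \<in> K" by (auto simp: K_def)
      qed
    qed
    moreover obtain t where "0 \<le> t" "t \<le> 1" "dist z (y + t *\<^sub>R v) < \<rho>" using near[OF zK] by blast
    ultimately have "D\<phi> z \<bullet> v < \<mu>" using slope by blast
    with D\<phi>v[OF T0(1)] show False by simp
  qed
  have "u z < u y + \<epsilon>"
  proof (rule \<delta>0(2))
    have "z - y = W z" using \<open>T z = 0\<close> by (simp add: W_def)
    then show "dist z y < \<delta>0" using W1 \<delta> by (simp add: dist_norm)
  qed
  moreover have "\<phi> (y + v) = \<mu> + \<epsilon>" by (simp add: \<phi>W W_def T_def ev)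
  moreover have "\<phi> z \<ge> 0" using \<open>T z = 0\<close> \<phi>z(2) by (simp add: \<phi>W)
  ultimately show "u (y + v) - u y \<le> \<mu> + \<epsilon>0" using zmax[OF yvK] \<epsilon> by linarith
qed

lemma subsolution_lipschitz:
  fixes u :: "'m::euclidean_space \<Rightarrow> real"
  assumes u: "viscosity_subsolution F b UNIV u" and \<Lambda>: "\<Lambda> \<ge> 0" and \<rho>: "\<rho> > 0"
    and bound: "\<And>z q. norm z < R + \<rho> \<Longrightarrow> F z q \<le> b \<Longrightarrow> norm q \<le> \<Lambda>"
  shows "\<Lambda>-lipschitz_on (cball 0 R) u"
proof (rule lipschitz_onI)
  have *: "u x' - u x \<le> \<Lambda> * dist x x'" if x: "x \<in> cball 0 R" "x' \<in> cball 0 R" for x x' :: 'm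
  proof (cases "x = x'")
    case False
    show ?thesis
    proof (rule field_le_epsilon)
      fix e :: real assume e: "e > 0"
      have "u (x + (x' - x)) - u x \<le> \<Lambda> * dist x x' + e"
      proof (rule subsolution_increment_along_segment[OF u _ \<rho>])
        show "x' - x \<noteq> 0" using False by simp
        fix t z q assume t: "0 \<le> t" "t \<le> 1" "dist z (x + t *\<^sub>R (x' - x)) < \<rho>" "F z q \<le> b"
        have "(1 - t) *\<^sub>R x + t *\<^sub>R x' \<in> cball 0 R"
          using convexD[OF convex_cball x, of "1 - t" t] t by simp
        then have "norm (x + t *\<^sub>R (x' - x)) \<le> R" by (simp add: algebra_simps)
        moreover have "norm z \<le> norm (x + t *\<^sub>R (x' - x)) + dist z (x + t *\<^sub>R (x' - x))"
          unfolding dist_norm by (rule norm_triangle_sub)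
        ultimately have "norm z < R + \<rho>" using t(3) by linarith
        then have "norm q \<le> \<Lambda>" using bound t(4) by blast
        then have "norm q * norm (x' - x) \<le> \<Lambda> * norm (x' - x)" by (rule mult_right_mono) simp
        then show "q \<bullet> (x' - x) < \<Lambda> * dist x x' + e"
          using norm_cauchy_schwarz[of q "x' - x"] e by (simp add: dist_norm norm_minus_commute)
      qed
      then show "u x' - u x \<le> \<Lambda> * dist x x' + e" by simp
    qed
  qed simp
  fix x x' :: 'm assume "x \<in> cball 0 R" "x' \<in> cball 0 R"
  then show "dist (u x) (u x') \<le> \<Lambda> * dist x x'"
    using *[of x x'] *[of x' x] by (simp add: dist_real_def dist_commute abs_le_iff)
qed (rule \<Lambda>)

section \<open>Coercive Hamiltonians: critical subsolutions and the support function\<close>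

text \<open>Closed convex sublevels are recovered from their support functions, and coercivity makes them
  locally bounded. The last two conditions together make zero a strict subsolution slope far away, with a
  margin that allows slopes of size \<open>1 / norm y\<close>.\<close>

locale coercive_hamiltonian =
  fixes F :: "'m::euclidean_space \<Rightarrow> 'm \<Rightarrow> real"
  assumes continuous: "continuous_on UNIV (\<lambda>(y, q). F y q)"
    and convex_sublevel: "convex {q. F y q \<le> b}"
    and coercive: "compact K \<Longrightarrow> \<exists>r>0. \<exists>C. \<forall>y\<in>K. \<forall>q. r * norm q - C \<le> F y q"
    and at_zero: "filterlim (\<lambda>y. F y 0) at_bot at_infinity"
    and linear_growth: "\<exists>C. \<forall>y q. F y q \<le> F y 0 + C * (1 + norm y) * norm q"
begin

lemma continuous_fixed: "continuous_on UNIV (\<lambda>z. F z q)"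
  by (rule continuous_on_test_Hamiltonian[OF continuous continuous_on_const])

lemma sublevel_bound:
  obtains \<Lambda> where "\<Lambda> \<ge> 0" "\<And>y q. norm y \<le> R \<Longrightarrow> F y q \<le> b \<Longrightarrow> norm q \<le> \<Lambda>"
proof -
  obtain r C where r: "r > 0" "\<And>y q. y \<in> cball 0 R \<Longrightarrow> r * norm q - C \<le> F y q"
    using coercive[OF compact_cball, of 0 R] by blast
  have "norm q \<le> max 0 ((b + C) / r)" if "norm y \<le> R" "F y q \<le> b" for y q
  proof -
    have "r * norm q \<le> b + C" using r(2)[of y q] that by simp
    then have "norm q \<le> (b + C) / r" using r(1) by (simp add: pos_le_divide_eq mult.commute)
    then show ?thesis by simp
  qed
  then show ?thesis by (intro that[of "max 0 ((b + C) / r)"]) auto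
qed

lemma sublevel_limit:
  assumes "y \<longlonglongrightarrow> y'" "q \<longlonglongrightarrow> q'" "\<And>n::nat. F (y n) (q n) \<le> b"
  shows "F y' q' \<le> b"
proof -
  have "isCont (\<lambda>(y, q). F y q) (y', q')"
    using continuous by (simp add: continuous_on_eq_continuous_at)
  then have "(\<lambda>n. (\<lambda>(y, q). F y q) (y n, q n)) \<longlonglongrightarrow> (\<lambda>(y, q). F y q) (y', q')"
    by (rule isCont_tendsto_compose) (intro tendsto_Pair assms(1,2))
  then have "(\<lambda>n. F (y n) (q n)) \<longlonglongrightarrow> F y' q'" by simp
  then show ?thesis by (rule LIMSEQ_le_const2) (use assms(3) in blast)
qed

lemma subsolution_lipschitz_ball:
  obtains \<Lambda> where "\<Lambda> \<ge> 0" "\<And>u. viscosity_subsolution F b UNIV u \<Longrightarrow> \<Lambda>-lipschitz_on (cball 0 R) u"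
proof -
  obtain \<Lambda> where \<Lambda>: "\<Lambda> \<ge> 0" "\<And>y q. norm y \<le> R + 1 \<Longrightarrow> F y q \<le> b \<Longrightarrow> norm q \<le> \<Lambda>"
    by (rule sublevel_bound[of "R + 1" b]) blast
  show ?thesis
  proof (rule that[OF \<Lambda>(1)])
    fix u assume u: "viscosity_subsolution F b UNIV u"
    show "\<Lambda>-lipschitz_on (cball 0 R) u"
      by (rule subsolution_lipschitz[OF u \<Lambda>(1) zero_less_one]) (use \<Lambda>(2) in force)
  qed
qed

lemma subsolution_continuous:
  assumes "viscosity_subsolution F b UNIV u"
  shows "continuous_on UNIV u"
proof (rule continuous_at_imp_continuous_on, rule ballI)
  fix y :: 'm
  obtain \<Lambda> where "\<Lambda>-lipschitz_on (cball 0 (norm y + 1)) u"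
    using subsolution_lipschitz_ball[of b "norm y + 1"] assms by metis
  then have "continuous_on (cball 0 (norm y + 1)) u" by (rule lipschitz_on_continuous_on)
  moreover have "y \<in> interior (cball 0 (norm y + 1))" by simp
  ultimately show "isCont u y" using continuous_on_interior by blast
qed

lemma zero_bounded_above: obtains B where "\<And>y. F y 0 \<le> B"
proof -
  obtain R where R: "\<And>y. norm y \<ge> R \<Longrightarrow> F y 0 \<le> 0"
    using at_zero unfolding filterlim_at_bot eventually_at_infinity by blast
  have "compact ((\<lambda>y. F y 0) ` cball 0 R)"
    by (intro compact_continuous_image compact_cball continuous_on_subset[OF continuous_fixed]) auto
  then obtain B where B: "\<And>y. y \<in> cball 0 R \<Longrightarrow> F y 0 \<le> B"
    using bounded_imp_bdd_above[OF compact_imp_bounded] unfolding bdd_above_def by (metis imageI)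
  have "F y 0 \<le> max B 0" for y
    using R[of y] B[of y] by (cases "norm y \<le> R") auto
  then show ?thesis by (rule that)
qed

lemma levels_nonempty: "{b. \<exists>u. viscosity_subsolution F b UNIV u} \<noteq> {}"
proof -
  obtain B where B: "\<And>y. F y 0 \<le> B" by (rule zero_bounded_above) blast
  have "viscosity_subsolution F B UNIV (\<lambda>_. 0)"
    by (rule viscosity_subsolution_C1[OF open_UNIV C1_gradient_on_const[of UNIV 0]]) (auto intro: B)
  then show ?thesis by blast
qed

lemma levels_bdd_below: "bdd_below {b. \<exists>u. viscosity_subsolution F b UNIV u}"
proof -
  obtain r C where r: "r > 0" "\<And>y q. y \<in> cball 0 1 \<Longrightarrow> r * norm q - C \<le> F y q"
    using coercive[OF compact_cball, of 0 1] by blast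
  show ?thesis
  proof (rule bdd_belowI)
    fix b assume "b \<in> {b. \<exists>u. viscosity_subsolution F b UNIV u}"
    then obtain u where "viscosity_subsolution F b UNIV u" by blast
    then obtain z q where "dist z 0 < 1" "F z q \<le> b" using subsolution_touched zero_less_one by metis
    moreover have "0 \<le> r * norm q" using r(1) by simp
    ultimately show "- C \<le> b" using r(2)[of z q] by simp
  qed
qed

abbreviation c where "c \<equiv> critical_value F"

text \<open>Subsolutions at levels decreasing to the critical value, normalised at the origin, are uniformly bounded and Lipschitz on every ball, so their upper limit
  is finite and is a subsolution by stability.\<close>

lemma critical_subsolution_exists: obtains w where "viscosity_subsolution F c UNIV w"
proof -
  have "\<exists>b u. viscosity_subsolution F b UNIV u \<and> c \<le> b \<and> b < c + inverse (Suc n)" for n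
  proof -
    have "Inf {b. \<exists>u. viscosity_subsolution F b UNIV u} < c + inverse (Suc n)"
      by (simp add: critical_value_def)
    then obtain b u where "viscosity_subsolution F b UNIV u" "b < c + inverse (Suc n)"
      using cInf_lessD[OF levels_nonempty] by blast
    moreover from this have "c \<le> b"
      unfolding critical_value_def by (intro cInf_lower[OF _ levels_bdd_below]) blast
    ultimately show ?thesis by blast
  qed
  then obtain b u' where u': "\<And>n. viscosity_subsolution F (b n) UNIV (u' n)"
    and b: "\<And>n. c \<le> b n" "\<And>n. b n < c + inverse (Suc n)" by metis
  have blim: "b \<longlonglongrightarrow> c"
  proof (rule tendsto_sandwich[OF _ _ tendsto_const])
    show "(\<lambda>n. c + inverse (real (Suc n))) \<longlonglongrightarrow> c"
      using tendsto_add[OF tendsto_const LIMSEQ_inverse_real_of_nat] by simp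
    show "\<forall>\<^sub>F n in sequentially. c \<le> b n" using b(1) by simp
    show "\<forall>\<^sub>F n in sequentially. b n \<le> c + inverse (real (Suc n))" using b(2) by (simp add: less_imp_le)
  qed
  define u where "u = (\<lambda>n z. u' n z - u' n 0)"
  have u: "viscosity_subsolution F (b n) UNIV (u n)" for n
    unfolding u_def by (rule viscosity_subsolution_add_const[OF u'])
  have u1: "viscosity_subsolution F (c + 1) UNIV (u n)" for n
  proof (rule viscosity_subsolution_mono[OF u])
    have "inverse (real (Suc n)) \<le> 1" by (simp add: field_simps)
    then show "b n \<le> c + 1" using b(2)[of n] by linarith
  qed
  have u0: "u n 0 = 0" for n by (simp add: u_def)
  have bound: "\<exists>B. \<forall>n. \<bar>u n z\<bar> \<le> B" for z
  proof -
    obtain \<Lambda> where "\<Lambda> \<ge> 0" "\<And>u. viscosity_subsolution F (c + 1) UNIV u \<Longrightarrow> \<Lambda>-lipschitz_on (cball 0 (norm z)) u"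
      by (rule subsolution_lipschitz_ball[of "c + 1" "norm z"]) blast
    then have "\<bar>u n z\<bar> \<le> \<Lambda> * norm z" for n
      using lipschitz_onD[of \<Lambda> "cball 0 (norm z)" "u n" z 0] u1[of n] u0[of n] by (simp add: dist_real_def)
    then show ?thesis by blast
  qed
  have above: "bdd_above ((\<lambda>k. u k z) ` {n..})" for z n
  proof -
    obtain B where "\<And>n. \<bar>u n z\<bar> \<le> B" using bound by blast
    then show ?thesis by (intro bdd_aboveI2[of _ _ B]) (rule abs_le_D1)
  qed
  have below: "bdd_below (range (\<lambda>n. SUP k\<in>{n..}. u k z))" for z
  proof -
    obtain B where B: "\<And>n. \<bar>u n z\<bar> \<le> B" using bound by blast
    have "- B \<le> (SUP k\<in>{n..}. u k z)" for n
      using B[of n] by (intro cSUP_upper2[OF above, of n]) auto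
    then show ?thesis by (rule bdd_belowI2)
  qed
  define w where "w = (\<lambda>z. INF n. SUP k\<in>{n..}. u k z)"
  have "viscosity_subsolution F c UNIV w"
  proof (rule viscosity_subsolution_half_relaxed_limit[OF continuous u blim])
    fix z t assume "w z < t"
    then obtain t' where t': "w z < t'" "t' < t" using dense by blast
    obtain n0 where "(SUP k\<in>{n0..}. u k z) < t'"
      using t'(1) cINF_less_iff[OF UNIV_not_empty below] unfolding w_def by blast
    then have n0: "u n z < t'" if "n \<ge> n0" for n
      using cSUP_upper[OF _ above, of n n0 z] that by force
    obtain \<Lambda> where \<Lambda>: "\<Lambda> \<ge> 0" "\<And>u. viscosity_subsolution F (c + 1) UNIV u \<Longrightarrow> \<Lambda>-lipschitz_on (cball 0 (norm z + 1)) u"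
      by (rule subsolution_lipschitz_ball[of "c + 1" "norm z + 1"]) blast
    define d where "d = min 1 ((t - t') / (\<Lambda> + 1))"
    have d: "d > 0" "d \<le> 1" "d \<le> (t - t') / (\<Lambda> + 1)" using t' \<Lambda>(1) by (auto simp: d_def)
    have "\<Lambda> * d \<le> t - t'"
    proof -
      have "\<Lambda> * d \<le> (\<Lambda> + 1) * d" using d(1) by simp
      also have "\<dots> \<le> t - t'" using d(3) \<Lambda>(1) by (simp add: field_simps)
      finally show ?thesis .
    qed
    show "\<exists>d>0. \<exists>n0. \<forall>n\<ge>n0. \<forall>z'. dist z' z < d \<longrightarrow> u n z' < t"
    proof (intro exI[of _ d] exI[of _ n0] conjI allI impI d(1))
      fix n z' assume n: "n0 \<le> n" and z': "dist z' z < d"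
      have "norm z' \<le> norm z + 1" using z' d(2) norm_triangle_sub[of z' z] by (simp add: dist_norm)
      then have "dist (u n z') (u n z) \<le> \<Lambda> * dist z' z"
        by (intro lipschitz_onD[OF \<Lambda>(2)[OF u1]]) auto
      also have "\<dots> \<le> \<Lambda> * d" using z' \<Lambda>(1) by (intro mult_left_mono) auto
      finally have "u n z' \<le> u n z + (t - t')" using \<open>\<Lambda> * d \<le> t - t'\<close> by (simp add: dist_real_def)
      then show "u n z' < t" using n0[OF n] by simp
    qed
  next
    fix z t n assume "t < w z"
    also have "\<dots> \<le> (SUP k\<in>{n..}. u k z)" unfolding w_def by (rule cINF_lower[OF below UNIV_I])
    finally show "\<exists>k\<ge>n. t < u k z"
      using less_cSUP_iff[OF _ above] by (metis atLeast_iff empty_iff order_refl)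
  qed
  then show ?thesis by (rule that)
qed

abbreviation Z where "Z \<equiv> critical_sublevel F"
abbreviation \<sigma> where "\<sigma> \<equiv> support_fn F"

text \<open>Gradients of test functions touching a critical subsolution exist at points accumulating at \<open>y\<close>;
  they stay bounded and accumulate in the sublevel at \<open>y\<close>.\<close>

lemma critical_sublevel_nonempty: "Z y \<noteq> {}"
proof -
  obtain w where w: "viscosity_subsolution F c UNIV w" by (rule critical_subsolution_exists)
  have "\<exists>z q. dist z y < inverse (real (Suc n)) \<and> F z q \<le> c" for n
  proof -
    have "inverse (real (Suc n)) > 0" by simp
    from subsolution_touched[OF w this, of y] show ?thesis by blast
  qed
  then obtain z q where z: "\<And>n. dist (z n) y < inverse (real (Suc n))" and q: "\<And>n. F (z n) (q n) \<le> c"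
    by metis
  have zlim: "z \<longlonglongrightarrow> y"
    using z by (intro metric_tendsto_imp_tendsto[OF LIMSEQ_inverse_real_of_nat]) (auto intro!: always_eventually less_imp_le)
  obtain \<Lambda> where \<Lambda>: "\<And>y' q. norm y' \<le> norm y + 1 \<Longrightarrow> F y' q \<le> c \<Longrightarrow> norm q \<le> \<Lambda>"
    by (rule sublevel_bound[of "norm y + 1" c]) blast
  have "q n \<in> cball 0 \<Lambda>" for n
  proof -
    have "inverse (real (Suc n)) \<le> 1" by (simp add: field_simps)
    then have "norm (z n) \<le> norm y + 1"
      using z[of n] norm_triangle_sub[of "z n" y] by (simp add: dist_norm)
    then show ?thesis using \<Lambda> q by simp
  qed
  then obtain q' r where r: "strict_mono r" "(q \<circ> r) \<longlonglongrightarrow> q'"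
    using compact_cball[of "0::'m" \<Lambda>] unfolding compact_def by metis
  have "F y q' \<le> c"
    by (rule sublevel_limit[OF LIMSEQ_subseq_LIMSEQ[OF zlim r(1)] r(2)]) (simp add: q)
  then show ?thesis by (auto simp: critical_sublevel_def)
qed

lemma critical_sublevel_bound:
  obtains \<Lambda> where "\<Lambda> \<ge> 0" "\<And>y q. norm y \<le> R \<Longrightarrow> q \<in> Z y \<Longrightarrow> norm q \<le> \<Lambda>"
  using sublevel_bound[of R c] unfolding critical_sublevel_def by (metis mem_Collect_eq)

lemma support_bdd_above: "bdd_above ((\<lambda>q. q \<bullet> v) ` Z y)"
proof -
  obtain \<Lambda> where "\<And>q. q \<in> Z y \<Longrightarrow> norm q \<le> \<Lambda>"
    using critical_sublevel_bound[of "norm y"] by (metis order_refl)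
  then have "q \<bullet> v \<le> \<Lambda> * norm v" if "q \<in> Z y" for q
    using norm_cauchy_schwarz[of q v] that by (meson mult_right_mono norm_ge_zero order_trans)
  then show ?thesis by (rule bdd_aboveI2)
qed

lemma inner_le_support: "q \<in> Z y \<Longrightarrow> q \<bullet> v \<le> \<sigma> y v"
  unfolding support_fn_def by (rule cSUP_upper[OF _ support_bdd_above])

lemma support_le: "(\<And>q. q \<in> Z y \<Longrightarrow> q \<bullet> v \<le> t) \<Longrightarrow> \<sigma> y v \<le> t"
  unfolding support_fn_def by (rule cSUP_least[OF critical_sublevel_nonempty])

lemma support_zero: "\<sigma> y 0 = 0"
  unfolding support_fn_def using critical_sublevel_nonempty[of y] by simp

lemma support_scale:
  assumes "s \<ge> 0"
  shows "\<sigma> y (s *\<^sub>R v) = s * \<sigma> y v"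
proof (rule antisym)
  show "\<sigma> y (s *\<^sub>R v) \<le> s * \<sigma> y v"
    using inner_le_support assms by (intro support_le) (auto intro!: mult_left_mono)
  show "s * \<sigma> y v \<le> \<sigma> y (s *\<^sub>R v)"
  proof (cases "s = 0")
    case False
    then have "\<sigma> y v \<le> \<sigma> y (s *\<^sub>R v) / s"
      using inner_le_support[of _ y "s *\<^sub>R v"] assms
      by (intro support_le) (simp add: field_simps)
    then show ?thesis using False assms by (simp add: field_simps)
  qed (simp add: support_zero)
qed

lemma support_abs_le:
  assumes "\<And>q. q \<in> Z y \<Longrightarrow> norm q \<le> \<Lambda>"
  shows "\<bar>\<sigma> y v\<bar> \<le> \<Lambda> * norm v"
proof -
  have *: "\<bar>q \<bullet> v\<bar> \<le> \<Lambda> * norm v" if "q \<in> Z y" for q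
    using Cauchy_Schwarz_ineq2[of q v] assms[OF that] by (meson mult_right_mono norm_ge_zero order_trans)
  obtain q where "q \<in> Z y" using critical_sublevel_nonempty by blast
  then have "- (\<Lambda> * norm v) \<le> \<sigma> y v" using *[of q] inner_le_support[of q y v] by linarith
  moreover have "\<sigma> y v \<le> \<Lambda> * norm v" by (rule support_le) (use * in \<open>simp add: abs_le_iff\<close>)
  ultimately show ?thesis by linarith
qed

lemma mem_critical_sublevel_if_le_support:
  assumes "\<And>v. p \<bullet> v \<le> \<sigma> y v"
  shows "p \<in> Z y"
proof (rule ccontr)
  assume p: "p \<notin> Z y"
  have "convex (Z y)" unfolding critical_sublevel_def by (rule convex_sublevel)
  moreover have "closed (Z y)" unfolding critical_sublevel_def
  proof (rule closed_Collect_le[OF _ continuous_on_const])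
    have "continuous_on UNIV (\<lambda>q. (y, q))" by (intro continuous_intros)
    from continuous_on_compose2[OF continuous this] show "continuous_on UNIV (F y)" by simp
  qed
  ultimately obtain a b where "a \<bullet> p < b" "\<And>x. x \<in> Z y \<Longrightarrow> b < a \<bullet> x"
    using separating_hyperplane_closed_point[OF _ _ p] by blast
  then have "\<sigma> y (- a) \<le> - b" "- b < p \<bullet> - a"
    by (auto intro!: support_le simp: inner_commute less_imp_le)
  with assms[of "- a"] show False by simp
qed

text \<open>Upper semicontinuity of the support function, in the form used by the segment estimate: the
  sublevels are locally bounded with closed graph. They need not depend lower semicontinuously on
  the point where the minimum of \<open>F y\<close> equals the critical value, so the support function need not
  be continuous in \<open>y\<close>.\<close>

lemma support_upper:
  assumes "\<sigma> y v < t"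
  obtains d where "d > 0" "\<And>z v' q. dist z y < d \<Longrightarrow> dist v' v < d \<Longrightarrow> q \<in> Z z \<Longrightarrow> q \<bullet> v' < t"
proof (rule ccontr)
  assume neg: "\<not> thesis"
  have "\<exists>z v' q. dist z y < inverse (real (Suc n)) \<and> dist v' v < inverse (real (Suc n)) \<and> q \<in> Z z \<and> t \<le> q \<bullet> v'" for n
  proof (rule ccontr)
    assume "\<not> ?thesis"
    then have "dist z y < inverse (real (Suc n)) \<Longrightarrow> dist v' v < inverse (real (Suc n)) \<Longrightarrow> q \<in> Z z \<Longrightarrow> q \<bullet> v' < t"
      for z v' q by (meson not_less)
    then have thesis by (intro that[of "inverse (real (Suc n))"]) auto
    with neg show False by simp
  qed
  then obtain z v' q where z: "\<And>n. dist (z n) y < inverse (real (Suc n))"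
    and v': "\<And>n. dist (v' n) v < inverse (real (Suc n))"
    and q: "\<And>n. q n \<in> Z (z n)" and t: "\<And>n. t \<le> q n \<bullet> v' n" by metis
  have zlim: "z \<longlonglongrightarrow> y"
    using z by (intro metric_tendsto_imp_tendsto[OF LIMSEQ_inverse_real_of_nat]) (auto intro!: always_eventually less_imp_le)
  have vlim: "v' \<longlonglongrightarrow> v"
    using v' by (intro metric_tendsto_imp_tendsto[OF LIMSEQ_inverse_real_of_nat]) (auto intro!: always_eventually less_imp_le)
  obtain \<Lambda> where \<Lambda>: "\<And>y' q. norm y' \<le> norm y + 1 \<Longrightarrow> q \<in> Z y' \<Longrightarrow> norm q \<le> \<Lambda>"
    by (rule critical_sublevel_bound[of "norm y + 1"]) blast
  have "q n \<in> cball 0 \<Lambda>" for n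
  proof -
    have "inverse (real (Suc n)) \<le> 1" by (simp add: field_simps)
    then have "norm (z n) \<le> norm y + 1"
      using z[of n] norm_triangle_sub[of "z n" y] by (simp add: dist_norm)
    then show ?thesis using \<Lambda> q by simp
  qed
  then obtain q' r where r: "strict_mono r" "(q \<circ> r) \<longlonglongrightarrow> q'"
    using compact_cball[of "0::'m" \<Lambda>] unfolding compact_def by metis
  have "F y q' \<le> c"
    by (rule sublevel_limit[OF LIMSEQ_subseq_LIMSEQ[OF zlim r(1)] r(2)])
      (use q in \<open>simp add: critical_sublevel_def\<close>)
  then have "q' \<bullet> v \<le> \<sigma> y v" by (intro inner_le_support) (simp add: critical_sublevel_def)
  moreover have "(\<lambda>n. (q \<circ> r) n \<bullet> (v' \<circ> r) n) \<longlonglongrightarrow> q' \<bullet> v"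
    by (intro tendsto_inner r(2) LIMSEQ_subseq_LIMSEQ[OF vlim r(1)])
  then have "t \<le> q' \<bullet> v" by (rule LIMSEQ_le_const) (use t in simp)
  ultimately show False using assms by simp
qed

lemma support_upper_less:
  assumes "\<sigma> y v < t"
  obtains d where "d > 0" "\<And>z v'. dist z y < d \<Longrightarrow> dist v' v < d \<Longrightarrow> \<sigma> z v' < t"
proof -
  obtain t' where t': "\<sigma> y v < t'" "t' < t" using assms dense by blast
  obtain d where d: "d > 0" "\<And>z v' q. dist z y < d \<Longrightarrow> dist v' v < d \<Longrightarrow> q \<in> Z z \<Longrightarrow> q \<bullet> v' < t'"
    by (rule support_upper[OF t'(1)]) blast
  have "\<sigma> z v' < t" if "dist z y < d" "dist v' v < d" for z v'
    using support_le[of z v' t'] d(2)[OF that] t'(2) by (meson less_imp_le le_less_trans)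
  with d(1) show ?thesis by (rule that)
qed

lemma support_borel: "(\<lambda>(y, v). \<sigma> y v) \<in> borel_measurable borel"
proof (rule borel_measurableI_less)
  fix t
  have "open {p. (\<lambda>(y, v). \<sigma> y v) p < t}"
  proof (subst open_subopen, intro ballI)
    fix p assume "p \<in> {p. (\<lambda>(y, v). \<sigma> y v) p < t}"
    then obtain y v where p: "p = (y, v)" "\<sigma> y v < t" by (cases p) auto
    obtain d where "d > 0" "\<And>z v'. dist z y < d \<Longrightarrow> dist v' v < d \<Longrightarrow> \<sigma> z v' < t"
      by (rule support_upper_less[OF p(2)]) blast
    then show "\<exists>T. open T \<and> p \<in> T \<and> T \<subseteq> {p. (\<lambda>(y, v). \<sigma> y v) p < t}"
      by (intro exI[of _ "ball y d \<times> ball v d"]) (auto simp: p(1) dist_commute intro: open_Times)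
  qed
  then show "{p \<in> space borel. (\<lambda>(y, v). \<sigma> y v) p < t} \<in> sets borel" by simp
qed

end

section \<open>Intrinsic length and intrinsic distance\<close>

lemma velocity_eq:
  assumes "s \<in> {0<..<1}" "(\<xi> has_vector_derivative v) (at s)"
  shows "velocity \<xi> s = v"
  unfolding velocity_def
  by (rule vector_derivative_within_closed_interval[OF zero_less_one])
    (use assms in \<open>auto intro: has_vector_derivative_at_within\<close>)

lemma lipschitz_curve_velocity:
  assumes "lipschitz_curve \<xi> y1 y2"
  obtains v N B where "v \<in> borel_measurable borel" "\<And>s. norm (v s) \<le> B" "negligible N"
    "\<And>s. s \<in> {0..1} - N \<Longrightarrow> s \<in> {0<..<1} \<and> (\<xi> has_vector_derivative v s) (at s) \<and> velocity \<xi> s = v s"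
    "\<And>c d. 0 \<le> c \<Longrightarrow> c \<le> d \<Longrightarrow> d \<le> 1 \<Longrightarrow> (v has_integral (\<xi> d - \<xi> c)) {c..d}"
proof -
  obtain L where lip: "L-lipschitz_on {0..1} \<xi>" using assms unfolding lipschitz_curve_def by blast
  obtain v N B where v: "v \<in> borel_measurable borel" "\<And>s. norm (v s) \<le> B" "negligible N"
    and deriv: "\<And>s. s \<in> {0<..<1} - N \<Longrightarrow> (\<xi> has_vector_derivative v s) (at s)"
    and int: "\<And>c d. 0 \<le> c \<Longrightarrow> c \<le> d \<Longrightarrow> d \<le> 1 \<Longrightarrow> (v has_integral (\<xi> d - \<xi> c)) {c..d}"
    by (rule lipschitz_on_interval_AE_derivative[OF lip zero_le_one]) (rule that; assumption)
  show ?thesis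
  proof (rule that[of v B "N \<union> {0, 1}"])
    show "negligible (N \<union> {0, 1})" using v(3) by simp
    show "s \<in> {0<..<1} \<and> (\<xi> has_vector_derivative v s) (at s) \<and> velocity \<xi> s = v s"
      if "s \<in> {0..1} - (N \<union> {0, 1})" for s
    proof -
      have s: "s \<in> {0<..<1}" "s \<in> {0<..<1} - N" using that by auto
      with velocity_eq[OF s(1) deriv[OF s(2)]] deriv[OF s(2)] show ?thesis by blast
    qed
  qed (fact v int)+
qed

lemma lipschitz_curve_bounded:
  assumes "lipschitz_curve \<xi> y1 y2"
  obtains R where "\<And>s. s \<in> {0..1} \<Longrightarrow> norm (\<xi> s) \<le> R"
proof -
  obtain L where "L-lipschitz_on {0..1} \<xi>" using assms unfolding lipschitz_curve_def by blast
  then have "compact (\<xi> ` {0..1})"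
    by (intro compact_continuous_image lipschitz_on_continuous_on) auto
  then have "bounded (\<xi> ` {0..1})" by (rule compact_imp_bounded)
  then obtain R where "\<forall>x\<in>\<xi> ` {0..1}. norm x \<le> R" unfolding bounded_iff by blast
  then show ?thesis by (intro that) auto
qed

text \<open>At the exceptional times the velocity is an arbitrary value, but these times form a null set.\<close>

lemma lipschitz_curve_integrable:
  fixes G :: "'m::euclidean_space \<times> 'm \<Rightarrow> real"
  assumes curve: "lipschitz_curve \<xi> y1 y2" and G: "G \<in> borel_measurable borel"
    and bound: "\<And>R. \<exists>C. \<forall>y v. norm y \<le> R \<longrightarrow> norm v \<le> R \<longrightarrow> \<bar>G (y, v)\<bar> \<le> C"
  shows "(\<lambda>s. G (\<xi> s, velocity \<xi> s)) integrable_on {0..1}"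
proof -
  obtain v N B where v: "v \<in> borel_measurable borel" "\<And>s. norm (v s) \<le> B" and N: "negligible N"
    and vel: "\<And>s. s \<in> {0..1} - N \<Longrightarrow> s \<in> {0<..<1} \<and> (\<xi> has_vector_derivative v s) (at s) \<and> velocity \<xi> s = v s"
    by (rule lipschitz_curve_velocity[OF curve]) (rule that; assumption)
  obtain L where lip: "L-lipschitz_on {0..1} \<xi>" using curve unfolding lipschitz_curve_def by blast
  obtain R where R: "\<And>s. s \<in> {0..1} \<Longrightarrow> norm (\<xi> s) \<le> R" by (rule lipschitz_curve_bounded[OF curve]) blast
  obtain C where C: "\<And>y v. norm y \<le> max R B \<Longrightarrow> norm v \<le> max R B \<Longrightarrow> \<bar>G (y, v)\<bar> \<le> C"
    using bound[of "max R B"] by blast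
  have "(\<lambda>s. G (\<xi> s, v s)) integrable_on {0..1}"
  proof (rule measurable_bounded_by_integrable_imp_integrable)
    have "\<xi> \<in> borel_measurable (lebesgue_on {0..1})"
      by (rule continuous_imp_measurable_on_sets_lebesgue[OF lipschitz_on_continuous_on[OF lip]]) simp
    moreover have "v \<in> borel_measurable (lebesgue_on {0..1})"
      using v(1) by (intro measurable_restrict_space1 measurable_completion) simp
    ultimately have "(\<lambda>s. (\<xi> s, v s)) \<in> borel_measurable (lebesgue_on {0..1})"
      by (rule borel_measurable_Pair)
    then show "(\<lambda>s. G (\<xi> s, v s)) \<in> borel_measurable (lebesgue_on {0..1})"
      by (rule measurable_compose[OF _ G])
    show "(\<lambda>s. C) integrable_on {0..1::real}" by (rule integrable_const_ivl)
    show "norm (G (\<xi> s, v s)) \<le> C" if "s \<in> {0..1}" for s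
      using C[of "\<xi> s" "v s"] R[OF that] v(2)[of s] by simp
  qed simp
  then show ?thesis
    by (rule integrable_spike[OF _ N]) (use vel in auto)
qed

lemma speed_integrable:
  assumes "lipschitz_curve \<xi> y1 y2"
  shows "(\<lambda>s. norm (velocity \<xi> s)) integrable_on {0..1}"
proof -
  have "(\<lambda>p::'a \<times> 'a. norm (snd p)) \<in> borel_measurable borel"
    by (intro borel_measurable_continuous_onI continuous_intros)
  from lipschitz_curve_integrable[OF assms this] show ?thesis by fastforce
qed

lemma lipschitz_curve_straight: "lipschitz_curve (\<lambda>s. y1 + s *\<^sub>R (y2 - y1)) y1 y2"
proof -
  have "(norm (y2 - y1))-lipschitz_on {0..1} (\<lambda>s. y1 + s *\<^sub>R (y2 - y1))"
  proof (rule lipschitz_onI)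
    fix s t :: real
    have "y1 + s *\<^sub>R (y2 - y1) - (y1 + t *\<^sub>R (y2 - y1)) = (s - t) *\<^sub>R (y2 - y1)"
      by (simp add: algebra_simps)
    then show "dist (y1 + s *\<^sub>R (y2 - y1)) (y1 + t *\<^sub>R (y2 - y1)) \<le> norm (y2 - y1) * dist s t"
      by (simp only: dist_norm norm_scaleR real_norm_def mult.commute)
  qed simp
  then show ?thesis unfolding lipschitz_curve_def by auto
qed

definition concat_segment :: "(real \<Rightarrow> 'm::euclidean_space) \<Rightarrow> 'm \<Rightarrow> 'm \<Rightarrow> real \<Rightarrow> 'm" where
  "concat_segment \<xi> y1 y2 s = (if s \<le> 1/2 then \<xi> (2 * s) else y1 + (2 * s - 1) *\<^sub>R (y2 - y1))"

lemma lipschitz_curve_concat_segment: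
  assumes "lipschitz_curve \<xi> y0 y1"
  shows "lipschitz_curve (concat_segment \<xi> y1 y2) y0 y2"
proof -
  obtain L where lip: "L-lipschitz_on {0..1} \<xi>" and ends: "\<xi> 0 = y0" "\<xi> 1 = y1"
    using assms unfolding lipschitz_curve_def by blast
  have L: "L \<ge> 0" by (rule lipschitz_on_nonneg[OF lip])
  define K where "K = 2 * (L + norm (y2 - y1))"
  have "K-lipschitz_on {0..1} (\<lambda>s. if s \<le> 1/2 then \<xi> (2 * s) else y1 + (2 * s - 1) *\<^sub>R (y2 - y1))"
  proof (rule lipschitz_on_concat)
    show "K-lipschitz_on {0..1/2} (\<lambda>s. \<xi> (2 * s))"
    proof (rule lipschitz_onI)
      fix s t :: real assume "s \<in> {0..1/2}" "t \<in> {0..1/2}"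
      then have "dist (\<xi> (2 * s)) (\<xi> (2 * t)) \<le> L * dist (2 * s) (2 * t)"
        by (intro lipschitz_onD[OF lip]) auto
      also have "\<dots> = 2 * L * dist s t" by (simp add: dist_real_def abs_if)
      also have "\<dots> \<le> K * dist s t" unfolding K_def by (intro mult_right_mono) auto
      finally show "dist (\<xi> (2 * s)) (\<xi> (2 * t)) \<le> K * dist s t" .
    qed (use L in \<open>simp add: K_def\<close>)
    show "K-lipschitz_on {1/2..1} (\<lambda>s. y1 + (2 * s - 1) *\<^sub>R (y2 - y1))"
    proof (rule lipschitz_onI)
      fix s t :: real
      have "y1 + (2 * s - 1) *\<^sub>R (y2 - y1) - (y1 + (2 * t - 1) *\<^sub>R (y2 - y1)) = (2 * (s - t)) *\<^sub>R (y2 - y1)"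
        by (simp add: algebra_simps)
      then have "dist (y1 + (2 * s - 1) *\<^sub>R (y2 - y1)) (y1 + (2 * t - 1) *\<^sub>R (y2 - y1)) = 2 * norm (y2 - y1) * dist s t"
        by (simp only: dist_norm norm_scaleR real_norm_def abs_mult) simp
      also have "\<dots> \<le> K * dist s t" unfolding K_def using L by (intro mult_right_mono) auto
      finally show "dist (y1 + (2 * s - 1) *\<^sub>R (y2 - y1)) (y1 + (2 * t - 1) *\<^sub>R (y2 - y1)) \<le> K * dist s t" .
    qed (use L in \<open>simp add: K_def\<close>)
    show "\<xi> (2 * (1/2)) = y1 + (2 * (1/2) - 1) *\<^sub>R (y2 - y1)" using ends by simp
  qed
  then show ?thesis
    unfolding lipschitz_curve_def concat_segment_def[abs_def] using ends by auto
qed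

context coercive_hamiltonian
begin

lemma support_bound:
  obtains \<Lambda> where "\<Lambda> \<ge> 0" "\<And>y v. norm y \<le> R \<Longrightarrow> \<bar>\<sigma> y v\<bar> \<le> \<Lambda> * norm v"
proof -
  obtain \<Lambda> where \<Lambda>: "\<Lambda> \<ge> 0" "\<And>y q. norm y \<le> R \<Longrightarrow> q \<in> Z y \<Longrightarrow> norm q \<le> \<Lambda>"
    by (rule critical_sublevel_bound[of R]) blast
  show ?thesis by (rule that[OF \<Lambda>(1)]) (rule support_abs_le[OF \<Lambda>(2)])
qed

lemma intrinsic_integrable:
  assumes "lipschitz_curve \<xi> y1 y2"
  shows "(\<lambda>s. \<sigma> (\<xi> s) (velocity \<xi> s)) integrable_on {0..1}"
proof -
  have "\<exists>C. \<forall>y v. norm y \<le> R \<longrightarrow> norm v \<le> R \<longrightarrow> \<bar>case (y, v) of (y, v) \<Rightarrow> \<sigma> y v\<bar> \<le> C" for R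
  proof -
    obtain \<Lambda> where \<Lambda>: "\<Lambda> \<ge> 0" "\<And>y v. norm y \<le> R \<Longrightarrow> \<bar>\<sigma> y v\<bar> \<le> \<Lambda> * norm v"
      by (rule support_bound[of R]) blast
    have "\<bar>\<sigma> y v\<bar> \<le> \<Lambda> * R" if "norm y \<le> R" "norm v \<le> R" for y v
      using \<Lambda>(2)[OF that(1), of v] mult_left_mono[OF that(2) \<Lambda>(1)] by linarith
    then show ?thesis by auto
  qed
  from lipschitz_curve_integrable[OF assms support_borel this] show ?thesis by simp
qed

text \<open>The curve is replaced near time \<open>s\<close> by the chord \<open>h *\<^sub>R w\<close>, whose direction \<open>w\<close> is close to \<open>v\<close>; the
  segment estimate and upper semicontinuity bound the increment along the chord. No derivative of
  \<open>u\<close> itself is involved.\<close>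

lemma derivative_along_curve_le_support:
  assumes u: "viscosity_subsolution F c UNIV u"
    and \<xi>: "(\<xi> has_vector_derivative v) (at s)"
    and D: "((\<lambda>s. u (\<xi> s)) has_real_derivative D) (at s)"
  shows "D \<le> \<sigma> (\<xi> s) v"
proof (rule dense_ge)
  fix t assume "\<sigma> (\<xi> s) v < t"
  then obtain d where d: "d > 0" "\<And>z v' q. dist z (\<xi> s) < d \<Longrightarrow> dist v' v < d \<Longrightarrow> q \<in> Z z \<Longrightarrow> q \<bullet> v' < t"
    by (rule support_upper) blast
  show "D \<le> t"
  proof (rule field_le_epsilon)
    fix e :: real assume e: "e > 0"
    obtain d1 where d1: "d1 > 0" "\<And>s'. norm (s' - s) < d1 \<Longrightarrow>
        norm (\<xi> s' - \<xi> s - (s' - s) *\<^sub>R v) \<le> d / 2 * norm (s' - s)"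
      using \<xi> d(1) unfolding has_vector_derivative_def has_derivative_at_alt
      by (metis half_gt_zero)
    obtain d2 where d2: "d2 > 0" "\<And>s'. norm (s' - s) < d2 \<Longrightarrow>
        norm (u (\<xi> s') - u (\<xi> s) - D * (s' - s)) \<le> e * norm (s' - s)"
      using D e unfolding has_field_derivative_def has_derivative_at_alt by metis
    define M where "M = norm v + d"
    have M: "M > 0" using d(1) by (simp add: M_def add_nonneg_pos)
    define m where "m = min (min d1 d2) (d / M)"
    have m: "m > 0" "m \<le> d1" "m \<le> d2" "m \<le> d / M" using d(1) d1(1) d2(1) M by (auto simp: m_def)
    define h where "h = m / 2"
    have "h < m" "h > 0" using m(1) by (simp_all add: h_def)
    with m have h: "h > 0" "h < d1" "h < d2" "h < d / M" by linarith+
    have hM: "h * M < d" using h(4) M by (simp add: pos_less_divide_eq)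
    define w where "w = (\<xi> (s + h) - \<xi> s) /\<^sub>R h"
    have hw: "h *\<^sub>R w = \<xi> (s + h) - \<xi> s" using h(1) by (simp add: w_def)
    have "norm (h *\<^sub>R (w - v)) \<le> d / 2 * h"
      using d1(2)[of "s + h"] h by (simp add: hw scaleR_diff_right)
    then have "h * norm (w - v) \<le> h * (d / 2)"
      using h(1) unfolding norm_scaleR by (simp only: mult.commute abs_of_pos)
    then have wv: "norm (w - v) < d" using h(1) d(1) by simp
    then have "norm w < M" using norm_triangle_sub[of w v] by (simp add: M_def)
    then have "h * norm w < h * M" using h(1) by simp
    then have "h * norm w < h * M" using h(1) by simp
    moreover have "norm (h *\<^sub>R w) = h * norm w" using h(1) by simp
    ultimately have nhw: "norm (h *\<^sub>R w) < d" using hM by linarith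
    have "u (\<xi> (s + h)) - u (\<xi> s) \<le> h * t"
    proof (cases "w = 0")
      case True
      obtain q where "q \<in> Z (\<xi> s)" using critical_sublevel_nonempty by blast
      then have "0 < t" using d(2)[of "\<xi> s" w q] d(1) wv True by (simp add: dist_norm)
      then show ?thesis using hw True h(1) by simp
    next
      case False
      have "u (\<xi> s + h *\<^sub>R w) - u (\<xi> s) \<le> h * t"
      proof (rule subsolution_increment_along_segment[OF u])
        show "h *\<^sub>R w \<noteq> 0" "d - norm (h *\<^sub>R w) > 0" using False h nhw by auto
        fix \<tau> z q assume \<tau>: "0 \<le> \<tau>" "\<tau> \<le> 1" and z: "dist z (\<xi> s + \<tau> *\<^sub>R h *\<^sub>R w) < d - norm (h *\<^sub>R w)"
          and q: "F z q \<le> c"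
        have "dist z (\<xi> s) \<le> dist z (\<xi> s + \<tau> *\<^sub>R h *\<^sub>R w) + dist (\<xi> s + \<tau> *\<^sub>R h *\<^sub>R w) (\<xi> s)"
          by (rule dist_triangle)
        also have "dist (\<xi> s + \<tau> *\<^sub>R h *\<^sub>R w) (\<xi> s) = \<tau> * norm (h *\<^sub>R w)"
          using \<tau> by (simp add: dist_norm abs_mult)
        also have "\<tau> * norm (h *\<^sub>R w) \<le> norm (h *\<^sub>R w)" using \<tau> by (simp add: mult_left_le_one_le)
        finally have "dist z (\<xi> s) < d" using z by linarith
        then have "q \<bullet> w < t" using wv q by (intro d(2)) (auto simp: dist_norm critical_sublevel_def)
        then show "q \<bullet> h *\<^sub>R w < h * t" using h(1) by simp
      qed
      then show ?thesis by (simp add: hw)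
    qed
    moreover have "\<bar>u (\<xi> (s + h)) - u (\<xi> s) - D * h\<bar> \<le> e * h"
      using d2(2)[of "s + h"] h by simp
    ultimately have "h * D \<le> h * (t + e)" by (simp add: algebra_simps abs_le_iff)
    then show "D \<le> t + e" using h(1) by simp
  qed
qed

lemma subsolution_along_curve_lipschitz:
  assumes u: "viscosity_subsolution F b UNIV u" and \<xi>: "lipschitz_curve \<xi> y1 y2"
  obtains K where "K-lipschitz_on {0..1} (\<lambda>s. u (\<xi> s))"
proof -
  obtain L where L: "L-lipschitz_on {0..1} \<xi>" using \<xi> unfolding lipschitz_curve_def by blast
  obtain R where R: "\<And>s. s \<in> {0..1} \<Longrightarrow> norm (\<xi> s) \<le> R" by (rule lipschitz_curve_bounded[OF \<xi>]) blast
  obtain \<Lambda> where "\<Lambda>-lipschitz_on (cball 0 R) u"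
    using subsolution_lipschitz_ball[of b R] u by metis
  then have "\<Lambda>-lipschitz_on (\<xi> ` {0..1}) u" by (rule lipschitz_on_subset) (use R in auto)
  from lipschitz_on_compose2[OF L this] show ?thesis by (rule that)
qed

text \<open>Half of the duality between subsolutions and curves: it makes the intrinsic distance finite and
  bounds it below by every increment of a subsolution.\<close>

lemma subsolution_increment_le_length:
  assumes u: "viscosity_subsolution F c UNIV u" and \<xi>: "lipschitz_curve \<xi> y1 y2"
  shows "u y2 - u y1 \<le> intrinsic_length F \<xi>"
proof -
  obtain v N B where N: "negligible N"
    and vel: "\<And>s. s \<in> {0..1} - N \<Longrightarrow> s \<in> {0<..<1} \<and> (\<xi> has_vector_derivative v s) (at s) \<and> velocity \<xi> s = v s"
    by (rule lipschitz_curve_velocity[OF \<xi>]) (rule that; assumption)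
  obtain K where K: "K-lipschitz_on {0..1} (\<lambda>s. u (\<xi> s))"
    by (rule subsolution_along_curve_lipschitz[OF u \<xi>])
  have "u (\<xi> 1) - u (\<xi> 0) \<le> integral {0..1} (\<lambda>s. \<sigma> (\<xi> s) (velocity \<xi> s))"
  proof (rule lipschitz_increment_le_integral[OF K zero_le_one intrinsic_integrable[OF \<xi>] N])
    fix s D assume s: "s \<in> {0<..<1} - N" and D: "((\<lambda>s. u (\<xi> s)) has_real_derivative D) (at s)"
    from s have "s \<in> {0..1} - N" by auto
    from vel[OF this] have v: "(\<xi> has_vector_derivative v s) (at s)" "velocity \<xi> s = v s" by auto
    show "D \<le> \<sigma> (\<xi> s) (velocity \<xi> s)"
      unfolding v(2) by (rule derivative_along_curve_le_support[OF u v(1) D])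
  qed
  then show ?thesis using \<xi> by (simp add: intrinsic_length_def lipschitz_curve_def)
qed

abbreviation S where "S \<equiv> intrinsic_dist F"

lemma lengths_nonempty: "{intrinsic_length F \<xi> | \<xi>. lipschitz_curve \<xi> y1 y2} \<noteq> {}"
  using lipschitz_curve_straight by blast

lemma lengths_bdd_below: "bdd_below {intrinsic_length F \<xi> | \<xi>. lipschitz_curve \<xi> y1 y2}"
proof -
  obtain w where w: "viscosity_subsolution F c UNIV w" by (rule critical_subsolution_exists) blast
  show ?thesis
    by (rule bdd_belowI[of _ "w y2 - w y1"]) (use subsolution_increment_le_length[OF w] in blast)
qed

lemma intrinsic_dist_le: "lipschitz_curve \<xi> y1 y2 \<Longrightarrow> S y1 y2 \<le> intrinsic_length F \<xi>"
  unfolding intrinsic_dist_def by (rule cInf_lower[OF _ lengths_bdd_below]) blast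

lemma subsolution_increment_le_dist:
  assumes u: "viscosity_subsolution F c UNIV u"
  shows "u y2 - u y1 \<le> S y1 y2"
  unfolding intrinsic_dist_def
  by (rule cInf_greatest[OF lengths_nonempty]) (use subsolution_increment_le_length[OF u] in blast)

lemma intrinsic_dist_self_le: "S y y \<le> 0"
proof -
  let ?\<xi> = "\<lambda>s::real. y + s *\<^sub>R (y - y)"
  have "velocity ?\<xi> s = 0" if "s \<in> {0<..<1}" for s
    by (rule velocity_eq[OF that]) simp
  then have "integral {0..1} (\<lambda>s. \<sigma> (?\<xi> s) (velocity ?\<xi> s)) = integral {0..1} (\<lambda>s::real. 0::real)"
    by (intro integral_spike[of "{0,1}"]) (auto simp: support_zero)
  then have "intrinsic_length F ?\<xi> = 0" unfolding intrinsic_length_def by simp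
  then show ?thesis using intrinsic_dist_le[OF lipschitz_curve_straight[of y y]] by simp
qed

text \<open>The support function is positively homogeneous in the velocity, so running through each piece at
  double speed does not change its length.\<close>

lemma length_concat_segment_le:
  assumes \<xi>: "lipschitz_curve \<xi> y0 y1"
    and t: "\<And>s. 0 \<le> s \<Longrightarrow> s \<le> 1 \<Longrightarrow> \<sigma> (y1 + s *\<^sub>R (y2 - y1)) (y2 - y1) \<le> t"
  shows "intrinsic_length F (concat_segment \<xi> y1 y2) \<le> intrinsic_length F \<xi> + t"
proof -
  let ?\<eta> = "concat_segment \<xi> y1 y2"
  define k where "k = (\<lambda>s. \<sigma> (?\<eta> s) (velocity ?\<eta> s))"
  define g where "g = (\<lambda>s. \<sigma> (\<xi> s) (velocity \<xi> s))"
  have kint: "k integrable_on {0..1}"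
    unfolding k_def by (rule intrinsic_integrable[OF lipschitz_curve_concat_segment[OF \<xi>]])
  have gint: "(g has_integral intrinsic_length F \<xi>) {0..1}"
    unfolding g_def intrinsic_length_def by (rule integrable_integral[OF intrinsic_integrable[OF \<xi>]])
  obtain v N B where N: "negligible N"
    and vel: "\<And>s. s \<in> {0..1} - N \<Longrightarrow> s \<in> {0<..<1} \<and> (\<xi> has_vector_derivative v s) (at s) \<and> velocity \<xi> s = v s"
    by (rule lipschitz_curve_velocity[OF \<xi>]) (rule that; assumption)
  define N' where "N' = (\<lambda>x. x / 2) ` N \<union> {1/2}"
  have "(\<lambda>x::real. x / 2) differentiable_on N"
    by (rule bounded_linear_imp_differentiable_on[OF bounded_linear_divide])
  then have "negligible N'"
    unfolding N'_def using N by (simp add: negligible_differentiable_image_negligible)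
  have first: "k s = 2 * g (2 * s)" if s: "s \<in> {0..1/2} - N'" for s
  proof -
    have "2 * s \<notin> N"
    proof
      assume "2 * s \<in> N"
      then have "(2 * s) / 2 \<in> N'" unfolding N'_def by blast
      then show False using s by simp
    qed
    moreover have "s \<noteq> 1/2" using s by (auto simp: N'_def)
    ultimately have s2: "2 * s \<in> {0..1} - N" "s < 1/2" using s by auto
    from vel[OF s2(1)] have v: "2 * s \<in> {0<..<1}" "(\<xi> has_vector_derivative v (2 * s)) (at (2 * s))"
      "velocity \<xi> (2 * s) = v (2 * s)" by auto
    have "((\<xi> \<circ> (\<lambda>s. 2 * s)) has_vector_derivative 2 *\<^sub>R v (2 * s)) (at s)"
      by (rule vector_diff_chain_at) (use v(2) in \<open>auto intro!: derivative_eq_intros\<close>)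
    then have "(?\<eta> has_vector_derivative 2 *\<^sub>R v (2 * s)) (at s)"
      by (rule has_vector_derivative_transform_within_open[of _ _ _ "{..<1/2}"])
        (use s2 in \<open>auto simp: concat_segment_def\<close>)
    then have "velocity ?\<eta> s = 2 *\<^sub>R v (2 * s)" using v(1) by (intro velocity_eq) auto
    then show ?thesis using s2(2) unfolding k_def g_def
      by (simp add: v(3) support_scale concat_segment_def)
  qed
  have second: "k s \<le> 2 * t" if s: "s \<in> {1/2..1} - {1/2, 1}" for s
  proof -
    have "((\<lambda>s. y1 + (2 * s - 1) *\<^sub>R (y2 - y1)) has_vector_derivative 2 *\<^sub>R (y2 - y1)) (at s)"
      by (auto intro!: derivative_eq_intros simp: has_vector_derivative_def fun_eq_iff algebra_simps)
    then have "(?\<eta> has_vector_derivative 2 *\<^sub>R (y2 - y1)) (at s)"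
      by (rule has_vector_derivative_transform_within_open[of _ _ _ "{1/2<..}"])
        (use s in \<open>auto simp: concat_segment_def\<close>)
    then have "velocity ?\<eta> s = 2 *\<^sub>R (y2 - y1)" using s by (intro velocity_eq) auto
    then have "k s = 2 * \<sigma> (y1 + (2 * s - 1) *\<^sub>R (y2 - y1)) (y2 - y1)"
      using s unfolding k_def by (simp add: support_scale concat_segment_def)
    then show ?thesis using t[of "2 * s - 1"] s by auto
  qed
  have "((\<lambda>s. 2 * g (2 * s)) has_integral intrinsic_length F \<xi>) {0..1/2}"
  proof -
    have im: "(\<lambda>x::real. x / 2) ` {0..1} = {0..1/2}"
      using image_divide_atLeastAtMost[of 2 0 1] by simp
    show ?thesis
      using has_integral_mult_right[OF has_integral_stretch_real[OF gint, of 2], of 2] unfolding im by simp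
  qed
  from has_integral_spike[OF \<open>negligible N'\<close> _ this, of k]
  have "(k has_integral intrinsic_length F \<xi>) {0..1/2}" using first by blast
  then have "integral {0..1/2} k = intrinsic_length F \<xi>" by (rule integral_unique)
  moreover have "integral {1/2..1} k \<le> t"
  proof -
    have k2: "k integrable_on {1/2..1}" by (rule integrable_on_subinterval[OF kint]) auto
    have "((\<lambda>s. if s \<in> {1/2, 1} then 2 * t else k s) has_integral integral {1/2..1} k) {1/2..1}"
      by (rule has_integral_spike[OF _ _ integrable_integral[OF k2], of "{1/2, 1}"]) auto
    moreover have "((\<lambda>s::real. 2 * t) has_integral t) {1/2..1}"
      using has_integral_const_real[of "2 * t" "1/2" 1] by simp
    ultimately show ?thesis
    proof (rule has_integral_le)
      show "(if s \<in> {1/2, 1} then 2 * t else k s) \<le> 2 * t" if "s \<in> {1/2..1}" for s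
        using second[of s] that by auto
    qed
  qed
  moreover have "integral {0..1/2} k + integral {1/2..1} k = integral {0..1} k"
    by (rule Henstock_Kurzweil_Integration.integral_combine[OF _ _ kint]) auto
  ultimately have "integral {0..1} k \<le> intrinsic_length F \<xi> + t" by linarith
  then show ?thesis by (simp add: intrinsic_length_def[of _ ?\<eta>] k_def)
qed

lemma intrinsic_dist_extend:
  assumes t: "\<And>s. 0 \<le> s \<Longrightarrow> s \<le> 1 \<Longrightarrow> \<sigma> (y1 + s *\<^sub>R (y2 - y1)) (y2 - y1) \<le> t"
  shows "S y0 y2 \<le> S y0 y1 + t"
proof (rule field_le_epsilon)
  fix e :: real assume "e > 0"
  then have "Inf {intrinsic_length F \<xi> | \<xi>. lipschitz_curve \<xi> y0 y1} < S y0 y1 + e"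
    by (simp add: intrinsic_dist_def)
  then obtain \<xi> where \<xi>: "lipschitz_curve \<xi> y0 y1" "intrinsic_length F \<xi> < S y0 y1 + e"
    using cInf_lessD[OF lengths_nonempty] by blast
  have "S y0 y2 \<le> intrinsic_length F (concat_segment \<xi> y1 y2)"
    by (rule intrinsic_dist_le[OF lipschitz_curve_concat_segment[OF \<xi>(1)]])
  also have "\<dots> \<le> intrinsic_length F \<xi> + t" by (rule length_concat_segment_le[OF \<xi>(1) t])
  finally show "S y0 y2 \<le> S y0 y1 + t + e" using \<xi>(2) by linarith
qed

lemma intrinsic_dist_continuous: "continuous_on UNIV (S y0)"
proof (rule continuous_at_imp_continuous_on, rule ballI)
  fix y :: 'm
  obtain \<Lambda> where \<Lambda>: "\<Lambda> \<ge> 0" "\<And>z v. norm z \<le> norm y + 1 \<Longrightarrow> \<bar>\<sigma> z v\<bar> \<le> \<Lambda> * norm v"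
    by (rule support_bound[of "norm y + 1"]) blast
  let ?B = "cball (0::'m) (norm y + 1)"
  have *: "S y0 y2 - S y0 y1 \<le> \<Lambda> * dist y1 y2" if y: "y1 \<in> ?B" "y2 \<in> ?B" for y1 y2 :: 'm
  proof -
    have "S y0 y2 \<le> S y0 y1 + \<Lambda> * norm (y2 - y1)"
    proof (rule intrinsic_dist_extend)
      fix s :: real assume "0 \<le> s" "s \<le> 1"
      then have "(1 - s) *\<^sub>R y1 + s *\<^sub>R y2 \<in> ?B"
        using convexD[OF convex_cball y, of "1 - s" s] by simp
      then have "norm (y1 + s *\<^sub>R (y2 - y1)) \<le> norm y + 1" by (simp add: algebra_simps)
      from \<Lambda>(2)[OF this, of "y2 - y1"] show "\<sigma> (y1 + s *\<^sub>R (y2 - y1)) (y2 - y1) \<le> \<Lambda> * norm (y2 - y1)"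
        by (simp add: abs_le_iff)
    qed
    then show ?thesis by (simp add: dist_norm norm_minus_commute)
  qed
  have "\<Lambda>-lipschitz_on ?B (S y0)"
  proof (rule lipschitz_onI)
    fix y1 y2 :: 'm assume "y1 \<in> ?B" "y2 \<in> ?B"
    then show "dist (S y0 y1) (S y0 y2) \<le> \<Lambda> * dist y1 y2"
      using *[of y1 y2] *[of y2 y1] by (simp add: dist_real_def dist_commute abs_le_iff)
  qed (rule \<Lambda>(1))
  then have "continuous_on ?B (S y0)" by (rule lipschitz_on_continuous_on)
  moreover have "y \<in> interior ?B" by simp
  ultimately show "isCont (S y0) y" using continuous_on_interior by blast
qed

text \<open>The other half of the duality. If \<open>\<phi>\<close> touches \<open>S y0\<close> from above at \<open>y\<close>, arriving at \<open>y\<close> along short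
  segments of direction \<open>v\<close> shows that the slope of \<open>\<phi>\<close> in direction \<open>v\<close> is at most \<open>\<sigma> y v\<close>. As this
  holds for every \<open>v\<close>, the gradient lies in the closed convex set \<open>Z y\<close>.\<close>

lemma intrinsic_dist_subsolution: "viscosity_subsolution F c UNIV (S y0)"
proof (rule viscosity_subsolutionI[OF continuous_imp_usc_on_UNIV[OF intrinsic_dist_continuous]])
  fix \<phi> D\<phi> y r
  assume \<phi>: "C1_gradient_on UNIV \<phi> D\<phi>" and r: "r > (0::real)"
    and max: "\<And>z. dist z y < r \<Longrightarrow> S y0 z - \<phi> z \<le> S y0 y - \<phi> y"
  have "D\<phi> y \<bullet> v \<le> \<sigma> y v" for v
  proof (rule dense_ge)
    fix t assume "\<sigma> y v < t"
    then obtain d where d: "d > 0" "\<And>z v'. dist z y < d \<Longrightarrow> dist v' v < d \<Longrightarrow> \<sigma> z v' < t"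
      by (rule support_upper_less) blast
    show "D\<phi> y \<bullet> v \<le> t"
    proof (rule field_le_epsilon)
      fix e :: real assume "e > 0"
      define e' where "e' = e / (norm v + 1)"
      have e': "e' > 0" "e' * norm v \<le> e"
        using \<open>e > 0\<close> by (auto simp: e'_def field_simps add_pos_nonneg)
      have "(\<phi> has_derivative (\<lambda>h. h \<bullet> D\<phi> y)) (at y)"
        using \<phi> unfolding C1_gradient_on_def gderiv_def by blast
      then obtain d1 where d1: "d1 > 0" "\<And>z. norm (z - y) < d1 \<Longrightarrow>
          norm (\<phi> z - \<phi> y - (z - y) \<bullet> D\<phi> y) \<le> e' * norm (z - y)"
        using e'(1) unfolding has_derivative_at_alt by metis
      define m where "m = min (min d d1) r"
      have m: "m > 0" "m \<le> d" "m \<le> d1" "m \<le> r" using d d1 r by (auto simp: m_def)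
      define h where "h = m / (norm v + 1)"
      have h: "h > 0" "h * norm v < m"
        using m by (auto simp: h_def field_simps add_pos_nonneg)
      define x where "x = y - h *\<^sub>R v"
      have yx: "y - x = h *\<^sub>R v" "x - y = - (h *\<^sub>R v)" by (simp_all add: x_def)
      have "S y0 y \<le> S y0 x + h * t"
      proof (rule intrinsic_dist_extend)
        fix s :: real assume s: "0 \<le> s" "s \<le> 1"
        have "x + s *\<^sub>R (y - x) - y = - ((1 - s) *\<^sub>R (h *\<^sub>R v))"
          by (simp add: yx x_def algebra_simps)
        then have "dist (x + s *\<^sub>R (y - x)) y = (1 - s) * (h * norm v)"
          using s h by (simp add: dist_norm)
        also have "\<dots> \<le> 1 * (h * norm v)" using s h by (intro mult_right_mono) auto
        finally have "dist (x + s *\<^sub>R (y - x)) y < d" using h m by simp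
        then have "\<sigma> (x + s *\<^sub>R (y - x)) v < t" using d by simp
        then show "\<sigma> (x + s *\<^sub>R (y - x)) (y - x) \<le> h * t"
          using h by (simp add: yx(1) support_scale)
      qed
      moreover have dx: "norm (x - y) < m" using h by (simp add: yx)
      then have "S y0 x - \<phi> x \<le> S y0 y - \<phi> y" using m by (intro max) (simp add: dist_norm)
      moreover have "\<bar>\<phi> x - \<phi> y + h * (v \<bullet> D\<phi> y)\<bar> \<le> e' * (h * norm v)"
        using d1(2)[of x] dx m h by (simp add: yx)
      then have "h * (v \<bullet> D\<phi> y) \<le> \<phi> y - \<phi> x + e' * (h * norm v)" by linarith
      ultimately have "h * (v \<bullet> D\<phi> y) \<le> h * t + e' * (h * norm v)" by linarith
      also have "\<dots> = h * (t + e' * norm v)" by (simp add: algebra_simps)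
      also have "\<dots> \<le> h * (t + e)" using e' h by (intro mult_left_mono) auto
      finally show "D\<phi> y \<bullet> v \<le> t + e" using h by (simp add: inner_commute)
    qed
  qed
  then have "D\<phi> y \<in> Z y" by (rule mem_critical_sublevel_if_le_support)
  then show "F y (D\<phi> y) \<le> c" by (simp add: critical_sublevel_def)
qed

end

section \<open>The intrinsic distance from a point of the Aubry set\<close>

lemma continuous_imp_lsc_on_UNIV:
  assumes "continuous_on UNIV u"
  shows "lsc_on UNIV u"
  unfolding lsc_on_def
proof (intro ballI allI impI)
  fix y t assume "t < u y"
  moreover have "open {z. t < u z}" by (intro open_Collect_less continuous_on_const assms)
  ultimately show "\<forall>\<^sub>F z in at y within UNIV. t < u z"
    unfolding eventually_at_topological by (intro exI[of _ "{z. t < u z}"]) auto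
qed

context coercive_hamiltonian
begin

text \<open>If a test function touches \<open>w\<close> from below with subcritical gradient, replace \<open>w\<close> near \<open>y\<close> by a
  slightly lifted strict version of the test function.\<close>

lemma bump_subsolution:
  assumes w: "viscosity_subsolution F c UNIV w"
    and \<phi>: "C1_gradient_on UNIV \<phi> D\<phi>" and r: "r > 0" and R: "R > 0"
    and min: "\<And>z. dist z y < r \<Longrightarrow> w y - \<phi> y \<le> w z - \<phi> z"
    and strict: "F y (D\<phi> y) < c"
  obtains u \<psi> D\<psi> \<rho> \<delta> where "viscosity_subsolution F c UNIV u" "C1_gradient_on UNIV \<psi> D\<psi>"
    "\<rho> > 0" "\<delta> > 0" "\<And>z. dist z y < \<rho> \<Longrightarrow> u z = \<psi> z \<and> F z (D\<psi> z) \<le> c - \<delta>"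
    "w y < u y" "\<And>z. R \<le> dist z y \<Longrightarrow> u z = w z"
proof -
  define D\<psi> where "D\<psi> = (\<lambda>z. D\<phi> z + (2 * (- 1)) *\<^sub>R (z - y))"
  define \<delta> where "\<delta> = (c - F y (D\<phi> y)) / 2"
  have \<delta>: "\<delta> > 0" using strict by (simp add: \<delta>_def)
  have contF: "continuous_on UNIV (\<lambda>z. F z (D\<psi> z))"
    using \<phi> unfolding D\<psi>_def C1_gradient_on_def
    by (intro continuous_on_test_Hamiltonian[OF continuous] continuous_intros) auto
  have "F y (D\<psi> y) < c - \<delta>" using strict by (simp add: D\<psi>_def \<delta>_def field_simps)
  then obtain \<rho>1 where \<rho>1: "\<rho>1 > 0" "\<And>z. dist z y < \<rho>1 \<Longrightarrow> F z (D\<psi> z) < c - \<delta>"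
    by (rule usc_on_UNIV_ball[OF continuous_imp_usc_on_UNIV[OF contF]]) blast
  define m where "m = min r (min R \<rho>1)"
  have m: "m > 0" "m \<le> r" "m \<le> R" "m \<le> \<rho>1" using r R \<rho>1 by (auto simp: m_def)
  \<comment> \<open>the paraboloid drops by \<open>2 * \<epsilon>\<close> at distance \<open>m / 2\<close>, so the lifted function is below \<open>w\<close> from there on\<close>
  define \<epsilon> where "\<epsilon> = m\<^sup>2 / 8"
  have \<epsilon>: "\<epsilon> > 0" using m by (simp add: \<epsilon>_def)
  define \<psi> where "\<psi> = (\<lambda>z. \<phi> z + - 1 * (norm (z - y))\<^sup>2 + (w y - \<phi> y + \<epsilon>))"
  have \<psi>: "C1_gradient_on UNIV \<psi> D\<psi>"
  proof -
    have "C1_gradient_on UNIV \<psi> (\<lambda>z. D\<psi> z + 0)"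
      unfolding \<psi>_def D\<psi>_def
      by (rule C1_gradient_on_add[OF C1_gradient_on_add[OF \<phi> C1_gradient_on_sq_dist] C1_gradient_on_const])
    then show ?thesis by simp
  qed
  note \<psi>c = C1_gradient_continuous[OF \<psi>]
  note wc = subsolution_continuous[OF w]
  define u where "u = (\<lambda>z. if dist z y < m then max (w z) (\<psi> z) else w z)"
  have far: "u z = w z" if "m / 2 \<le> dist z y" for z
  proof (cases "dist z y < m")
    case True
    have "(m / 2)\<^sup>2 \<le> (norm (z - y))\<^sup>2"
      using that m unfolding dist_norm by (intro power_mono) auto
    then have "2 * \<epsilon> \<le> (norm (z - y))\<^sup>2" by (simp add: \<epsilon>_def power_divide)
    moreover have "w y - \<phi> y \<le> w z - \<phi> z" using min[of z] True m by simp
    ultimately have "\<psi> z < w z" using \<epsilon> by (simp add: \<psi>_def)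
    then show ?thesis by (simp add: u_def)
  qed (simp add: u_def)
  have le: "w z \<le> u z" "u z \<le> max (w z) (\<psi> z)" for z by (auto simp: u_def)
  have usc: "usc_on UNIV u"
    unfolding usc_on_UNIV_iff_open
  proof
    fix t
    have "{x. u x < t} = ({x. w x < t} \<inter> {x. \<psi> x < t}) \<union> ({x. w x < t} \<inter> {x. m / 2 < dist x y})"
      (is "?L = ?A \<union> ?B")
    proof (intro equalityI subsetI)
      fix x assume x: "x \<in> ?L"
      show "x \<in> ?A \<union> ?B"
      proof (cases "m / 2 < dist x y")
        case True
        then show ?thesis using x far[of x] by simp
      next
        case False
        then have "dist x y < m" using m by linarith
        then show ?thesis using x by (simp add: u_def)
      qed
    next
      fix x assume "x \<in> ?A \<union> ?B"
      then show "x \<in> ?L"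
      proof
        assume "x \<in> ?A"
        then have "max (w x) (\<psi> x) < t" by simp
        with le(2)[of x] have "u x < t" by (rule le_less_trans)
        then show ?thesis by simp
      next
        assume "x \<in> ?B"
        then show ?thesis using far[of x] by simp
      qed
    qed
    moreover have "open (?A \<union> ?B)"
      by (intro open_Un open_Int open_Collect_less continuous_intros wc \<psi>c)
    ultimately show "open ?L" by simp
  qed
  have sub: "viscosity_subsolution F c UNIV u"
  proof (rule viscosity_subsolution_raise[OF w usc le(1) \<psi>])
    fix z assume z: "w z < u z"
    have "dist z y < m / 2"
    proof (rule ccontr)
      assume "\<not> dist z y < m / 2"
      then show False using far[of z] z by simp
    qed
    then have zm: "dist z y < m" using m(1) by linarith
    have "u z = \<psi> z" using z zm by (simp add: u_def max_def split: if_splits)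
    moreover have "F z (D\<psi> z) \<le> c" using \<rho>1(2)[of z] zm m(4) \<delta> by simp
    moreover have "\<psi> x \<le> u x" if "dist x z < m - dist z y" for x
    proof -
      have "dist x y < m" using that dist_triangle[of x y z] by linarith
      then show ?thesis by (simp add: u_def)
    qed
    moreover have "m - dist z y > 0" using zm by simp
    ultimately show "u z = \<psi> z \<and> F z (D\<psi> z) \<le> c \<and> (\<exists>r>0. \<forall>x. dist x z < r \<longrightarrow> \<psi> x \<le> u x)" by blast
  qed
  have "\<psi> y = w y + \<epsilon>" by (simp add: \<psi>_def)
  then have wy: "w y - \<psi> y < 0" using \<epsilon> by simp
  have wusc: "usc_on UNIV (\<lambda>z. w z - \<psi> z)"
    by (rule usc_on_UNIV_diff_continuous[OF viscosity_subsolution_usc[OF w] \<psi>c])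
  obtain \<rho>2 where \<rho>2: "\<rho>2 > 0" "\<And>z. dist z y < \<rho>2 \<Longrightarrow> w z - \<psi> z < 0"
    by (rule usc_on_UNIV_ball[OF wusc, of y 0]) (use wy in auto)
  have uy: "u z = \<psi> z" if "dist z y < min \<rho>2 m" for z
    using \<rho>2(2)[of z] that by (simp add: u_def)
  show ?thesis
  proof (rule that[OF sub \<psi>])
    show "min \<rho>2 m > 0" using \<rho>2 m by simp
    show "\<delta> > 0" by (rule \<delta>)
    show "u z = \<psi> z \<and> F z (D\<psi> z) \<le> c - \<delta>" if z: "dist z y < min \<rho>2 m" for z
      using uy[OF z] \<rho>1(2)[of z] m(4) z by simp
    show "w y < u y" using uy[of y] \<rho>2(1) m(1) \<open>\<psi> y = w y + \<epsilon>\<close> \<epsilon> by simp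
    show "u z = w z" if "R \<le> dist z y" for z by (rule far) (use that m in linarith)
  qed
qed

text \<open>\<open>S y0\<close> is the largest critical subsolution vanishing at \<open>y0\<close>; a bump at \<open>y\<close> that keeps the value at
  \<open>y0\<close> would exceed it.\<close>

lemma intrinsic_dist_supersolution_off_source:
  assumes "C1_gradient_on UNIV \<phi> D\<phi>" "r > 0" "y \<noteq> y0"
    and "\<And>z. dist z y < r \<Longrightarrow> S y0 y - \<phi> y \<le> S y0 z - \<phi> z"
  shows "c \<le> F y (D\<phi> y)"
proof (rule ccontr)
  assume "\<not> c \<le> F y (D\<phi> y)"
  then have strict: "F y (D\<phi> y) < c" by simp
  have R: "dist y0 y > 0" using assms(3) by simp
  obtain u where u: "viscosity_subsolution F c UNIV u" "S y0 y < u y"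
    "\<And>z. dist y0 y \<le> dist z y \<Longrightarrow> u z = S y0 z"
    by (rule bump_subsolution[OF intrinsic_dist_subsolution assms(1,2) R _ strict])
      (rule assms(4), assumption, rule that, assumption, assumption, blast)
  have "u y - u y0 \<le> S y0 y" by (rule subsolution_increment_le_dist[OF u(1)])
  moreover have "u y0 \<le> 0" using u(3)[of y0] intrinsic_dist_self_le[of y0] by simp
  ultimately show False using u(2) by simp
qed

text \<open>Near a point where a critical subsolution is strict, the sublevels contain a ball of radius \<open>\<eta>\<close>
  around its gradient, so \<open>\<sigma> z v\<close> exceeds the slope by \<open>\<eta> * norm v\<close>. A cycle pays this excess until
  the time \<open>\<tau>\<close> at which it leaves the neighbourhood, if it does; up to then it has covered at
  least the radius of the neighbourhood or its whole length.\<close>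

lemma length_ge_near_strict_point:
  assumes u: "viscosity_subsolution F c UNIV u" and \<psi>: "C1_gradient_on UNIV \<psi> D\<psi>"
    and \<rho>: "\<rho> > 0" and eq: "\<And>z. dist z y0 < \<rho> \<Longrightarrow> u z = \<psi> z" and strict: "F y0 (D\<psi> y0) < c"
  obtains \<eta> \<rho>' where "\<eta> > 0" "\<rho>' > 0"
    "\<And>\<xi>. lipschitz_curve \<xi> y0 y0 \<Longrightarrow> \<eta> * min \<rho>' (euclidean_length \<xi>) \<le> intrinsic_length F \<xi>"
proof -
  have D\<psi>c: "continuous_on UNIV D\<psi>" using \<psi> by (simp add: C1_gradient_on_def)
  have "continuous_on UNIV (\<lambda>p::'m \<times> 'm. (fst p, D\<psi> (fst p) + snd p))"
    by (intro continuous_intros continuous_on_compose2[OF D\<psi>c]) auto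
  from continuous_on_compose2[OF continuous this]
  have "continuous_on UNIV (\<lambda>p. F (fst p) (D\<psi> (fst p) + snd p))" by simp
  then have "open {p. F (fst p) (D\<psi> (fst p) + snd p) < c}" by (intro open_Collect_less continuous_on_const)
  moreover have "(y0, 0) \<in> {p. F (fst p) (D\<psi> (fst p) + snd p) < c}" using strict by simp
  ultimately obtain A B where AB: "open A" "open B" "(y0, 0) \<in> A \<times> B"
    "A \<times> B \<subseteq> {p. F (fst p) (D\<psi> (fst p) + snd p) < c}"
    by (rule open_prod_elim) blast
  obtain d1 where d1: "d1 > 0" "ball y0 d1 \<subseteq> A" using AB(1,3) by (metis mem_Sigma_iff open_contains_ball)
  obtain d2 where d2: "d2 > 0" "ball 0 d2 \<subseteq> B" using AB(2,3) by (metis mem_Sigma_iff open_contains_ball)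
  define \<rho>' where "\<rho>' = min \<rho> d1"
  define \<eta> where "\<eta> = d2 / 2"
  have \<rho>': "\<rho>' > 0" "\<rho>' \<le> \<rho>" "\<rho>' \<le> d1" using \<rho> d1 by (auto simp: \<rho>'_def)
  have \<eta>: "\<eta> > 0" "\<eta> < d2" using d2 by (auto simp: \<eta>_def)
  have supp: "D\<psi> z \<bullet> v + \<eta> * norm v \<le> \<sigma> z v" if z: "dist z y0 < \<rho>'" for z v
  proof (cases "v = 0")
    case False
    define e where "e = (\<eta> / norm v) *\<^sub>R v"
    have "norm e = \<eta>" using False \<eta> by (simp add: e_def)
    then have "e \<in> ball 0 d2" using \<eta> by simp
    moreover have "z \<in> ball y0 d1" using z \<rho>' by (simp add: dist_commute)
    ultimately have "(z, e) \<in> A \<times> B" using d1 d2 by blast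
    then have "F z (D\<psi> z + e) < c" using AB(4) by auto
    then have "(D\<psi> z + e) \<bullet> v \<le> \<sigma> z v" by (intro inner_le_support) (simp add: critical_sublevel_def)
    moreover have "e \<bullet> v = \<eta> * norm v"
      using False by (simp add: e_def power2_norm_eq_inner[symmetric] power2_eq_square)
    ultimately show ?thesis by (simp add: inner_add_left)
  qed (simp add: support_zero)
  show ?thesis
  proof (rule that[OF \<eta>(1) \<rho>'(1)])
    fix \<xi> assume \<xi>: "lipschitz_curve \<xi> y0 y0"
    obtain L where lip: "L-lipschitz_on {0..1} \<xi>" and ends: "\<xi> 0 = y0" "\<xi> 1 = y0"
      using \<xi> unfolding lipschitz_curve_def by blast
    have \<xi>c: "continuous_on {0..1} \<xi>" by (rule lipschitz_on_continuous_on[OF lip])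
    obtain v N B where N: "negligible N"
      and vel: "\<And>s. s \<in> {0..1} - N \<Longrightarrow> s \<in> {0<..<1} \<and> (\<xi> has_vector_derivative v s) (at s) \<and> velocity \<xi> s = v s"
      and vint: "\<And>c d. 0 \<le> c \<Longrightarrow> c \<le> d \<Longrightarrow> d \<le> 1 \<Longrightarrow> (v has_integral (\<xi> d - \<xi> c)) {c..d}"
      by (rule lipschitz_curve_velocity[OF \<xi>]) (rule that; assumption)
    obtain \<tau> where \<tau>: "0 \<le> \<tau>" "\<tau> \<le> 1" "\<And>s. 0 \<le> s \<Longrightarrow> s < \<tau> \<Longrightarrow> dist (\<xi> s) y0 < \<rho>'"
      "\<tau> = 1 \<or> \<rho>' \<le> dist (\<xi> \<tau>) y0"
    proof (cases "\<forall>s\<in>{0..1}. dist (\<xi> s) y0 < \<rho>'")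
      case True
      then show ?thesis using that[of 1] by simp
    next
      case False
      define E where "E = {s \<in> {0..1}. \<rho>' \<le> dist (\<xi> s) y0}"
      have "closedin (top_of_set {0..1}) E"
        unfolding E_def
        by (intro continuous_closedin_preimage_constant continuous_on_dist \<xi>c continuous_on_const
            continuous_closedin_preimage[of _ _ "{\<rho>'..}", unfolded vimage_def Int_def, simplified])
      then have "compact E" using closedin_compact compact_Icc by blast
      moreover have "E \<noteq> {}" using False by (force simp: E_def)
      ultimately obtain \<tau> where \<tau>: "\<tau> \<in> E" "\<And>s. s \<in> E \<Longrightarrow> \<tau> \<le> s" by (metis compact_attains_inf)
      show ?thesis
      proof (rule that[of \<tau>])
        show "0 \<le> \<tau>" "\<tau> \<le> 1" "\<tau> = 1 \<or> \<rho>' \<le> dist (\<xi> \<tau>) y0" using \<tau>(1) by (auto simp: E_def)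
        show "dist (\<xi> s) y0 < \<rho>'" if "0 \<le> s" "s < \<tau>" for s
        proof (rule ccontr)
          assume "\<not> dist (\<xi> s) y0 < \<rho>'"
          then have "s \<in> E" using that \<open>\<tau> \<le> 1\<close> by (simp add: E_def)
          then show False using \<tau>(2) that(2) by force
        qed
      qed
    qed
    let ?sp = "\<lambda>s. norm (velocity \<xi> s)"
    have sp: "?sp integrable_on {0..\<tau>}"
      by (rule integrable_on_subinterval[OF speed_integrable[OF \<xi>]]) (use \<tau> in auto)
    have "((\<lambda>s. if s \<in> {0..\<tau>} then ?sp s else 0) has_integral integral {0..\<tau>} ?sp) {0..1}"
      by (subst has_integral_restrict) (use \<tau> sp in \<open>auto intro: integrable_integral\<close>)
    from has_integral_diff[OF integrable_integral[OF intrinsic_integrable[OF \<xi>]] has_integral_mult_right[OF this, of \<eta>]]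
    have k: "((\<lambda>s. \<sigma> (\<xi> s) (velocity \<xi> s) - \<eta> * (if s \<in> {0..\<tau>} then ?sp s else 0))
        has_integral intrinsic_length F \<xi> - \<eta> * integral {0..\<tau>} ?sp) {0..1}"
      by (simp add: intrinsic_length_def)
    obtain K where K: "K-lipschitz_on {0..1} (\<lambda>s. u (\<xi> s))"
      by (rule subsolution_along_curve_lipschitz[OF u \<xi>])
    have N': "negligible (insert \<tau> N)" using N by simp
    have "u (\<xi> 1) - u (\<xi> 0) \<le> integral {0..1} (\<lambda>s. \<sigma> (\<xi> s) (velocity \<xi> s) - \<eta> * (if s \<in> {0..\<tau>} then ?sp s else 0))"
    proof (rule lipschitz_increment_le_integral[OF K zero_le_one has_integral_integrable[OF k] N'])
      fix s D assume s: "s \<in> {0<..<1} - insert \<tau> N" and D: "((\<lambda>s. u (\<xi> s)) has_real_derivative D) (at s)"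
      from s have "s \<in> {0..1} - N" by auto
      from vel[OF this] have v: "(\<xi> has_vector_derivative v s) (at s)" "velocity \<xi> s = v s" by auto
      show "D \<le> \<sigma> (\<xi> s) (velocity \<xi> s) - \<eta> * (if s \<in> {0..\<tau>} then ?sp s else 0)"
      proof (cases "s < \<tau>")
        case True
        have near: "dist (\<xi> s) y0 < \<rho>'" using \<tau>(3) True s by simp
        have "(\<psi> has_derivative (\<lambda>h. h \<bullet> D\<psi> (\<xi> s))) (at (\<xi> s))"
          using \<psi> unfolding C1_gradient_on_def gderiv_def by blast
        from diff_chain_at[OF v(1)[unfolded has_vector_derivative_def] this]
        have chain: "((\<lambda>s. \<psi> (\<xi> s)) has_real_derivative v s \<bullet> D\<psi> (\<xi> s)) (at s)"
          by (simp add: has_field_derivative_def o_def mult.commute[of _ "v s \<bullet> D\<psi> (\<xi> s)"])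
        have loc: "\<psi> (\<xi> x) = u (\<xi> x)" if "x \<in> {0<..<\<tau>}" for x
          using \<tau>(3)[of x] that \<rho>'(2) eq[of "\<xi> x"] by simp
        have "((\<lambda>s. u (\<xi> s)) has_real_derivative v s \<bullet> D\<psi> (\<xi> s)) (at s)"
          by (rule has_field_derivative_transform_within_open[OF chain open_greaterThanLessThan _ loc])
            (use True s in auto)
        from DERIV_unique[OF D this] have "D = v s \<bullet> D\<psi> (\<xi> s)" .
        then show ?thesis using supp[OF near, of "v s"] True s by (simp add: v(2) inner_commute)
      next
        case False
        then show ?thesis
          using derivative_along_curve_le_support[OF u v(1) D] s by (simp add: v(2))
      qed
    qed
    then have main: "\<eta> * integral {0..\<tau>} ?sp \<le> intrinsic_length F \<xi>"
      using integral_unique[OF k] by (simp add: ends)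
    have "min \<rho>' (euclidean_length \<xi>) \<le> integral {0..\<tau>} ?sp"
      using \<tau>(4)
    proof
      assume "\<tau> = 1"
      then show ?thesis by (simp add: euclidean_length_def)
    next
      assume far: "\<rho>' \<le> dist (\<xi> \<tau>) y0"
      have "(v has_integral (\<xi> \<tau> - \<xi> 0)) {0..\<tau>}" using vint \<tau> by simp
      then have vel_int: "(velocity \<xi> has_integral (\<xi> \<tau> - \<xi> 0)) {0..\<tau>}"
        by (rule has_integral_spike[OF N, rotated]) (use vel \<tau> in auto)
      have "norm (integral {0..\<tau>} (velocity \<xi>)) \<le> integral {0..\<tau>} ?sp"
        by (rule integral_norm_bound_integral[OF has_integral_integrable[OF vel_int] sp order_refl])
      then have "norm (\<xi> \<tau> - \<xi> 0) \<le> integral {0..\<tau>} ?sp" unfolding integral_unique[OF vel_int] .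
      then show ?thesis using far by (simp add: ends dist_norm)
    qed
    then have "\<eta> * min \<rho>' (euclidean_length \<xi>) \<le> \<eta> * integral {0..\<tau>} ?sp" using \<eta> by (intro mult_left_mono) auto
    then show "\<eta> * min \<rho>' (euclidean_length \<xi>) \<le> intrinsic_length F \<xi>" using main by linarith
  qed
qed

text \<open>A bump at \<open>y0\<close> itself is a critical subsolution that is strict near \<open>y0\<close>. This contradicts
  \<open>aubry_no_strict\<close> directly, and \<open>aubry_cycles\<close> because the lengths of cycles would be
  bounded away from zero.\<close>

lemma intrinsic_dist_supersolution_at_aubry_source:
  assumes aubry: "aubry_cycles F y0 \<or> aubry_no_strict F y0"
    and \<phi>: "C1_gradient_on UNIV \<phi> D\<phi>" and r: "r > 0"
    and min: "\<And>z. dist z y0 < r \<Longrightarrow> S y0 y0 - \<phi> y0 \<le> S y0 z - \<phi> z"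
  shows "c \<le> F y0 (D\<phi> y0)"
proof (rule ccontr)
  assume "\<not> c \<le> F y0 (D\<phi> y0)"
  then have strict: "F y0 (D\<phi> y0) < c" by simp
  obtain u \<psi> D\<psi> \<rho> \<delta> where u: "viscosity_subsolution F c UNIV u" and \<psi>: "C1_gradient_on UNIV \<psi> D\<psi>"
    and \<rho>: "\<rho> > 0" and \<delta>: "\<delta> > 0"
    and near: "\<And>z. dist z y0 < \<rho> \<Longrightarrow> u z = \<psi> z \<and> F z (D\<psi> z) \<le> c - \<delta>"
  proof (rule bump_subsolution[OF intrinsic_dist_subsolution \<phi> r zero_less_one _ strict])
    show "S y0 y0 - \<phi> y0 \<le> S y0 z - \<phi> z" if "dist z y0 < r" for z by (rule min[OF that])
  next
    fix u \<psi> D\<psi> \<rho> \<delta>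
    assume "viscosity_subsolution F c UNIV u" "C1_gradient_on UNIV \<psi> D\<psi>" "\<rho> > 0" "\<delta> > 0"
      "\<And>z. dist z y0 < \<rho> \<Longrightarrow> u z = \<psi> z \<and> F z (D\<psi> z) \<le> c - \<delta>"
    then show thesis by (rule that)
  qed
  from aubry show False
  proof
    assume cyc: "aubry_cycles F y0"
    have "F y0 (D\<psi> y0) < c" using near[of y0] \<rho> \<delta> by simp
    have eq: "u z = \<psi> z" if "dist z y0 < \<rho>" for z using near[OF that] by blast
    obtain \<eta> \<rho>' where \<eta>: "\<eta> > 0" and \<rho>': "\<rho>' > 0"
      and len: "\<And>\<xi>. lipschitz_curve \<xi> y0 y0 \<Longrightarrow> \<eta> * min \<rho>' (euclidean_length \<xi>) \<le> intrinsic_length F \<xi>"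
      by (rule length_ge_near_strict_point[OF u \<psi> \<rho> _ \<open>F y0 (D\<psi> y0) < c\<close>])
        (rule eq, assumption, rule that)
    obtain \<xi> :: "nat \<Rightarrow> real \<Rightarrow> 'm" where \<xi>: "\<And>n. lipschitz_curve (\<xi> n) y0 y0"
      and INF0: "(INF n. intrinsic_length F (\<xi> n)) = 0" and pos: "(INF n. euclidean_length (\<xi> n)) > 0"
      using cyc unfolding aubry_cycles_def by blast
    have nonneg: "0 \<le> euclidean_length (\<xi> n)" for n
      unfolding euclidean_length_def by (rule integral_nonneg[OF speed_integrable[OF \<xi>]]) simp
    define \<epsilon> where "\<epsilon> = (INF n. euclidean_length (\<xi> n))"
    have \<epsilon>: "\<epsilon> \<le> euclidean_length (\<xi> n)" for n
      unfolding \<epsilon>_def by (rule cINF_lower[OF bdd_belowI2[of _ 0]]) (use nonneg in auto)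
    have "\<eta> * min \<rho>' \<epsilon> \<le> (INF n. intrinsic_length F (\<xi> n))"
    proof (rule cINF_greatest)
      fix n
      have "\<eta> * min \<rho>' \<epsilon> \<le> \<eta> * min \<rho>' (euclidean_length (\<xi> n))"
        using \<eta> \<epsilon>[of n] by (intro mult_left_mono) auto
      then show "\<eta> * min \<rho>' \<epsilon> \<le> intrinsic_length F (\<xi> n)" using len[OF \<xi>[of n]] by linarith
    qed simp
    moreover have "\<eta> * min \<rho>' \<epsilon> > 0" using \<eta> \<rho>' pos by (simp add: \<epsilon>_def)
    ultimately show False using INF0 by simp
  next
    assume no: "aubry_no_strict F y0"
    have "viscosity_subsolution F (c - \<delta>) (ball y0 \<rho>) u"
      by (rule viscosity_subsolution_C1[OF open_ball \<psi>]) (use near in \<open>auto simp: dist_commute\<close>)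
    then show False using no u \<delta> \<rho> unfolding aubry_no_strict_def by (metis centre_in_ball open_ball)
  qed
qed

theorem intrinsic_dist_solution:
  assumes "y0 \<in> aubry_set F"
  shows "viscosity_solution F c UNIV (S y0)"
proof (cases "aubry_solution F y0")
  case True
  then show ?thesis by (simp add: aubry_solution_def)
next
  case False
  with assms have aubry: "aubry_cycles F y0 \<or> aubry_no_strict F y0" by (simp add: aubry_set_def)
  have "viscosity_supersolution F c UNIV (S y0)"
    unfolding viscosity_supersolution_def
  proof (intro conjI allI impI)
    show "lsc_on UNIV (S y0)" by (rule continuous_imp_lsc_on_UNIV[OF intrinsic_dist_continuous])
    fix \<phi> D\<phi> y
    assume touch: "C1_gradient_on UNIV \<phi> D\<phi> \<and> y \<in> UNIV \<and>
      (\<forall>\<^sub>F z in at y within UNIV. S y0 y - \<phi> y \<le> S y0 z - \<phi> z)"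
    then have \<phi>: "C1_gradient_on UNIV \<phi> D\<phi>" by blast
    from touch obtain r where r: "r > 0" "\<And>z. z \<noteq> y \<Longrightarrow> dist z y < r \<Longrightarrow> S y0 y - \<phi> y \<le> S y0 z - \<phi> z"
      unfolding eventually_at by blast
    then have min: "S y0 y - \<phi> y \<le> S y0 z - \<phi> z" if "dist z y < r" for z
      using that by (cases "z = y") auto
    show "c \<le> F y (D\<phi> y)"
    proof (cases "y = y0")
      case True
      show ?thesis
        using intrinsic_dist_supersolution_at_aubry_source[OF aubry \<phi> r(1)] min True by blast
    next
      case False
      show ?thesis by (rule intrinsic_dist_supersolution_off_source[OF \<phi> r(1) False]) (rule min)
    qed
  qed
  then show ?thesis using intrinsic_dist_subsolution by (simp add: viscosity_solution_def)
qed

text \<open>Far away \<open>F y 0\<close> is below the critical value by a margin, and since the Hamiltonian grows at most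
  like \<open>(1 + norm y) * norm q\<close>, a small multiple of \<open>ln (1 + (norm y)\<^sup>2)\<close> is a subsolution there.
  Taking its maximum with a critical subsolution, after lowering it below the latter on a large
  ball, gives a critical subsolution on the whole space.\<close>

lemma coercive_critical_subsolution:
  obtains u \<kappa> K where "viscosity_subsolution F c UNIV u" "\<kappa> > 0" "\<And>y. \<kappa> * ln (1 + (norm y)\<^sup>2) - K \<le> u y"
proof -
  obtain w where w: "viscosity_subsolution F c UNIV w" by (rule critical_subsolution_exists) blast
  note wc = subsolution_continuous[OF w]
  obtain R where R: "\<And>y. norm y \<ge> R \<Longrightarrow> F y 0 \<le> c - 1"
    using at_zero unfolding filterlim_at_bot eventually_at_infinity by blast
  obtain C where C: "\<And>y q. F y q \<le> F y 0 + C * (1 + norm y) * norm q" using linear_growth by blast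
  \<comment> \<open>the growth term at the gradient of \<open>\<psi>\<close> is at most \<open>4 * \<kappa> * (\<bar>C\<bar> + 1)\<close>, which must not exceed the margin \<open>1\<close>\<close>
  define \<kappa> where "\<kappa> = 1 / (4 * (\<bar>C\<bar> + 1))"
  have \<kappa>: "\<kappa> > 0" by (simp add: \<kappa>_def add_nonneg_pos)
  let ?l = "\<lambda>y::'m. \<kappa> * ln (1 + (norm y)\<^sup>2)"
  have pos: "1 + (norm y)\<^sup>2 > 0" for y :: 'm by (simp add: add_pos_nonneg)
  have lc: "continuous_on UNIV ?l"
    by (intro continuous_intros) (metis pos less_irrefl)
  have "compact ((\<lambda>y. ?l y - w y) ` cball 0 R)"
    by (intro compact_continuous_image compact_cball continuous_on_subset[OF continuous_on_diff[OF lc wc]]) auto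
  then have "bdd_above ((\<lambda>y. ?l y - w y) ` cball 0 R)"
    by (intro bounded_imp_bdd_above compact_imp_bounded)
  then obtain K0 where K0: "\<And>y. y \<in> cball 0 R \<Longrightarrow> ?l y - w y \<le> K0"
    unfolding bdd_above_def by blast
  define \<psi> where "\<psi> = (\<lambda>y. ?l y - K0)"
  define D\<psi> where "D\<psi> = (\<lambda>y::'m. (2 * \<kappa> / (1 + (norm y)\<^sup>2)) *\<^sub>R y)"
  have \<psi>: "C1_gradient_on UNIV \<psi> D\<psi>"
    unfolding C1_gradient_on_def
  proof (intro conjI ballI)
    show "continuous_on UNIV D\<psi>" unfolding D\<psi>_def
      by (intro continuous_intros) (metis pos less_irrefl)
    fix y :: 'm
    have "1 + y \<bullet> y > 0" using pos[of y] by (simp add: power2_norm_eq_inner)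
    then show "GDERIV \<psi> y :> D\<psi> y"
      unfolding gderiv_def \<psi>_def D\<psi>_def power2_norm_eq_inner
      by (auto intro!: derivative_eq_intros simp: fun_eq_iff inner_commute field_simps)
  qed
  have F\<psi>: "F y (D\<psi> y) \<le> c" if y: "R \<le> norm y" for y :: 'm
  proof -
    have "(1 + norm y) * norm (D\<psi> y) = 2 * \<kappa> * ((norm y + (norm y)\<^sup>2) / (1 + (norm y)\<^sup>2))"
      using \<kappa> pos[of y] by (simp add: D\<psi>_def field_simps power2_eq_square)
    also have "\<dots> \<le> 2 * \<kappa> * 2"
    proof (intro mult_left_mono)
      have "0 \<le> (norm y - 1/2)\<^sup>2" by simp
      then have "norm y \<le> 1 + (norm y)\<^sup>2" by (simp add: power2_eq_square algebra_simps)
      then have "norm y + (norm y)\<^sup>2 \<le> 2 * (1 + (norm y)\<^sup>2)" by simp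
      then show "(norm y + (norm y)\<^sup>2) / (1 + (norm y)\<^sup>2) \<le> 2" using pos[of y] by (simp add: divide_le_eq)
    qed (use \<kappa> in simp)
    finally have b: "(1 + norm y) * norm (D\<psi> y) \<le> 4 * \<kappa>" by simp
    have "C * (1 + norm y) * norm (D\<psi> y) \<le> (\<bar>C\<bar> + 1) * ((1 + norm y) * norm (D\<psi> y))"
      unfolding mult.assoc by (intro mult_right_mono mult_nonneg_nonneg) auto
    also have "\<dots> \<le> (\<bar>C\<bar> + 1) * (4 * \<kappa>)" using b by (intro mult_left_mono) auto
    also have "\<dots> = 1" by (simp add: \<kappa>_def field_simps)
    finally show ?thesis using C[of y "D\<psi> y"] R[OF y] by linarith
  qed
  define u where "u = (\<lambda>y. max (w y) (\<psi> y))"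
  have "viscosity_subsolution F c UNIV u"
  proof (rule viscosity_subsolution_raise[OF w _ _ \<psi>])
    show "usc_on UNIV u" unfolding u_def
      by (intro continuous_imp_usc_on_UNIV continuous_on_max wc C1_gradient_continuous[OF \<psi>])
    show "w z \<le> u z" for z by (simp add: u_def)
    fix z assume z: "w z < u z"
    then have "u z = \<psi> z" "w z < \<psi> z" by (auto simp: u_def max_def split: if_splits)
    moreover have "R \<le> norm z"
    proof (rule ccontr)
      assume "\<not> R \<le> norm z"
      then have "?l z - w z \<le> K0" by (intro K0) simp
      with \<open>w z < \<psi> z\<close> show False by (simp add: \<psi>_def)
    qed
    ultimately show "u z = \<psi> z \<and> F z (D\<psi> z) \<le> c \<and> (\<exists>r>0. \<forall>x. dist x z < r \<longrightarrow> \<psi> x \<le> u x)"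
      using F\<psi> by (auto simp: u_def intro: exI[of _ 1])
  qed
  then show ?thesis by (rule that[OF _ \<kappa>, of u K0]) (simp add: u_def \<psi>_def)
qed

theorem intrinsic_dist_coercive: "filterlim (S y0) at_top at_infinity"
proof -
  obtain u \<kappa> K where u: "viscosity_subsolution F c UNIV u" and \<kappa>: "\<kappa> > 0"
    and lower: "\<And>y. \<kappa> * ln (1 + (norm y)\<^sup>2) - K \<le> u y"
    by (rule coercive_critical_subsolution) blast
  show ?thesis
    unfolding filterlim_at_top eventually_at_infinity
  proof
    fix T
    define b where "b = exp ((T + K + u y0) / \<kappa>)"
    have "T \<le> S y0 y" if y: "b \<le> norm y" for y :: 'm
    proof -
      have b0: "0 < b" by (simp add: b_def)
      have "0 \<le> (norm y - 1/2)\<^sup>2" by simp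
      then have "norm y \<le> 1 + (norm y)\<^sup>2" by (simp add: power2_eq_square algebra_simps)
      then have "ln b \<le> ln (1 + (norm y)\<^sup>2)" using y b0 by (simp add: ln_le_cancel_iff)
      then have "(T + K + u y0) / \<kappa> \<le> ln (1 + (norm y)\<^sup>2)" by (simp add: b_def)
      then have "T + K + u y0 \<le> \<kappa> * ln (1 + (norm y)\<^sup>2)"
        using \<kappa> by (simp add: pos_divide_le_eq mult.commute)
      then show ?thesis using lower[of y] subsolution_increment_le_dist[OF u, of y y0] by linarith
    qed
    then show "\<exists>b. \<forall>y. b \<le> norm y \<longrightarrow> T \<le> S y0 y" by blast
  qed
qed

end

section \<open>The Hamiltonian of the control problem\<close>

lemma continuous_on_SUP_compact:
  fixes h :: "'p::euclidean_space \<Rightarrow> 'a::metric_space \<Rightarrow> real"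
  assumes A: "compact A" "A \<noteq> {}" and h: "continuous_on (UNIV \<times> A) (\<lambda>(p, a). h p a)"
  shows "continuous_on UNIV (\<lambda>p. SUP a\<in>A. h p a)"
proof (rule continuous_at_imp_continuous_on, rule ballI)
  fix p :: 'p
  let ?H = "\<lambda>p. SUP a\<in>A. h p a"
  have bdd: "bdd_above (h p' ` A)" for p'
  proof -
    have "continuous_on A (\<lambda>a. (p', a))" by (intro continuous_intros)
    from continuous_on_compose2[OF h this] have "continuous_on A (h p')" by auto
    then show ?thesis
      by (intro bounded_imp_bdd_above compact_imp_bounded compact_continuous_image A(1))
  qed
  have "uniformly_continuous_on (cball p 1 \<times> A) (\<lambda>(p, a). h p a)"
    by (intro compact_uniformly_continuous continuous_on_subset[OF h] compact_Times compact_cball A(1)) auto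
  then have uc: "\<exists>d>0. \<forall>x\<in>cball p 1 \<times> A. \<forall>x'\<in>cball p 1 \<times> A. dist x' x < d \<longrightarrow>
      dist ((\<lambda>(p, a). h p a) x') ((\<lambda>(p, a). h p a) x) < e" if "e > 0" for e
    using that unfolding uniformly_continuous_on_def by blast
  show "isCont ?H p"
    unfolding continuous_at_eps_delta
  proof (intro allI impI)
    fix e :: real assume e: "e > 0"
    obtain d where d: "d > 0" "\<And>x x'. x \<in> cball p 1 \<times> A \<Longrightarrow> x' \<in> cball p 1 \<times> A \<Longrightarrow> dist x' x < d \<Longrightarrow>
      dist ((\<lambda>(p, a). h p a) x') ((\<lambda>(p, a). h p a) x) < e / 2"
      using uc[of "e / 2"] e by auto
    show "\<exists>d>0. \<forall>p'. dist p' p < d \<longrightarrow> dist (?H p') (?H p) < e"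
    proof (intro exI[of _ "min d 1"] conjI allI impI)
      fix p' assume p': "dist p' p < min d 1"
      have close: "\<bar>h p' a - h p a\<bar> < e / 2" if "a \<in> A" for a
        using d(2)[of "(p, a)" "(p', a)"] that p' by (simp add: dist_Pair_Pair dist_commute dist_real_def)
      have "?H p' \<le> ?H p + e / 2"
      proof (rule cSUP_least[OF A(2)])
        fix a assume a: "a \<in> A"
        show "h p' a \<le> ?H p + e / 2" using close[OF a] cSUP_upper[OF a bdd[of p]] by linarith
      qed
      moreover have "?H p \<le> ?H p' + e / 2"
      proof (rule cSUP_least[OF A(2)])
        fix a assume a: "a \<in> A"
        show "h p a \<le> ?H p' + e / 2" using close[OF a] cSUP_upper[OF a bdd[of p']] by linarith
      qed
      ultimately show "dist (?H p') (?H p) < e" using e unfolding dist_real_def by linarith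
    qed (use d in simp)
  qed
qed

text \<open>Otherwise \<open>G\<close>, hence its closed convex hull, lies in a half-space which misses a point of the ball
  opposite to \<open>q\<close>.\<close>

lemma ball_hull_direction:
  fixes G :: "'m::euclidean_space set"
  assumes r: "r > 0" and hull: "ball 0 r \<subseteq> closure (convex hull G)"
    and ne: "G \<noteq> {}"
  shows "\<exists>p\<in>G. r / 2 * norm q \<le> - (q \<bullet> p)"
proof (rule ccontr)
  assume "\<not> ?thesis"
  then have *: "- (q \<bullet> p) < r / 2 * norm q" if "p \<in> G" for p using that by force
  then have q: "q \<noteq> 0" using ne by force
  let ?T = "{p. - (r / 2 * norm q) \<le> q \<bullet> p}"
  have "G \<subseteq> ?T" using * by force
  then have "closure (convex hull G) \<subseteq> ?T"
    by (intro closure_minimal hull_minimal convex_halfspace_ge closed_halfspace_ge)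
  moreover have "- (3 * r / (4 * norm q)) *\<^sub>R q \<in> ball 0 r" using r q by simp
  ultimately have "- (r / 2 * norm q) \<le> q \<bullet> (- (3 * r / (4 * norm q)) *\<^sub>R q)" using hull by blast
  also have "\<dots> = - (3 / 4 * (r * norm q))"
    using q by (simp add: power2_norm_eq_inner[symmetric] power2_eq_square)
  finally have "r * norm q \<le> 0" by simp
  then show False using r q by (simp add: mult_le_0_iff)
qed

text \<open>Coercivity in \<open>q\<close> comes from the velocities \<open>g x0 y a\<close> surrounding the origin, the behaviour at
  infinity from the coercivity of the running cost and the bound on \<open>f\<close>, and the linear growth from the
  Lipschitz continuity of \<open>g\<close>.\<close>

lemma hamiltonian_coercive:
  fixes f :: "'n::euclidean_space \<Rightarrow> 'm::euclidean_space \<Rightarrow> 'a::euclidean_space \<Rightarrow> 'n"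
    and g :: "'n \<Rightarrow> 'm \<Rightarrow> 'a \<Rightarrow> 'm" and l :: "'n \<Rightarrow> 'm \<Rightarrow> 'a \<Rightarrow> real" and A :: "'a set"
  assumes A: "compact A"
    and f: "continuous_on (UNIV \<times> UNIV \<times> A) (\<lambda>(x, y, a). f x y a)"
    and g: "continuous_on (UNIV \<times> UNIV \<times> A) (\<lambda>(x, y, a). g x y a)"
    and l: "continuous_on (UNIV \<times> UNIV \<times> A) (\<lambda>(x, y, a). l x y a)"
    and L0: "L0 > 0"
    and lip: "\<And>x1 y1 x2 y2 a. a \<in> A \<Longrightarrow>
           norm (g x1 y1 a - g x2 y2 a) \<le> L0 * (norm (x1 - x2) + norm (y1 - y2))"
    and Q0: "\<And>x y a. a \<in> A \<Longrightarrow> norm (f x y a) \<le> Q0"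
    and hull: "\<And>K. compact K \<Longrightarrow>
           \<exists>r>0. \<forall>(x, y)\<in>K. ball 0 r \<subseteq> closure (convex hull (g x y ` A))"
    and linf: "\<And>B. compact B \<Longrightarrow> B \<noteq> {} \<Longrightarrow>
           filterlim (\<lambda>y. INF (x, a)\<in>B \<times> A. l x y a) at_top at_infinity"
  shows "coercive_hamiltonian (\<lambda>y q. hamiltonian f g l A x0 y p0 q)"
proof -
  define h where "h = (\<lambda>(y, q) a. - (p0 \<bullet> f x0 y a) - q \<bullet> g x0 y a - l x0 y a)"
  have H: "hamiltonian f g l A x0 y p0 q = (SUP a\<in>A. h (y, q) a)" for y q
    by (simp add: hamiltonian_def h_def)
  have ne: "A \<noteq> {}"
  proof
    assume "A = {}"
    moreover obtain r :: real where "r > 0" "ball 0 r \<subseteq> closure (convex hull (g x0 0 ` A))"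
      using hull[of "{(x0, 0)}"] by auto
    ultimately show False by simp
  qed
  have emb: "continuous_on (UNIV \<times> A) (\<lambda>z::'m \<times> 'a. (x0, fst z, snd z))"
    by (intro continuous_intros)
  have im: "(\<lambda>z::'m \<times> 'a. (x0, fst z, snd z)) ` (UNIV \<times> A) \<subseteq> UNIV \<times> UNIV \<times> A" by auto
  have f': "continuous_on (UNIV \<times> A) (\<lambda>(y, a). f x0 y a)"
    using continuous_on_compose2[OF f emb im] by (simp add: case_prod_unfold)
  have g': "continuous_on (UNIV \<times> A) (\<lambda>(y, a). g x0 y a)"
    using continuous_on_compose2[OF g emb im] by (simp add: case_prod_unfold)
  have l': "continuous_on (UNIV \<times> A) (\<lambda>(y, a). l x0 y a)"
    using continuous_on_compose2[OF l emb im] by (simp add: case_prod_unfold)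
  have hc: "continuous_on (UNIV \<times> A) (\<lambda>(p, a). h p a)"
  proof -
    have fst': "continuous_on (UNIV \<times> A) (\<lambda>z::('m \<times> 'm) \<times> 'a. (fst (fst z), snd z))"
      by (intro continuous_intros)
    have im: "(\<lambda>z::('m \<times> 'm) \<times> 'a. (fst (fst z), snd z)) ` (UNIV \<times> A) \<subseteq> UNIV \<times> A" by auto
    note comp = continuous_on_compose2[OF _ fst' im]
    have "continuous_on (UNIV \<times> A) (\<lambda>z::('m \<times> 'm) \<times> 'a. - (p0 \<bullet> f x0 (fst (fst z)) (snd z))
        - snd (fst z) \<bullet> g x0 (fst (fst z)) (snd z) - l x0 (fst (fst z)) (snd z))"
      using comp[OF f'] comp[OF g'] comp[OF l'] by (intro continuous_intros) simp_all
    then show ?thesis by (simp add: h_def case_prod_unfold)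
  qed
  have bdd: "bdd_above (h p ` A)" for p
  proof -
    have "continuous_on A (\<lambda>a. (p, a))" by (intro continuous_intros)
    from continuous_on_compose2[OF hc this] have "continuous_on A (h p)" by auto
    then show ?thesis
      by (intro bounded_imp_bdd_above compact_imp_bounded compact_continuous_image A)
  qed
  have up: "h (y, q) a \<le> hamiltonian f g l A x0 y p0 q" if "a \<in> A" for y q a
    unfolding H by (rule cSUP_upper[OF that bdd])
  have least: "hamiltonian f g l A x0 y p0 q \<le> b" if "\<And>a. a \<in> A \<Longrightarrow> h (y, q) a \<le> b" for y q b
    unfolding H by (rule cSUP_least[OF ne that])
  have pf: "\<bar>p0 \<bullet> f x0 y a\<bar> \<le> norm p0 * Q0" if "a \<in> A" for y a
    using Cauchy_Schwarz_ineq2[of p0 "f x0 y a"] mult_left_mono[OF Q0[OF that, of x0 y], of "norm p0"] by simp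
  show ?thesis
  proof
    show "continuous_on UNIV (\<lambda>(y, q). hamiltonian f g l A x0 y p0 q)"
    proof -
      have "continuous_on UNIV (\<lambda>p. SUP a\<in>A. h p a)" by (rule continuous_on_SUP_compact[OF A ne hc])
      then show ?thesis by (simp add: H case_prod_unfold)
    qed
  next
    fix y b
    show "convex {q. hamiltonian f g l A x0 y p0 q \<le> b}"
    proof (rule convexI)
      fix q q' and u v :: real
      assume q: "q \<in> {q. hamiltonian f g l A x0 y p0 q \<le> b}" "q' \<in> {q. hamiltonian f g l A x0 y p0 q \<le> b}"
        and uv: "0 \<le> u" "0 \<le> v" "u + v = 1"
      have "h (y, u *\<^sub>R q + v *\<^sub>R q') a \<le> b" if a: "a \<in> A" for a
      proof -
        have qb: "h (y, q) a \<le> b" "h (y, q') a \<le> b" using q up[OF a, of y q] up[OF a, of y q'] by auto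
        have u: "u = 1 - v" using uv by simp
        have "h (y, u *\<^sub>R q + v *\<^sub>R q') a = u * h (y, q) a + v * h (y, q') a"
          unfolding u by (simp add: h_def inner_add_left algebra_simps)
        also have "\<dots> \<le> u * b + v * b" using qb uv by (intro add_mono mult_left_mono)
        also have "\<dots> = b" using uv by (simp flip: distrib_right)
        finally show ?thesis .
      qed
      then show "u *\<^sub>R q + v *\<^sub>R q' \<in> {q. hamiltonian f g l A x0 y p0 q \<le> b}" using least by simp
    qed
  next
    fix K :: "'m set" assume K: "compact K"
    have "compact ({x0} \<times> K)" using K by (intro compact_Times) auto
    from hull[OF this] obtain r where r: "r > 0"
      "\<forall>(x, y)\<in>{x0} \<times> K. ball 0 r \<subseteq> closure (convex hull (g x y ` A))" by blast
    then have r2: "ball 0 r \<subseteq> closure (convex hull (g x0 y ` A))" if "y \<in> K" for y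
      using that by blast
    have "compact ((\<lambda>(y, a). l x0 y a) ` (K \<times> A))"
      by (intro compact_continuous_image continuous_on_subset[OF l'] compact_Times K A) auto
    then have "bdd_above ((\<lambda>(y, a). l x0 y a) ` (K \<times> A))" by (intro bounded_imp_bdd_above compact_imp_bounded)
    then obtain M where M: "\<And>y a. y \<in> K \<Longrightarrow> a \<in> A \<Longrightarrow> l x0 y a \<le> M" unfolding bdd_above_def by force
    have "r / 2 * norm q - (norm p0 * Q0 + M) \<le> hamiltonian f g l A x0 y p0 q" if y: "y \<in> K" for y q
    proof -
      obtain a where a: "a \<in> A" "r / 2 * norm q \<le> - (q \<bullet> g x0 y a)"
        using ball_hull_direction[OF r(1) r2[OF y], of q] ne by auto
      then show ?thesis using up[OF a(1), of y q] pf[OF a(1), of y] M[OF y a(1)] by (simp add: h_def)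
    qed
    then show "\<exists>r>0. \<exists>C. \<forall>y\<in>K. \<forall>q. r * norm q - C \<le> hamiltonian f g l A x0 y p0 q"
      using r(1) by (intro exI[of _ "r / 2"]) auto
  next
    show "filterlim (\<lambda>y. hamiltonian f g l A x0 y p0 0) at_bot at_infinity"
      unfolding filterlim_at_bot
    proof
      fix T :: real
      have "\<forall>\<^sub>F y in at_infinity. norm p0 * Q0 - T \<le> (INF (x, a)\<in>{x0} \<times> A. l x y a)"
        using linf[of "{x0}"] unfolding filterlim_at_top by auto
      then show "\<forall>\<^sub>F y in at_infinity. hamiltonian f g l A x0 y p0 0 \<le> T"
      proof (rule eventually_mono)
        fix y assume y: "norm p0 * Q0 - T \<le> (INF (x, a)\<in>{x0} \<times> A. l x y a)"
        have "continuous_on A (\<lambda>a. (y, a))" by (intro continuous_intros)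
        from continuous_on_compose2[OF l' this] have "continuous_on A (l x0 y)" by auto
        then have "bdd_below (l x0 y ` A)"
          by (intro bounded_imp_bdd_below compact_imp_bounded compact_continuous_image A)
        moreover have "(\<lambda>(x, a). l x y a) ` ({x0} \<times> A) = l x0 y ` A" by force
        ultimately have "(INF (x, a)\<in>{x0} \<times> A. l x y a) \<le> l x0 y a" if "a \<in> A" for a
          using that by (simp add: cINF_lower)
        with y have ly: "norm p0 * Q0 - T \<le> l x0 y a" if "a \<in> A" for a using that by (meson order_trans)
        show "hamiltonian f g l A x0 y p0 0 \<le> T"
        proof (rule least)
          fix a assume a: "a \<in> A"
          show "h (y, 0) a \<le> T" using pf[OF a, of y] ly[OF a] by (simp add: h_def abs_le_iff)
        qed
      qed
    qed
  next
    have "continuous_on A (\<lambda>a. (0, a))" by (intro continuous_intros)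
    from continuous_on_compose2[OF g' this] have "continuous_on A (g x0 0)" by auto
    then have "bounded (g x0 0 ` A)" by (intro compact_imp_bounded compact_continuous_image A)
    then obtain G where G: "\<And>a. a \<in> A \<Longrightarrow> norm (g x0 0 a) \<le> G" unfolding bounded_iff by blast
    have "hamiltonian f g l A x0 y p0 q
        \<le> hamiltonian f g l A x0 y p0 0 + (\<bar>G\<bar> + L0) * (1 + norm y) * norm q" for y q
    proof (rule least)
      fix a assume a: "a \<in> A"
      have "norm (g x0 y a) \<le> norm (g x0 0 a) + norm (g x0 y a - g x0 0 a)" by (rule norm_triangle_sub)
      also have "\<dots> \<le> G + L0 * norm y" using G[OF a] lip[OF a, of x0 y x0 0] by simp
      also have "\<dots> \<le> (\<bar>G\<bar> + L0) * (1 + norm y)"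
      proof -
        have "G \<le> \<bar>G\<bar>" "0 \<le> \<bar>G\<bar> * norm y" by simp_all
        moreover have "(\<bar>G\<bar> + L0) * (1 + norm y) = \<bar>G\<bar> + \<bar>G\<bar> * norm y + L0 + L0 * norm y"
          by (simp add: algebra_simps)
        ultimately show ?thesis using L0 by linarith
      qed
      finally have "norm q * norm (g x0 y a) \<le> norm q * ((\<bar>G\<bar> + L0) * (1 + norm y))"
        by (rule mult_left_mono) simp
      moreover have "- (q \<bullet> g x0 y a) \<le> norm q * norm (g x0 y a)"
        using Cauchy_Schwarz_ineq2[of q "g x0 y a"] by (simp add: abs_le_iff)
      moreover have "h (y, q) a = h (y, 0) a - q \<bullet> g x0 y a" by (simp add: h_def)
      ultimately show "h (y, q) a \<le> hamiltonian f g l A x0 y p0 0 + (\<bar>G\<bar> + L0) * (1 + norm y) * norm q"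
        using up[OF a, of y 0] by (simp add: mult.commute)
    qed
    then show "\<exists>C. \<forall>y q. hamiltonian f g l A x0 y p0 q
        \<le> hamiltonian f g l A x0 y p0 0 + C * (1 + norm y) * norm q" by blast
  qed
qed

theorem proposition3p9:
  fixes f :: "'n::euclidean_space \<Rightarrow> 'm::euclidean_space \<Rightarrow> 'a::euclidean_space \<Rightarrow> 'n"
    and g :: "'n \<Rightarrow> 'm \<Rightarrow> 'a \<Rightarrow> 'm"
    and l :: "'n \<Rightarrow> 'm \<Rightarrow> 'a \<Rightarrow> real"
    and A :: "'a set"
    and L0 Q0 :: real
    and x0 p0 :: 'n
    and H0 :: "'m \<Rightarrow> 'm \<Rightarrow> real"
    and y0 :: 'm
  assumes "compact A"
    and "continuous_on (UNIV \<times> UNIV \<times> A) (\<lambda>(x, y, a). f x y a)"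
    and "continuous_on (UNIV \<times> UNIV \<times> A) (\<lambda>(x, y, a). g x y a)"
    and "continuous_on (UNIV \<times> UNIV \<times> A) (\<lambda>(x, y, a). l x y a)"
    and "L0 > 0"
    and "\<And>x1 y1 x2 y2 a. a \<in> A \<Longrightarrow>
           norm (f x1 y1 a - f x2 y2 a) \<le> L0 * (norm (x1 - x2) + norm (y1 - y2))"
    and "\<And>x1 y1 x2 y2 a. a \<in> A \<Longrightarrow>
           norm (g x1 y1 a - g x2 y2 a) \<le> L0 * (norm (x1 - x2) + norm (y1 - y2))"
    and "\<And>x y a. a \<in> A \<Longrightarrow> norm (f x y a) \<le> Q0"
    and "\<And>K. compact K \<Longrightarrow>
           \<exists>r>0. \<forall>(x, y)\<in>K. ball 0 r \<subseteq> closure (convex hull (g x y ` A))"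
    and "\<And>B. compact B \<Longrightarrow> B \<noteq> {} \<Longrightarrow>
           filterlim (\<lambda>y. INF (x, a)\<in>B \<times> A. l x y a) at_top at_infinity"
    and "H0 = (\<lambda>y q. hamiltonian f g l A x0 y p0 q)"
    and "y0 \<in> aubry_set H0"
  shows "filterlim (\<lambda>y. intrinsic_dist H0 y0 y) at_top at_infinity \<and>
         viscosity_solution H0 (critical_value H0) UNIV (\<lambda>y. intrinsic_dist H0 y0 y)"
proof -
  interpret coercive_hamiltonian H0
    unfolding assms(11) by (rule hamiltonian_coercive) (fact assms)+
  show ?thesis
    using intrinsic_dist_coercive[of y0] intrinsic_dist_solution[OF assms(12)] by simp
qed

end
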